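(* Let $\mathbb{K}=\mathbb{R}$ or $\mathbb{C}$, let $n\ge 2$ and $m\ge 1$ be integers, let $G=GL(n,\mathbb{K})$, and let $P$ be the maximal parabolic subgroup of $G$ such that $G/P\cong\mathbb{P}^{n-1}\mathbb{K}$. There is a well-defined surjection $$\pi\colon \mathrm{diag}(G)\backslash G^m/P^m\twoheadrightarrow \mathcal{P}_{n,m}$$ onto the finite set $\mathcal{P}_{n,m}$, sending the orbit $\mathrm{diag}(G)\cdot F$ to the unique $p\in\mathcal{P}_{n,m}$ such that $F$ is $p$-constructible, with the following property: for each element $$p=\left(\{I_a\}_{a=1}^{A},\{J_b\}_{b=1}^{B},\{(K_c,r_c)\}_{c=1}^{C}\right)\in\mathcal{P}_{n,m},$$ the map $$\prod_{c=1}^{C}(\mathbb{P}^{r_c-1}\mathbb{K})^{\#K_c-r_c-1}\longrightarrow \pi^{-1}(p),\qquad q\mapsto \mathrm{diag}(G)\cdot F(p,q)$$ is an open dense embedding (i.e. a homeomorphism onto an open dense subset of the fibre $\pi^{-1}(p)$).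
   Context: Notation: $\mathbb{N}=\{0,1,2,\ldots\}$; all vector spaces are over $\mathbb{K}$ and finite-dimensional. $\mathrm{diag}(G)\subset G^m$ is the diagonal subgroup. Projective spaces have their usual (Hausdorff) topology, orbit spaces the quotient topology, and fibres the subspace topology. Multiple flags. Let $\mathbf{d}=(r;d^{(1)},\ldots,d^{(m)})$ be non-negative integers with $d^{(i)}\le r$. For an $r$-dimensional vector space $V$, $Fl_{\mathbf{d}}(V)=\prod_{i=1}^m\mathrm{Gr}_{d^{(i)}}(V)$, with elements written $(V;V^{(1)},\ldots,V^{(m)})$, $V^{(i)}\subset V$ of dimension $d^{(i)}$. Such an element is called an $m$-tuple flag of dimension $\mathbf{d}$ (written $\dim D=\mathbf{d}$). Direct sum: $(V;V^{(i)})_i\oplus(W;W^{(i)})_i=(V\oplus W;V^{(i)}\oplus W^{(i)})_i$. Two $m$-tuple flags $(V;V^{(i)})_i$, $(W;W^{(i)})_i$ are isomorphic if there is a linear isomorphism $f\colon V\to W$ with $f(V^{(i)})=W^{(i)}$ for all $i$. An $m$-tuple flag is indecomposable if it is not isomorphic to a direct sum of two non-trivial ones (trivial means dimension $(0;0,\ldots,0)$). $G^m/P^m$ is identified with $Fl_{(n;1,\ldots,1)}(\mathbb{K}^n)=(\mathbb{P}^{n-1}\mathbb{K})^m$, with $G$ acting diagonally; two elements are in the same $\mathrm{diag}(G)$-orbit iff they are isomorphic, so any $m$-tuple flag of dimension $(n;1,\ldots,1)$ determines a $\mathrm{diag}(G)$-orbit after identifying its whole space with $\mathbb{K}^n$ by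 a linear isomorphism. For $K\subset\{1,\ldots,m\}$ and $r\in\mathbb{N}$ put $\mathbf{d}(K,r)=(r;\delta_{1,K},\ldots,\delta_{m,K})$, where $\delta_{i,K}=1$ if $i\in K$ and $0$ otherwise. The set $\mathcal{P}_{n,m}$: all tuples $p=(\{I_a\}_{a=1}^{A},\{J_b\}_{b=1}^{B},\{(K_c,r_c)\}_{c=1}^{C})$ (unordered families, each possibly empty) such that $\{1,\ldots,m\}$ is the disjoint union of all the $I_a$, $J_b$, $K_c$; $\#I_a\ge1$, $\#J_b\ge 3$, $r_c\in\mathbb{N}$, $4\le r_c+2\le \#K_c$ for all $a,b,c$; and $0\le r(p)\le n$, where $r(p):=A+\sum_{b=1}^B(\#J_b-1)+\sum_{c=1}^C r_c$. $p$-constructible: for $p=(\{I_a\}_{a=1}^{A},\{J_b\}_{b=1}^{B},\{(K_c,r_c)\}_{c=1}^{C})\in\mathcal{P}_{n,m}$, an $m$-tuple flag $F$ is $p$-constructible if $F$ is isomorphic to $\bigoplus_{k=1}^{n-r(p)}F_{\emptyset,k}\oplus\bigoplus_{a=1}^A F_a\oplus\bigoplus_{b=1}^B D_b\oplus\bigoplus_{c=1}^C E_c$ with all summands indecomposable $m$-tuple flags and $\dim F_{\emptyset,k}=\mathbf{d}(\emptyset,1)$, $\dim F_a=\mathbf{d}(I_a,1)$, $\dim D_b=\mathbf{d}(J_b,\#J_b-1)$, $\dim E_c=\mathbf{d}(K_c,r_c)$. Representatives. Let $e_1,\ldots,e_r$ be the standard basis of $\mathbb{K}^r$. - For $I\subset\{1,\ldots,m\}$: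 $F(I)=(\mathbb{K};V^{(i)})_i$ with $V^{(i)}=\mathbb{K}$ if $i\in I$, $0$ otherwise. - For $J=\{j_1<\cdots<j_{r+1}\}\subset\{1,\ldots,m\}$ with $r\ge2$: $D(J)=(\mathbb{K}^r;V^{(i)})_i$ with $V^{(j_h)}=\mathbb{K}e_h$ for $1\le h\le r$, $V^{(j_{r+1})}=\mathbb{K}\sum_{h=1}^r e_h$, and $V^{(i)}=0$ for $i\notin J$. - For $K=\{k_1<\cdots<k_{\#K}\}\subset\{1,\ldots,m\}$, an integer $r$ with $4\le r+2\le\#K$, and $q=(q^{(r+2)},\ldots,q^{(\#K)})\in(\mathbb{P}^{r-1}\mathbb{K})^{\#K-r-1}$: $E(K,r,q)=(\mathbb{K}^r;V^{(i)})_i$ with $V^{(k_h)}=\mathbb{K}e_h$ for $1\le h\le r$, $V^{(k_{r+1})}=\mathbb{K}\sum_{h=1}^re_h$, $V^{(k_h)}=q^{(h)}$ for $r+2\le h\le\#K$, and $V^{(i)}=0$ for $i\notin K$. - For $p=(\{I_a\}_{a=1}^{A},\{J_b\}_{b=1}^{B},\{(K_c,r_c)\}_{c=1}^{C})\in\mathcal{P}_{n,m}$ and $q=(q_1,\ldots,q_C)\in\prod_{c=1}^C(\mathbb{P}^{r_c-1}\mathbb{K})^{\#K_c-r_c-1}$: $F(p,q)=F(\emptyset)^{\oplus(n-r(p))}\oplus\bigoplus_{a=1}^AF(I_a)\oplus\bigoplus_{b=1}^BD(J_b)\oplus\bigoplus_{c=1}^CE(K_c,r_c,q_c)$, which has dimension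 $(n;1,\ldots,1)$. *)

theory Defs
  imports "HOL-Analysis.Analysis" "HOL-Library.Function_Algebras" "HOL-Library.Disjoint_Sets"
begin

section \<open>Vector spaces of functions\<close>

text \<open>
  All vector spaces over a field \<open>'k\<close> are taken inside function spaces \<open>'x \<Rightarrow> 'k\<close> with the pointwise
  operations.  Every finite-dimensional vector space is isomorphic to a subspace of \<open>nat \<Rightarrow> 'k\<close>;
  other index types \<open>'x\<close> arise from external direct sums.
\<close>

definition fscale :: "'k::field \<Rightarrow> ('x \<Rightarrow> 'k) \<Rightarrow> 'x \<Rightarrow> 'k" where
  "fscale c v = (\<lambda>x. c * v x)"

global_interpretation fvs: vector_space "fscale :: 'k::field \<Rightarrow> ('x \<Rightarrow> 'k) \<Rightarrow> 'x \<Rightarrow> 'k"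
  by unfold_locales (auto simp: fscale_def fun_eq_iff algebra_simps)

definition lin_iso :: "(('x \<Rightarrow> 'k::field) \<Rightarrow> ('y \<Rightarrow> 'k)) \<Rightarrow> ('x \<Rightarrow> 'k) set \<Rightarrow> ('y \<Rightarrow> 'k) set \<Rightarrow> bool" where
  "lin_iso f V W \<longleftrightarrow> bij_betw f V W
     \<and> (\<forall>x\<in>V. \<forall>y\<in>V. f (x + y) = f x + f y)
     \<and> (\<forall>c. \<forall>x\<in>V. f (fscale c x) = fscale c (f x))"

text \<open>\<open>Kpow r\<close> is $K^r$, with coordinates numbered \<open>1, \<dots>, r\<close> and standard basis \<open>unit_vec 1, \<dots>, unit_vec r\<close>.\<close>

definition Kpow :: "nat \<Rightarrow> (nat \<Rightarrow> 'k::field) set" where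
  "Kpow r = {v. \<forall>i. i \<notin> {1..r} \<longrightarrow> v i = 0}"

definition unit_vec :: "nat \<Rightarrow> nat \<Rightarrow> 'k::field" where
  "unit_vec h = (\<lambda>i. if i = h then 1 else 0)"


section \<open>Multiple flags\<close>

text \<open>Only the components \<open>part D i\<close> with \<open>i \<in> {1..m}\<close> of an \<open>m\<close>-tuple flag \<open>D\<close> are significant.\<close>

record 'v mflag =
  whole :: "'v set"
  part :: "nat \<Rightarrow> 'v set"

definition is_mflag :: "nat \<Rightarrow> ('x \<Rightarrow> 'k::field) mflag \<Rightarrow> bool" where
  "is_mflag m D \<longleftrightarrow> (\<exists>B. finite B \<and> fvs.span B = whole D)
     \<and> (\<forall>i\<in>{1..m}. fvs.subspace (part D i) \<and> part D i \<subseteq> whole D)"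

definition has_dim :: "nat \<Rightarrow> ('x \<Rightarrow> 'k::field) mflag \<Rightarrow> nat \<times> (nat \<Rightarrow> nat) \<Rightarrow> bool" where
  "has_dim m D d \<longleftrightarrow> is_mflag m D \<and> fvs.dim (whole D) = fst d
     \<and> (\<forall>i\<in>{1..m}. fvs.dim (part D i) = snd d i)"

definition dvec :: "nat set \<Rightarrow> nat \<Rightarrow> nat \<times> (nat \<Rightarrow> nat)" where
  "dvec K r = (r, \<lambda>i. if i \<in> K then 1 else 0)"

definition mflag_iso :: "nat \<Rightarrow> ('x \<Rightarrow> 'k::field) mflag \<Rightarrow> ('y \<Rightarrow> 'k) mflag \<Rightarrow> bool" where
  "mflag_iso m D E \<longleftrightarrow>
     (\<exists>f. lin_iso f (whole D) (whole E) \<and> (\<forall>i\<in>{1..m}. f ` part D i = part E i))"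

text \<open>Vectors of \<open>V \<oplus> W\<close> are functions on the disjoint union of the two index types.\<close>

definition vsum :: "('x \<Rightarrow> 'k) set \<Rightarrow> ('y \<Rightarrow> 'k) set \<Rightarrow> ('x + 'y \<Rightarrow> 'k) set" where
  "vsum V W = {v. v \<circ> Inl \<in> V \<and> v \<circ> Inr \<in> W}"

definition mflag_sum :: "('x \<Rightarrow> 'k) mflag \<Rightarrow> ('y \<Rightarrow> 'k) mflag \<Rightarrow> ('x + 'y \<Rightarrow> 'k) mflag"
    (infixr \<open>\<oplus>\<^sub>F\<close> 65) where
  "D \<oplus>\<^sub>F E = \<lparr>whole = vsum (whole D) (whole E), part = (\<lambda>i. vsum (part D i) (part E i))\<rparr>"

definition vSum :: "'s set \<Rightarrow> ('s \<Rightarrow> ('x \<Rightarrow> 'k::field) set) \<Rightarrow> ('s \<times> 'x \<Rightarrow> 'k) set" where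
  "vSum S V = {v. (\<forall>s\<in>S. (\<lambda>x. v (s, x)) \<in> V s) \<and> (\<forall>s x. s \<notin> S \<longrightarrow> v (s, x) = 0)}"

definition mflag_Sum :: "'s set \<Rightarrow> ('s \<Rightarrow> ('x \<Rightarrow> 'k::field) mflag) \<Rightarrow> ('s \<times> 'x \<Rightarrow> 'k) mflag" where
  "mflag_Sum S D = \<lparr>whole = vSum S (\<lambda>s. whole (D s)), part = (\<lambda>i. vSum S (\<lambda>s. part (D s) i))\<rparr>"

definition trivial_mflag :: "nat \<Rightarrow> ('x \<Rightarrow> 'k::field) mflag \<Rightarrow> bool" where
  "trivial_mflag m D \<longleftrightarrow> has_dim m D (0, \<lambda>i. 0)"

definition indecomposable :: "nat \<Rightarrow> ('x \<Rightarrow> 'k::field) mflag \<Rightarrow> bool" where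
  "indecomposable m D \<longleftrightarrow> is_mflag m D \<and>
     \<not> (\<exists>(D1 :: (nat \<Rightarrow> 'k) mflag) (D2 :: (nat \<Rightarrow> 'k) mflag). is_mflag m D1 \<and> is_mflag m D2
          \<and> \<not> trivial_mflag m D1 \<and> \<not> trivial_mflag m D2 \<and> mflag_iso m D (D1 \<oplus>\<^sub>F D2))"


section \<open>The index set and constructibility\<close>

text \<open>
  The members of a family occurring in an element of the index set are nonempty and pairwise
  disjoint, hence distinct, so that an unordered family is the same thing as a set.
\<close>

type_synonym ptuple = "nat set set \<times> nat set set \<times> (nat set \<times> nat) set"

definition rank_p :: "ptuple \<Rightarrow> nat" where
  "rank_p = (\<lambda>(Is, Js, Ks). card Is + (\<Sum>J\<in>Js. card J - 1) + (\<Sum>(K, r)\<in>Ks. r))"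

definition Pset :: "nat \<Rightarrow> nat \<Rightarrow> ptuple set" where
  "Pset n m = {(Is, Js, Ks).
      disjoint_family_on (case_sum id (case_sum id fst)) (Is <+> (Js <+> Ks))
    \<and> \<Union>Is \<union> \<Union>Js \<union> \<Union>(fst ` Ks) = {1..m}
    \<and> (\<forall>I\<in>Is. 1 \<le> card I) \<and> (\<forall>J\<in>Js. 3 \<le> card J)
    \<and> (\<forall>(K, r)\<in>Ks. 4 \<le> r + 2 \<and> r + 2 \<le> card K)
    \<and> rank_p (Is, Js, Ks) \<le> n}"

definition constructible :: "nat \<Rightarrow> nat \<Rightarrow> ptuple \<Rightarrow> ('x \<Rightarrow> 'k::field) mflag \<Rightarrow> bool" where
  "constructible n m = (\<lambda>(Is, Js, Ks) F.
     \<exists>(F0 :: nat \<Rightarrow> (nat \<Rightarrow> 'k) mflag) (Fa :: nat set \<Rightarrow> (nat \<Rightarrow> 'k) mflag)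
      (D :: nat set \<Rightarrow> (nat \<Rightarrow> 'k) mflag) (E :: nat set \<times> nat \<Rightarrow> (nat \<Rightarrow> 'k) mflag).
        (\<forall>k\<in>{1..n - rank_p (Is, Js, Ks)}. indecomposable m (F0 k) \<and> has_dim m (F0 k) (dvec {} 1))
      \<and> (\<forall>I\<in>Is. indecomposable m (Fa I) \<and> has_dim m (Fa I) (dvec I 1))
      \<and> (\<forall>J\<in>Js. indecomposable m (D J) \<and> has_dim m (D J) (dvec J (card J - 1)))
      \<and> (\<forall>(K, r)\<in>Ks. indecomposable m (E (K, r)) \<and> has_dim m (E (K, r)) (dvec K r))
      \<and> mflag_iso m F
          (mflag_Sum {1..n - rank_p (Is, Js, Ks)} F0 \<oplus>\<^sub>F mflag_Sum Is Fa \<oplus>\<^sub>F mflag_Sum Js D \<oplus>\<^sub>F mflag_Sum Ks E))"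


section \<open>Representatives\<close>

text \<open>If \<open>i\<close> is the \<open>h\<close>-th smallest element of \<open>J\<close>, then \<open>index_in J i = h\<close>.\<close>

definition index_in :: "nat set \<Rightarrow> nat \<Rightarrow> nat" where
  "index_in J i = card {j\<in>J. j \<le> i}"

definition Frep :: "nat set \<Rightarrow> (nat \<Rightarrow> 'k::field) mflag" where
  "Frep I = \<lparr>whole = Kpow 1, part = (\<lambda>i. if i \<in> I then Kpow 1 else {0})\<rparr>"

definition Drep :: "nat set \<Rightarrow> (nat \<Rightarrow> 'k::field) mflag" where
  "Drep J = (let r = card J - 1 in
     \<lparr>whole = Kpow r,
      part = (\<lambda>i. if i \<notin> J then {0}
                  else if index_in J i \<le> r then fvs.span {unit_vec (index_in J i)}
                  else fvs.span {\<Sum>h=1..r. unit_vec h})\<rparr>)"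

definition Erep :: "nat set \<Rightarrow> nat \<Rightarrow> (nat \<Rightarrow> (nat \<Rightarrow> 'k::field) set) \<Rightarrow> (nat \<Rightarrow> 'k) mflag" where
  "Erep K r q =
     \<lparr>whole = Kpow r,
      part = (\<lambda>i. if i \<notin> K then {0}
                  else if index_in K i \<le> r then fvs.span {unit_vec (index_in K i)}
                  else if index_in K i = r + 1 then fvs.span {\<Sum>h=1..r. unit_vec h}
                  else q (index_in K i))\<rparr>"

definition Fpq :: "nat \<Rightarrow> ptuple \<Rightarrow> (nat set \<times> nat \<Rightarrow> nat \<Rightarrow> (nat \<Rightarrow> 'k::field) set) \<Rightarrow>
    ((nat \<times> nat) + (nat set \<times> nat) + (nat set \<times> nat) + ((nat set \<times> nat) \<times> nat) \<Rightarrow> 'k) mflag" where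
  "Fpq n = (\<lambda>(Is, Js, Ks) q.
     mflag_Sum {1..n - rank_p (Is, Js, Ks)} (\<lambda>k. Frep {}) \<oplus>\<^sub>F mflag_Sum Is Frep
     \<oplus>\<^sub>F mflag_Sum Js Drep \<oplus>\<^sub>F mflag_Sum Ks (\<lambda>(K, r). Erep K r (q (K, r))))"


section \<open>Projective spaces, orbits and topologies\<close>

definition quotient_topology :: "'a topology \<Rightarrow> ('a \<Rightarrow> 'b) \<Rightarrow> 'b topology" where
  "quotient_topology X f =
     topology (\<lambda>U. U \<subseteq> f ` topspace X \<and> openin X {x \<in> topspace X. f x \<in> U})"

lemma openin_quotient_topology:
  "openin (quotient_topology X f) U \<longleftrightarrow> U \<subseteq> f ` topspace X \<and> openin X {x \<in> topspace X. f x \<in> U}"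
proof -
  have "istopology (\<lambda>U. U \<subseteq> f ` topspace X \<and> openin X {x \<in> topspace X. f x \<in> U})"
    unfolding istopology_def
  proof (intro conjI allI impI)
    fix S T assume S: "S \<subseteq> f ` topspace X \<and> openin X {x \<in> topspace X. f x \<in> S}"
      and T: "T \<subseteq> f ` topspace X \<and> openin X {x \<in> topspace X. f x \<in> T}"
    have "{x \<in> topspace X. f x \<in> S \<inter> T} = {x \<in> topspace X. f x \<in> S} \<inter> {x \<in> topspace X. f x \<in> T}"
      by auto
    then show "openin X {x \<in> topspace X. f x \<in> S \<inter> T}" using S T by auto
    show "S \<inter> T \<subseteq> f ` topspace X" using S by auto
  next
    fix \<U> assume U: "\<forall>U\<in>\<U>. U \<subseteq> f ` topspace X \<and> openin X {x \<in> topspace X. f x \<in> U}"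
    have "{x \<in> topspace X. f x \<in> \<Union>\<U>} = (\<Union>U\<in>\<U>. {x \<in> topspace X. f x \<in> U})" by auto
    then show "openin X {x \<in> topspace X. f x \<in> \<Union>\<U>}" using U by auto
    show "\<Union>\<U> \<subseteq> f ` topspace X" using U by auto
  qed
  then show ?thesis unfolding quotient_topology_def by (simp add: topology_inverse')
qed

lemma topspace_quotient_topology [simp]: "topspace (quotient_topology X f) = f ` topspace X"
proof -
  have "{x \<in> topspace X. f x \<in> f ` topspace X} = topspace X" by auto
  then have "openin (quotient_topology X f) (f ` topspace X)"
    by (simp add: openin_quotient_topology)
  moreover have "topspace (quotient_topology X f) \<subseteq> f ` topspace X"
    using openin_topspace[of "quotient_topology X f"] unfolding openin_quotient_topology by blast
  ultimately show ?thesis using openin_subset by blast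
qed

lemma quotient_map_quotient_topology: "quotient_map X (quotient_topology X f) f"
  unfolding quotient_map_def by (auto simp: openin_quotient_topology)

text \<open>
  The points of \<open>Proj r\<close> are the lines in $K^r$, so this is $\mathbf{P}^{r-1}K$.
  The topology on \<open>Kpow r\<close> induced from the product topology of \<open>nat \<Rightarrow> 'k\<close> is the usual one.
\<close>

definition Proj :: "nat \<Rightarrow> (nat \<Rightarrow> 'k::{field,topological_space}) set topology" where
  "Proj r = quotient_topology (top_of_set (Kpow r - {0})) (\<lambda>v. fvs.span {v})"

text \<open>\<open>Tuples n m\<close> is $(\mathbf{P}^{n-1}K)^m$, i.e. $G^m/P^m$.\<close>

definition Tuples :: "nat \<Rightarrow> nat \<Rightarrow> (nat \<Rightarrow> (nat \<Rightarrow> 'k::{field,topological_space}) set) topology" where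
  "Tuples n m = product_topology (\<lambda>i. Proj n) {1..m}"

definition tuple_flag :: "nat \<Rightarrow> (nat \<Rightarrow> (nat \<Rightarrow> 'k::field) set) \<Rightarrow> (nat \<Rightarrow> 'k) mflag" where
  "tuple_flag n F = \<lparr>whole = Kpow n, part = F\<rparr>"

definition GL :: "nat \<Rightarrow> ((nat \<Rightarrow> 'k::field) \<Rightarrow> (nat \<Rightarrow> 'k)) set" where
  "GL n = {g \<in> extensional (Kpow n). lin_iso g (Kpow n) (Kpow n)}"

definition diag_orbit :: "nat \<Rightarrow> nat \<Rightarrow> (nat \<Rightarrow> (nat \<Rightarrow> 'k::field) set) \<Rightarrow> (nat \<Rightarrow> (nat \<Rightarrow> 'k) set) set" where
  "diag_orbit n m F = {(\<lambda>i\<in>{1..m}. g ` F i) | g. g \<in> GL n}"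

definition OrbitSpace :: "nat \<Rightarrow> nat \<Rightarrow> (nat \<Rightarrow> (nat \<Rightarrow> 'k::{field,topological_space}) set) set topology" where
  "OrbitSpace n m = quotient_topology (Tuples n m) (diag_orbit n m)"

text \<open>
  The orbit determined by an \<open>m\<close>-tuple flag of dimension \<open>(n; 1, \<dots>, 1)\<close> consists of all the tuples
  obtained from it by identifying its whole space with $K^n$.
\<close>

definition mflag_orbit :: "nat \<Rightarrow> nat \<Rightarrow> ('x \<Rightarrow> 'k::field) mflag \<Rightarrow> (nat \<Rightarrow> (nat \<Rightarrow> 'k) set) set" where
  "mflag_orbit n m D = {(\<lambda>i\<in>{1..m}. f ` part D i) | f. lin_iso f (whole D) (Kpow n)}"

text \<open>The component \<open>q (K, r)\<close> of a parameter is a tuple of lines indexed by \<open>h = r + 2, \<dots>, #K\<close>.\<close>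

definition Params :: "ptuple \<Rightarrow> (nat set \<times> nat \<Rightarrow> nat \<Rightarrow> (nat \<Rightarrow> 'k::{field,topological_space}) set) topology" where
  "Params = (\<lambda>(Is, Js, Ks).
     product_topology (\<lambda>(K, r). product_topology (\<lambda>h. Proj r) {r + 2..card K}) Ks)"

definition open_dense_embedding :: "'a topology \<Rightarrow> 'b topology \<Rightarrow> ('a \<Rightarrow> 'b) \<Rightarrow> bool" where
  "open_dense_embedding X Y f \<longleftrightarrow> embedding_map X Y f
     \<and> openin Y (f ` topspace X) \<and> Y closure_of (f ` topspace X) = topspace Y"

end

theory Submission
  imports Defs
begin

text \<open>
  Choose a vector \<open>v i\<close> in each line.  A decomposition of the flag into indecomposables is the partition
  of $\{1,\dots,m\}$ into the connected components of the matroid of these vectors: a block \<open>K\<close> splits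
  off iff its span meets the span of the remaining vectors trivially, and two connected blocks that split
  off are equal or disjoint.  This determines \<open>p\<close>.  Whenever the first $r+1$ vectors of a block of rank
  \<open>r\<close> form a circuit, they can be rescaled so that the last one is the sum of the others, which form a
  basis; the coordinates of the other vectors in this basis, up to scalars, are the parameter \<open>q\<close>, and
  it depends continuously on \<open>v\<close>.  The circuit condition is open, and dense within a fibre because the
  vectors can be moved one after the other inside the span of their block.  As \<open>v \<mapsto>\<close> orbit is an open
  map, the statement about the fibre can be checked on the space of vector tuples.
\<close>

section \<open>Independent families, spans and linear maps on subspaces of function spaces\<close>

section \<open>Linear algebra in function spaces\<close>

text \<open>As simp rules these two would rewrite sums of vectors into pointwise form.\<close>

declare plus_fun_apply [simp del] zero_fun_apply [simp del]

text \<open>Splittings of a flag correspond to separators because of one observation: if a line is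
  the direct sum of its parts in two summands, then it lies in one of the summands. This makes
  uniqueness of \<open>p\<close> a statement about connected separators, with no general uniqueness
  theorem for decompositions.

  The orbit space is in general not Hausdorff, and neither are its fibres, so compactness of the
  parameter space cannot give the embedding. Instead the inverse is written down on vector tuples,
  where limits of coefficients can be computed, and pushed down along an open map. Openness comes
  from a group: a saturation is a union of preimages under the maps given by an element of GL(n) and
  a rescaling of each vector.

  The image is open and dense but not always the whole fibre, since the circuit condition singles
  out the first \<open>r + 1\<close> indices of a block: in a connected block two of these vectors
  may be parallel.

  The classification and the normal forms work over any field. A norm enters only with the topology,
  where an approximate dual basis replaces determinants.\<close>

definition indep_fam :: "'i set \<Rightarrow> ('i \<Rightarrow> 'x \<Rightarrow> 'k::field) \<Rightarrow> bool" where
  "indep_fam T u \<longleftrightarrow> (\<forall>c. (\<Sum>t\<in>T. fscale (c t) (u t)) = 0 \<longrightarrow> (\<forall>t\<in>T. c t = 0))"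

definition lin_on :: "(('x \<Rightarrow> 'k::field) \<Rightarrow> ('y \<Rightarrow> 'k)) \<Rightarrow> ('x \<Rightarrow> 'k) set \<Rightarrow> bool" where
  "lin_on f V \<longleftrightarrow> (\<forall>x\<in>V. \<forall>y\<in>V. f (x + y) = f x + f y) \<and> (\<forall>c. \<forall>x\<in>V. f (fscale c x) = fscale c (f x))"

definition fin_dim :: "('x \<Rightarrow> 'k::field) set \<Rightarrow> bool" where
  "fin_dim V \<longleftrightarrow> (\<exists>B. finite B \<and> fvs.span B = V)"

lemma fscale_apply: "fscale c v x = c * v x"
  by (simp add: fscale_def)

lemma sum_fun_apply: "(\<Sum>t\<in>T. f t) x = (\<Sum>t\<in>T. f t x)"
  by (induction T rule: infinite_finite_induct) (auto simp: plus_fun_apply zero_fun_apply)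

lemmas pointwise = fun_eq_iff fscale_apply sum_fun_apply plus_fun_apply zero_fun_apply

lemma span_fam:
  assumes "finite T"
  shows "fvs.span (u ` T) = {x. \<exists>c. x = (\<Sum>t\<in>T. fscale (c t) (u t))}"
  using assms
proof (induction T)
  case empty
  then show ?case by (auto simp: zero_fun_def)
next
  case (insert a T)
  have "(\<exists>k c. x = fscale k (u a) + (\<Sum>t\<in>T. fscale (c t) (u t)))
     \<longleftrightarrow> (\<exists>c. x = (\<Sum>t\<in>insert a T. fscale (c t) (u t)))" for x
  proof
    assume "\<exists>k c. x = fscale k (u a) + (\<Sum>t\<in>T. fscale (c t) (u t))"
    then obtain k c where x: "x = fscale k (u a) + (\<Sum>t\<in>T. fscale (c t) (u t))" by blast
    have "(\<Sum>t\<in>T. fscale ((c(a := k)) t) (u t)) = (\<Sum>t\<in>T. fscale (c t) (u t))"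
      using insert by (intro sum.cong) auto
    then have "x = (\<Sum>t\<in>insert a T. fscale ((c(a := k)) t) (u t))" using insert x by simp
    then show "\<exists>c. x = (\<Sum>t\<in>insert a T. fscale (c t) (u t))" by blast
  qed (use insert in auto)
  moreover have "(\<exists>k. x - fscale k (u a) \<in> {x. \<exists>c. x = (\<Sum>t\<in>T. fscale (c t) (u t))})
     \<longleftrightarrow> (\<exists>k c. x = fscale k (u a) + (\<Sum>t\<in>T. fscale (c t) (u t)))" for x
    by (simp add: diff_eq_eq add.commute)
  ultimately show ?case using insert.IH by (simp only: image_insert fvs.span_insert)
qed

lemma span_famE:
  assumes "finite T" "x \<in> fvs.span (u ` T)"
  obtains c where "x = (\<Sum>t\<in>T. fscale (c t) (u t))"
  using assms span_fam by blast

lemma indep_famD: "indep_fam T u \<Longrightarrow> (\<Sum>t\<in>T. fscale (c t) (u t)) = 0 \<Longrightarrow> t \<in> T \<Longrightarrow> c t = 0"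
  unfolding indep_fam_def by blast

lemma indep_fam_coeffs_eq:
  assumes "indep_fam T u" "(\<Sum>t\<in>T. fscale (c t) (u t)) = (\<Sum>t\<in>T. fscale (d t) (u t))" "t \<in> T"
  shows "c t = d t"
proof -
  have "(\<Sum>t\<in>T. fscale (c t - d t) (u t)) = 0"
    using assms(2) by (simp add: fvs.scale_left_diff_distrib sum_subtractf)
  then show ?thesis using indep_famD[OF assms(1), of "\<lambda>t. c t - d t"] assms(3) by auto
qed

lemma indep_fam_subset:
  assumes "indep_fam T u" "finite T" "S \<subseteq> T"
  shows "indep_fam S u"
  unfolding indep_fam_def
proof (intro allI impI ballI)
  fix c t assume c: "(\<Sum>t\<in>S. fscale (c t) (u t)) = 0" and t: "t \<in> S"
  have "(\<Sum>t\<in>T. fscale (if t \<in> S then c t else 0) (u t)) = (\<Sum>t\<in>S. fscale (if t \<in> S then c t else 0) (u t))"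
    using assms by (intro sum.mono_neutral_right) auto
  also have "\<dots> = 0" using c by simp
  finally show "c t = 0"
    using indep_famD[OF assms(1), of "\<lambda>t. if t \<in> S then c t else 0" t] t assms by auto
qed

lemma indep_fam_cong:
  assumes "\<And>t. t \<in> T \<Longrightarrow> u t = w t" shows "indep_fam T u \<longleftrightarrow> indep_fam T w"
  unfolding indep_fam_def by (simp add: assms cong: sum.cong)

lemma indep_fam_notin:
  assumes "indep_fam T u" "finite T" "h \<in> T"
  shows "u h \<notin> fvs.span (u ` (T - {h}))"
proof
  assume "u h \<in> fvs.span (u ` (T - {h}))"
  then obtain c where c: "u h = (\<Sum>t\<in>T - {h}. fscale (c t) (u t))" using span_famE assms(2) by (metis finite_Diff)
  have "(\<Sum>t\<in>T. fscale ((c(h := -1)) t) (u t)) = fscale (-1) (u h) + (\<Sum>t\<in>T - {h}. fscale ((c(h := -1)) t) (u t))"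
    using assms by (simp add: sum.remove)
  also have "(\<Sum>t\<in>T - {h}. fscale ((c(h := -1)) t) (u t)) = u h"
    unfolding c by (intro sum.cong) auto
  also have "fscale (-1) (u h) + u h = 0" by (simp add: pointwise)
  finally have "(\<Sum>t\<in>T. fscale ((c(h := -1)) t) (u t)) = 0" .
  from indep_famD[OF assms(1) this assms(3)] show False by simp
qed

lemma indep_fam_insert:
  assumes "indep_fam T u" "finite T" "u h \<notin> fvs.span (u ` T)"
  shows "indep_fam (insert h T) u"
  unfolding indep_fam_def
proof (intro allI impI)
  fix c assume c: "(\<Sum>t\<in>insert h T. fscale (c t) (u t)) = 0"
  have h: "h \<notin> T" using assms(3) by (meson fvs.span_base image_eqI)
  have e: "fscale (c h) (u h) + (\<Sum>t\<in>T. fscale (c t) (u t)) = 0" using c h assms(2) by simp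
  have "c h = 0"
  proof (rule ccontr)
    assume n: "c h \<noteq> 0"
    have "fscale (c h) (u h) = - (\<Sum>t\<in>T. fscale (c t) (u t))" using e by (simp add: eq_neg_iff_add_eq_0)
    then have "fscale (c h) (u h) \<in> fvs.span (u ` T)"
      by (simp add: fvs.span_base fvs.span_neg fvs.span_scale fvs.span_sum)
    then have "fscale (inverse (c h)) (fscale (c h) (u h)) \<in> fvs.span (u ` T)" by (rule fvs.span_scale)
    then show False using n assms(3) by simp
  qed
  then have "(\<Sum>t\<in>T. fscale (c t) (u t)) = 0" using e by simp
  then show "\<forall>t\<in>insert h T. c t = 0" using \<open>c h = 0\<close> assms(1) unfolding indep_fam_def by blast
qed

text \<open>Indexing matters: a family that repeats a vector is dependent although its set of values
  may be independent. This equivalence opens the basis theory for sets to indexed families.\<close>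

lemma indep_fam_iff:
  assumes "finite T"
  shows "indep_fam T u \<longleftrightarrow> inj_on u T \<and> fvs.independent (u ` T)"
proof
  assume i: "indep_fam T u"
  have inj: "inj_on u T"
  proof (rule inj_onI)
    fix s t assume *: "s \<in> T" "t \<in> T" "u s = u t"
    show "s = t"
    proof (rule ccontr)
      assume "s \<noteq> t"
      then have "u s \<in> u ` (T - {s})" using * by auto
      then show False using indep_fam_notin[OF i assms *(1)] by (simp add: fvs.span_base)
    qed
  qed
  moreover have "fvs.independent (u ` T)"
    unfolding fvs.dependent_def
  proof clarify
    fix t assume t: "t \<in> T" "u t \<in> fvs.span (u ` T - {u t})"
    have "u ` T - {u t} \<subseteq> u ` (T - {t})" by auto
    then have "u t \<in> fvs.span (u ` (T - {t}))" using t fvs.span_mono by blast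
    then show False using indep_fam_notin[OF i assms t(1)] by simp
  qed
  ultimately show "inj_on u T \<and> fvs.independent (u ` T)" by simp
next
  assume a: "inj_on u T \<and> fvs.independent (u ` T)"
  show "indep_fam T u"
    unfolding indep_fam_def
  proof (intro allI impI ballI)
    fix c t assume c: "(\<Sum>t\<in>T. fscale (c t) (u t)) = 0" and t: "t \<in> T"
    have "(\<Sum>x\<in>u ` T. fscale (c (the_inv_into T u x)) x) = (\<Sum>t\<in>T. fscale (c t) (u t))"
      using a by (simp add: sum.reindex the_inv_into_f_f)
    then have "c (the_inv_into T u (u t)) = 0"
      using c a t assms fvs.independentD[of "u ` T" "u ` T" "\<lambda>x. c (the_inv_into T u x)" "u t"] by auto
    then show "c t = 0" using a t by (simp add: the_inv_into_f_f)
  qed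
qed

lemma dim_span_indep_fam: "finite T \<Longrightarrow> indep_fam T u \<Longrightarrow> fvs.dim (fvs.span (u ` T)) = card T"
  by (simp add: indep_fam_iff fvs.dim_eq_card_independent card_image)

lemma fin_dim_subspace: "fin_dim V \<Longrightarrow> fvs.subspace V"
  unfolding fin_dim_def using fvs.subspace_span by blast

lemma fin_dim_span: "finite B \<Longrightarrow> fin_dim (fvs.span B)"
  unfolding fin_dim_def by blast

lemma fin_dim_basis:
  assumes V: "fin_dim V" and U: "U \<subseteq> V" "fvs.subspace U"
  obtains B where "B \<subseteq> U" "finite B" "fvs.independent B" "fvs.span B = U" "card B = fvs.dim U"
proof -
  obtain B where B: "B \<subseteq> U" "fvs.independent B" "U \<subseteq> fvs.span B" "card B = fvs.dim U"
    using fvs.basis_exists by blast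
  obtain C where C: "finite C" "fvs.span C = V" using V fin_dim_def by blast
  have "finite B" using fvs.independent_span_bound[OF C(1) B(2)] B(1) U(1) C(2) by blast
  moreover have "fvs.span B = U" using B U fvs.span_minimal by blast
  ultimately show ?thesis using B that by blast
qed

lemma fin_dim_subset: "fin_dim V \<Longrightarrow> U \<subseteq> V \<Longrightarrow> fvs.subspace U \<Longrightarrow> fin_dim U"
  by (metis fin_dim_basis fin_dim_span)

lemma fin_dim_basis_fam:
  assumes "fin_dim V"
  obtains u where "indep_fam {1..fvs.dim V} u" "fvs.span (u ` {1..fvs.dim V}) = V"
proof -
  obtain B where B: "B \<subseteq> V" "finite B" "fvs.independent B" "fvs.span B = V" "card B = fvs.dim V"
    by (rule fin_dim_basis[OF assms order_refl fin_dim_subspace[OF assms]])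
  obtain u where u: "bij_betw u {1..fvs.dim V} B"
    using B by (metis ex_bij_betw_nat_finite_1)
  then have "indep_fam {1..fvs.dim V} u" using B by (simp add: indep_fam_iff bij_betw_def)
  then show ?thesis using that u B by (metis bij_betw_imp_surj_on)
qed

lemma indep_fam_card_le:
  assumes "fin_dim V" "indep_fam T u" "finite T" "u ` T \<subseteq> V"
  shows "card T \<le> fvs.dim V"
proof -
  obtain B where B: "B \<subseteq> V" "finite B" "fvs.independent B" "fvs.span B = V" "card B = fvs.dim V"
    by (rule fin_dim_basis[OF assms(1) order_refl fin_dim_subspace[OF assms(1)]])
  have "card (u ` T) \<le> card B"
    using fvs.independent_span_bound[OF B(2), of "u ` T"] assms B(4) indep_fam_iff by blast
  then show ?thesis using assms B by (simp add: indep_fam_iff card_image)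
qed

lemma indep_fam_spans:
  assumes "fin_dim V" "indep_fam T u" "finite T" "u ` T \<subseteq> V" "fvs.dim V \<le> card T"
  shows "fvs.span (u ` T) = V"
proof (rule ccontr)
  assume n: "fvs.span (u ` T) \<noteq> V"
  have sub: "fvs.span (u ` T) \<subseteq> V" using assms fin_dim_subspace fvs.span_minimal by blast
  then obtain x where x: "x \<in> V" "x \<notin> fvs.span (u ` T)" using n by blast
  obtain B where B: "B \<subseteq> V" "finite B" "fvs.independent B" "fvs.span B = V" "card B = fvs.dim V"
    by (rule fin_dim_basis[OF assms(1) order_refl fin_dim_subspace[OF assms(1)]])
  have i: "fvs.independent (insert x (u ` T))"
    using x assms by (simp add: indep_fam_iff fvs.independent_insert)
  have "card (insert x (u ` T)) \<le> card B"
    using fvs.independent_span_bound[OF B(2) i] B(4) x(1) assms(4) by auto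
  moreover have "x \<notin> u ` T" using x(2) fvs.span_base[of x "u ` T"] by blast
  ultimately show False using assms B by (simp add: indep_fam_iff card_image)
qed

lemma spanning_indep_fam:
  assumes "finite T" "card T \<le> fvs.dim (fvs.span (u ` T))"
  shows "indep_fam T u"
proof -
  obtain B where B: "B \<subseteq> u ` T" "fvs.independent B" "u ` T \<subseteq> fvs.span B"
    by (metis fvs.maximal_independent_subset)
  have sp: "fvs.span B = fvs.span (u ` T)"
    using B by (meson fvs.span_minimal fvs.span_mono fvs.subspace_span subset_antisym)
  have "card B = fvs.dim (fvs.span (u ` T))"
    using sp B(2) fvs.dim_eq_card[of B "fvs.span (u ` T)"] by (simp add: fvs.span_span)
  moreover have "card B \<le> card (u ` T)" using B assms by (simp add: card_mono)
  moreover have "card (u ` T) \<le> card T" using assms card_image_le by blast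
  ultimately have c: "card (u ` T) = card T" "card B = card (u ` T)" using assms by linarith+
  then have "B = u ` T" using B assms by (simp add: card_subset_eq)
  then show ?thesis using c B assms by (simp add: indep_fam_iff eq_card_imp_inj_on)
qed

lemma fin_dim_dim_0: "fin_dim V \<Longrightarrow> fvs.dim V = 0 \<longleftrightarrow> V = {0}"
proof
  assume V: "fin_dim V" and d: "fvs.dim V = 0"
  obtain B where "B \<subseteq> V" "finite B" "fvs.independent B" "fvs.span B = V" "card B = fvs.dim V"
    by (rule fin_dim_basis[OF V order_refl fin_dim_subspace[OF V]])
  then show "V = {0}" using d by auto
next
  assume "V = {0}"
  then have "fvs.span {} = fvs.span V" by simp
  then show "fvs.dim V = 0" using fvs.dim_eq_card[of "{}" V] fvs.independent_empty by simp
qed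

lemma fin_dim_dim_1:
  assumes "fin_dim V" "fvs.dim V = 1"
  obtains y where "y \<noteq> 0" "V = fvs.span {y}"
proof -
  obtain B where B: "B \<subseteq> V" "finite B" "fvs.independent B" "fvs.span B = V" "card B = fvs.dim V"
    by (rule fin_dim_basis[OF assms(1) order_refl fin_dim_subspace[OF assms(1)]])
  then obtain y where "B = {y}" using assms by (auto simp: card_1_singleton_iff)
  then have "y \<noteq> 0" using B(3) fvs.dependent_zero[of B] by auto
  then show ?thesis using B(4) \<open>B = {y}\<close> that by blast
qed

lemma indep_fam_single: "u t \<noteq> 0 \<Longrightarrow> indep_fam {t} u"
  by (simp add: indep_fam_def)

lemma dim_line: "y \<noteq> 0 \<Longrightarrow> fvs.dim (fvs.span {y}) = 1"
  using dim_span_indep_fam[of "{y}" "\<lambda>y. y"] indep_fam_single[of "\<lambda>y. y" y] by simp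

text \<open>A basis \<open>B\<close> of \<open>U\<close> extends to a basis \<open>C\<close> of
  \<open>V\<close>, and the complement is spanned by \<open>C - B\<close>. A common vector has its
  representation in \<open>C\<close> supported both in \<open>B\<close> and in \<open>C - B\<close>,
  so it vanishes.\<close>

lemma complement_exists:
  assumes "fin_dim V" "fvs.subspace U" "U \<subseteq> V"
  obtains W where "fvs.subspace W" "W \<subseteq> V" "U \<inter> W = {0}" "\<forall>x\<in>V. \<exists>a\<in>U. \<exists>b\<in>W. x = a + b"
proof -
  obtain B where B: "B \<subseteq> U" "finite B" "fvs.independent B" "fvs.span B = U"
    by (rule fin_dim_basis[OF assms(1,3,2)])
  obtain C where C: "B \<subseteq> C" "C \<subseteq> V" "fvs.independent C" "V \<subseteq> fvs.span C"
    by (rule fvs.maximal_independent_subset_extend[of B V]) (use B assms(3) in auto)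
  let ?W = "fvs.span (C - B)"
  have CB: "C = B \<union> (C - B)" using C(1) by blast
  have "?W \<subseteq> V"
    by (rule fvs.span_minimal) (use C(2) assms(1) fin_dim_subspace in auto)
  moreover have "\<exists>a\<in>U. \<exists>b\<in>?W. x = a + b" if "x \<in> V" for x
  proof -
    have "x \<in> fvs.span (B \<union> (C - B))" using that C(4) CB by auto
    then show ?thesis unfolding fvs.span_Un B(4) by blast
  qed
  moreover have "U \<inter> ?W = {0}"
  proof -
    have "x = 0" if x: "x \<in> U" "x \<in> ?W" for x
    proof -
      have "fvs.representation C x b = 0" for b
      proof (cases "b \<in> B")
        case True
        have "fvs.representation C x = fvs.representation (C - B) x"
          by (rule fvs.representation_extend[OF C(3) x(2)]) simp
        then show ?thesis using True fvs.representation_ne_zero[of "C - B" x b] by auto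
      next
        case False
        have "fvs.representation C x = fvs.representation B x"
          by (rule fvs.representation_extend[OF C(3) _ C(1)]) (use x B in simp)
        then show ?thesis using False fvs.representation_ne_zero[of B x b] by auto
      qed
      then show "x = 0"
        using fvs.sum_nonzero_representation_eq[OF C(3), of x] x(1) assms(3) C(4) by (simp add: subset_iff)
    qed
    moreover have "0 \<in> U" "0 \<in> ?W" using assms(2) by (auto simp: fvs.subspace_0 fvs.span_zero)
    ultimately show ?thesis by blast
  qed
  ultimately show ?thesis using that[of ?W] by simp
qed

lemma span_singleton_eq_iff:
  assumes "a \<noteq> 0"
  shows "fvs.span {a} = fvs.span {b} \<longleftrightarrow> (\<exists>c. c \<noteq> 0 \<and> b = fscale c a)"
proof
  assume e: "fvs.span {a} = fvs.span {b}"
  then have "b \<in> fvs.span {a}" by (simp add: fvs.span_base)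
  then obtain c where c: "b = fscale c a" by (auto simp: fvs.span_singleton)
  have "b \<noteq> 0"
  proof
    assume "b = 0"
    then have "fvs.span {b} = {0}" by (simp only: fvs.span_insert_0 fvs.span_empty)
    then show False using e assms fvs.span_base[of a "{a}"] by simp
  qed
  then show "\<exists>c. c \<noteq> 0 \<and> b = fscale c a" using c by (metis fvs.scale_zero_left)
next
  assume "\<exists>c. c \<noteq> 0 \<and> b = fscale c a"
  then obtain c where c: "c \<noteq> 0" "b = fscale c a" by blast
  then have "a = fscale (inverse c) b" by simp
  then show "fvs.span {a} = fvs.span {b}"
    using c(2) fvs.span_scale[OF fvs.span_base[of a "{a}"], of c]
      fvs.span_scale[OF fvs.span_base[of b "{b}"], of "inverse c"]
    by (intro subset_antisym fvs.span_minimal) auto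
qed

subsection \<open>Linear maps on subspaces\<close>

lemma lin_iso_alt: "lin_iso f V W \<longleftrightarrow> bij_betw f V W \<and> lin_on f V"
  unfolding lin_iso_def lin_on_def by blast

lemma lin_on_add: "lin_on f V \<Longrightarrow> x \<in> V \<Longrightarrow> y \<in> V \<Longrightarrow> f (x + y) = f x + f y"
  and lin_on_scale: "lin_on f V \<Longrightarrow> x \<in> V \<Longrightarrow> f (fscale c x) = fscale c (f x)"
  unfolding lin_on_def by blast+

lemma lin_on_0: "lin_on f V \<Longrightarrow> x \<in> V \<Longrightarrow> f 0 = 0"
  using lin_on_scale[of f V x 0] by simp

lemma lin_on_comp: "lin_on f V \<Longrightarrow> lin_on g W \<Longrightarrow> f ` V \<subseteq> W \<Longrightarrow> lin_on (g \<circ> f) V"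
  unfolding lin_on_def by (simp add: image_subset_iff)

lemma lin_on_sum:
  assumes "lin_on f V" "fvs.subspace V" "finite T" "\<And>t. t \<in> T \<Longrightarrow> u t \<in> V"
  shows "f (\<Sum>t\<in>T. fscale (c t) (u t)) = (\<Sum>t\<in>T. fscale (c t) (f (u t)))"
  using assms(3,4)
proof (induction T)
  case empty
  then show ?case using lin_on_0[OF assms(1) fvs.subspace_0[OF assms(2)]] by (simp add: zero_fun_def)
next
  case (insert a T)
  have "(\<Sum>t\<in>T. fscale (c t) (u t)) \<in> V" "fscale (c a) (u a) \<in> V"
    using insert assms(2) by (auto intro!: fvs.subspace_sum fvs.subspace_scale)
  then show ?case using insert assms(1) by (simp add: lin_on_add lin_on_scale)
qed

lemma lin_on_span:
  assumes "lin_on f V" "fvs.subspace V" "finite T" "u ` T \<subseteq> V"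
  shows "f ` fvs.span (u ` T) = fvs.span ((\<lambda>t. f (u t)) ` T)"
proof -
  have *: "f (\<Sum>t\<in>T. fscale (c t) (u t)) = (\<Sum>t\<in>T. fscale (c t) (f (u t)))" for c
    by (rule lin_on_sum[OF assms(1,2,3)]) (use assms(4) in auto)
  show ?thesis unfolding span_fam[OF assms(3)] using * by (auto simp: image_def)
qed

lemma lin_on_span_singleton:
  assumes "lin_on f V" "fvs.subspace V" "y \<in> V"
  shows "f ` fvs.span {y} = fvs.span {f y}"
  using lin_on_span[OF assms(1,2), of "{y}" "\<lambda>y. y"] assms(3) by simp

lemma lin_on_eq_0: "lin_on f V \<Longrightarrow> inj_on f V \<Longrightarrow> fvs.subspace V \<Longrightarrow> x \<in> V \<Longrightarrow> f x = 0 \<Longrightarrow> x = 0"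
  by (metis fvs.subspace_0 inj_onD lin_on_0)

lemma lin_on_injI:
  assumes "lin_on f V" "fvs.subspace V" "\<And>x. x \<in> V \<Longrightarrow> f x = 0 \<Longrightarrow> x = 0"
  shows "inj_on f V"
proof (rule inj_onI)
  fix x y assume *: "x \<in> V" "y \<in> V" "f x = f y"
  have m: "fscale (-1) y \<in> V" using assms(2) * by (intro fvs.subspace_scale)
  have "f (x + fscale (-1) y) = 0"
    using * by (simp only: lin_on_add[OF assms(1) *(1) m] lin_on_scale[OF assms(1) *(2)]) (simp add: pointwise)
  moreover have "x + fscale (-1) y \<in> V" using assms(2) *(1) m by (rule fvs.subspace_add)
  ultimately have "x + fscale (-1) y = 0" by (rule assms(3)[rotated])
  then show "x = y" by (simp add: pointwise)
qed

lemma indep_fam_image: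
  assumes "lin_on f V" "inj_on f V" "fvs.subspace V" "finite T" "u ` T \<subseteq> V"
  shows "indep_fam T (\<lambda>t. f (u t)) \<longleftrightarrow> indep_fam T u"
proof -
  have "(\<Sum>t\<in>T. fscale (c t) (f (u t))) = f (\<Sum>t\<in>T. fscale (c t) (u t))" for c
    by (rule lin_on_sum[OF assms(1,3,4), symmetric]) (use assms(5) in auto)
  moreover have "(\<Sum>t\<in>T. fscale (c t) (u t)) \<in> V" for c
    using assms by (auto intro!: fvs.subspace_sum fvs.subspace_scale)
  ultimately have "(\<Sum>t\<in>T. fscale (c t) (f (u t))) = 0 \<longleftrightarrow> (\<Sum>t\<in>T. fscale (c t) (u t)) = 0" for c
    using lin_on_eq_0[OF assms(1-3)] lin_on_0[OF assms(1) fvs.subspace_0[OF assms(3)]] by auto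
  then show ?thesis unfolding indep_fam_def by simp
qed

lemma lin_iso_inv:
  assumes "lin_iso f V W" "fvs.subspace V"
  shows "lin_iso (inv_into V f) W V"
proof -
  have b: "bij_betw f V W" and l: "lin_on f V" using assms by (auto simp: lin_iso_alt)
  let ?g = "inv_into V f"
  have g: "?g y \<in> V" "f (?g y) = y" if "y \<in> W" for y
    using b that by (metis bij_betw_imp_surj_on inv_into_into, metis bij_betw_inv_into_right)
  have gf: "?g (f x) = x" if "x \<in> V" for x using b that by (simp add: bij_betw_inv_into_left)
  have "?g (x + y) = ?g x + ?g y" if "x \<in> W" "y \<in> W" for x y
    using gf[of "?g x + ?g y"] g that assms(2) lin_on_add[OF l, of "?g x" "?g y"] by (simp add: fvs.subspace_add)
  moreover have "?g (fscale c x) = fscale c (?g x)" if "x \<in> W" for c x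
    using gf[of "fscale c (?g x)"] g that assms(2) lin_on_scale[OF l, of "?g x"] by (simp add: fvs.subspace_scale)
  ultimately show ?thesis
    using bij_betw_inv_into[OF b] unfolding lin_iso_def by blast
qed

lemma lin_iso_trans: "lin_iso f U V \<Longrightarrow> lin_iso g V W \<Longrightarrow> lin_iso (g \<circ> f) U W"
  unfolding lin_iso_alt using bij_betw_trans[of f U V g W] lin_on_comp[of f U g V]
  by (auto simp: bij_betw_imp_surj_on)

lemma lin_iso_cong:
  assumes "\<And>x. x \<in> V \<Longrightarrow> f x = g x" "fvs.subspace V" shows "lin_iso f V W \<longleftrightarrow> lin_iso g V W"
proof -
  have "lin_on f V \<longleftrightarrow> lin_on g V"
    unfolding lin_on_def using assms by (simp add: fvs.subspace_add fvs.subspace_scale)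
  moreover have "bij_betw f V W \<longleftrightarrow> bij_betw g V W" using assms bij_betw_cong by blast
  ultimately show ?thesis by (simp add: lin_iso_alt)
qed

text \<open>The inverse of the bijection brings a part back only if that part lies in the domain,
  hence the last hypothesis.\<close>

lemma mflag_iso_sym:
  assumes "mflag_iso m D E" "fvs.subspace (whole D)" "\<And>i. i \<in> {1..m} \<Longrightarrow> part D i \<subseteq> whole D"
  shows "mflag_iso m E D"
proof -
  obtain f where f: "lin_iso f (whole D) (whole E)" "\<forall>i\<in>{1..m}. f ` part D i = part E i"
    using assms unfolding mflag_iso_def by blast
  have "inv_into (whole D) f ` part E i = part D i" if "i \<in> {1..m}" for i
    using f that assms(3) by (metis bij_betw_def inv_into_image_cancel lin_iso_alt)
  then show ?thesis using lin_iso_inv[OF f(1) assms(2)] unfolding mflag_iso_def by blast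
qed

lemma mflag_iso_trans: "mflag_iso m D E \<Longrightarrow> mflag_iso m E F \<Longrightarrow> mflag_iso m D F"
  unfolding mflag_iso_def using lin_iso_trans by (metis image_comp)

subsection \<open>The space \<open>Kpow n\<close>\<close>

lemma subspace_Kpow [simp]: "fvs.subspace (Kpow n :: (nat \<Rightarrow> 'k::field) set)"
  by (auto simp: fvs.subspace_def Kpow_def pointwise)

lemma Kpow_expand: "z \<in> Kpow n \<Longrightarrow> (\<Sum>j\<in>{1..n}. fscale (z j) (unit_vec j)) = z"
  by (auto simp: pointwise unit_vec_def Kpow_def if_distrib cong: if_cong)

lemma unit_vec_in_Kpow: "h \<in> {1..n} \<Longrightarrow> unit_vec h \<in> Kpow n"
  by (auto simp: unit_vec_def Kpow_def)

lemma Kpow_eq_span: "(Kpow n :: (nat \<Rightarrow> 'k::field) set) = fvs.span (unit_vec ` {1..n})"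
proof
  show "fvs.span (unit_vec ` {1..n}) \<subseteq> Kpow n"
    by (rule fvs.span_minimal) (auto intro: unit_vec_in_Kpow)
  show "(Kpow n :: (nat \<Rightarrow> 'k) set) \<subseteq> fvs.span (unit_vec ` {1..n})"
  proof
    fix x :: "nat \<Rightarrow> 'k" assume "x \<in> Kpow n"
    then have "x = (\<Sum>j\<in>{1..n}. fscale (x j) (unit_vec j))" by (simp only: Kpow_expand)
    then show "x \<in> fvs.span (unit_vec ` {1..n})" using span_fam[of "{1..n}" unit_vec] by blast
  qed
qed

lemma indep_unit_vec: "indep_fam {1..n} (unit_vec :: nat \<Rightarrow> nat \<Rightarrow> 'k::field)"
proof -
  have "c t = 0" if "(\<Sum>t\<in>{1..n}. fscale (c t) (unit_vec t :: nat \<Rightarrow> 'k)) = 0" "t \<in> {1..n}" for c t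
  proof -
    have "(\<Sum>t\<in>{1..n}. fscale (c t) (unit_vec t :: nat \<Rightarrow> 'k)) t = c t"
      using that(2) by (simp add: pointwise unit_vec_def if_distrib cong: if_cong)
    then show ?thesis using that(1) by (simp add: zero_fun_apply)
  qed
  then show ?thesis unfolding indep_fam_def by blast
qed

lemma fin_dim_Kpow [simp]: "fin_dim (Kpow n :: (nat \<Rightarrow> 'k::field) set)"
  unfolding Kpow_eq_span by (rule fin_dim_span) simp

lemma dim_Kpow [simp]: "fvs.dim (Kpow n :: (nat \<Rightarrow> 'k::field) set) = n"
  unfolding Kpow_eq_span using dim_span_indep_fam[OF _ indep_unit_vec, of n] by simp

section \<open>Matroid connectedness of a family of vectors and its separators\<close>

section \<open>Connected families and separators\<close>

abbreviation spn :: "('i \<Rightarrow> 'x \<Rightarrow> 'k::field) \<Rightarrow> 'i set \<Rightarrow> ('x \<Rightarrow> 'k) set" where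
  "spn v S \<equiv> fvs.span (v ` S)"

text \<open>Connectedness of the matroid of the vectors: no proper nonempty subset is a separator,
  that is, has a span meeting the span of the rest trivially. The empty set and singletons are
  connected.\<close>

definition conn :: "('i \<Rightarrow> 'x \<Rightarrow> 'k::field) \<Rightarrow> 'i set \<Rightarrow> bool" where
  "conn v K \<longleftrightarrow> (\<forall>S. S \<noteq> {} \<and> S \<subset> K \<longrightarrow> \<not> spn v S \<inter> spn v (K - S) \<subseteq> {0})"

lemma connD: "conn v K \<Longrightarrow> S \<subseteq> K \<Longrightarrow> spn v S \<inter> spn v (K - S) \<subseteq> {0} \<Longrightarrow> S = {} \<or> S = K"
  unfolding conn_def by blast

lemma spn_mono: "S \<subseteq> T \<Longrightarrow> spn v S \<subseteq> spn v T"
  by (simp add: fvs.span_mono image_mono)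

lemma spn_mem: "i \<in> S \<Longrightarrow> v i \<in> spn v S"
  by (simp add: fvs.span_base)

lemma spn_Un: "spn v (S \<union> T) = {x + y | x y. x \<in> spn v S \<and> y \<in> spn v T}"
  by (simp add: image_Un fvs.span_Un)

lemma fin_dim_spn: "finite S \<Longrightarrow> fin_dim (spn v S)"
  by (simp add: fin_dim_span)

text \<open>Spans depend only on the lines, so rescaling the chosen vectors changes nothing.\<close>

lemma conn_cong:
  assumes "\<And>i. i \<in> K \<Longrightarrow> spn v {i} = spn w {i}"
  shows "conn v K \<longleftrightarrow> conn w K"
proof -
  have "spn v S \<subseteq> spn w S" if "S \<subseteq> K" "\<And>i. i \<in> K \<Longrightarrow> spn v {i} = spn w {i}"
    for S and v w :: "'a \<Rightarrow> 'b \<Rightarrow> 'c"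
  proof (rule fvs.span_minimal)
    show "v ` S \<subseteq> spn w S"
    proof clarify
      fix i assume i: "i \<in> S"
      have "v i \<in> spn v {i}" by (simp add: fvs.span_base)
      also have "\<dots> = spn w {i}" using that i by blast
      also have "\<dots> \<subseteq> spn w S" by (rule spn_mono) (use i in simp)
      finally show "v i \<in> spn w S" .
    qed
  qed simp
  then have e: "spn v S = spn w S" if "S \<subseteq> K" for S
    using assms that by (metis subset_antisym)
  then have "spn v S = spn w S \<and> spn v (K - S) = spn w (K - S)" if "S \<subset> K" for S
    using that by blast
  then show ?thesis unfolding conn_def by simp
qed

text \<open>Write a common vector as \<open>a + b\<close> with \<open>a\<close> from
  \<open>K - S\<close> and \<open>b\<close> from \<open>M - K\<close>. Then \<open>b\<close> lies in
  the spans of both \<open>K\<close> and \<open>M - K\<close>, hence is zero, and what remains is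
  common to \<open>S\<close> and \<open>K - S\<close>.\<close>

lemma separator_trans:
  assumes "spn v K \<inter> spn v (M - K) \<subseteq> {0}" "S \<subseteq> K" "K \<subseteq> M" "spn v S \<inter> spn v (K - S) \<subseteq> {0}"
  shows "spn v S \<inter> spn v (M - S) \<subseteq> {0}"
proof
  fix z assume z: "z \<in> spn v S \<inter> spn v (M - S)"
  have "M - S = (K - S) \<union> (M - K)" using assms(2,3) by blast
  then have "z \<in> {x + y | x y. x \<in> spn v (K - S) \<and> y \<in> spn v (M - K)}"
    using z spn_Un[of v "K - S" "M - K"] by simp
  then obtain a b where ab: "z = a + b" "a \<in> spn v (K - S)" "b \<in> spn v (M - K)"
    by (elim CollectE exE conjE)
  have "z \<in> spn v K" "a \<in> spn v K"
    using subsetD[OF spn_mono[OF assms(2)]] subsetD[OF spn_mono[of "K - S" K]] z ab(2) by auto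
  then have "z - a \<in> spn v K" by (rule fvs.span_diff)
  then have "b \<in> spn v K" using ab(1) by simp
  then have "b \<in> {0}" using ab(3) subsetD[OF assms(1)] by simp
  then have "z = a" using ab(1) by simp
  then show "z \<in> {0}" using ab(2) z subsetD[OF assms(4), of z] by simp
qed

text \<open>Induction on the size: a disconnected \<open>K\<close> falls into \<open>S\<close> and
  \<open>K - S\<close>, and by \<open>separator_trans\<close> both are again separators of the
  ambient \<open>M\<close>, so the hypothesis applies to each.\<close>

lemma connected_partition:
  assumes "finite M" "K \<subseteq> M" "spn v K \<inter> spn v (M - K) \<subseteq> {0}"
  shows "\<exists>P. \<Union>P = K \<and> disjoint P \<and> {} \<notin> P \<and> (\<forall>S\<in>P. conn v S \<and> spn v S \<inter> spn v (M - S) \<subseteq> {0})"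
  using assms(2,3)
proof (induction "card K" arbitrary: K rule: less_induct)
  case less
  show ?case
  proof (cases "conn v K")
    case True
    show ?thesis
    proof (cases "K = {}")
      case True then show ?thesis by (intro exI[of _ "{}"]) auto
    next
      case False then show ?thesis using \<open>conn v K\<close> less by (intro exI[of _ "{K}"]) (auto simp: disjoint_def)
    qed
  next
    case False
    then obtain S where S: "S \<noteq> {}" "S \<subset> K" "spn v S \<inter> spn v (K - S) \<subseteq> {0}"
      unfolding conn_def by auto
    have fK: "finite K" by (rule finite_subset[OF less(2) assms(1)])
    have KS: "K - (K - S) = S" using S(2) by blast
    have S2: "spn v (K - S) \<inter> spn v (K - (K - S)) \<subseteq> {0}" unfolding KS using S(3) by (simp only: Int_commute)
    have sub: "S \<subseteq> K" "K - S \<subseteq> K" "S \<subseteq> M" "K - S \<subseteq> M" using S(2) less(2) by auto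
    have "card S < card K" by (rule psubset_card_mono[OF fK S(2)])
    from less(1)[OF this sub(3) separator_trans[OF less(3) sub(1) less(2) S(3)]]
    obtain P where P: "\<Union>P = S" "disjoint P" "{} \<notin> P" "\<forall>S\<in>P. conn v S \<and> spn v S \<inter> spn v (M - S) \<subseteq> {0}"
      by (elim exE conjE)
    have "card (K - S) < card K" by (rule psubset_card_mono[OF fK]) (use S(1,2) in auto)
    from less(1)[OF this sub(4) separator_trans[OF less(3) sub(2) less(2) S2]]
    obtain Q where Q: "\<Union>Q = K - S" "disjoint Q" "{} \<notin> Q" "\<forall>S\<in>Q. conn v S \<and> spn v S \<inter> spn v (M - S) \<subseteq> {0}"
      by (elim exE conjE)
    have "disjoint (P \<union> Q)" by (rule disjoint_union) (use P(1,2) Q(1,2) in auto)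
    moreover have "\<Union>(P \<union> Q) = K" using P(1) Q(1) sub(1) by auto
    moreover have "{} \<notin> P \<union> Q" using P(3) Q(3) by simp
    moreover have "\<forall>S\<in>P \<union> Q. conn v S \<and> spn v S \<inter> spn v (M - S) \<subseteq> {0}"
      unfolding ball_Un using P(4) Q(4) by (rule conjI)
    ultimately show ?thesis by (intro exI conjI)
  qed
qed

text \<open>The separator \<open>L\<close> cuts \<open>K\<close> into \<open>K \<inter> L\<close>
  and the rest, whose spans lie in the spans of \<open>L\<close> and \<open>M - L\<close>. A
  connected \<open>K\<close> admits no such cut. Used in both directions, this makes the connected
  separators containing a given index unique.\<close>

lemma connected_separators_meet:
  assumes "K \<inter> L \<noteq> {}" "K \<subseteq> M" "conn v K" "spn v L \<inter> spn v (M - L) \<subseteq> {0}"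
  shows "K \<subseteq> L"
proof -
  have "spn v (K \<inter> L) \<subseteq> spn v L" "spn v (K - K \<inter> L) \<subseteq> spn v (M - L)"
    using assms(2) by (auto intro!: spn_mono)
  then have "spn v (K \<inter> L) \<inter> spn v (K - K \<inter> L) \<subseteq> {0}"
    by (rule subset_trans[OF Int_mono assms(4)])
  then have "K \<inter> L = {} \<or> K \<inter> L = K" by (rule connD[OF assms(3), rotated]) simp
  then show ?thesis using assms(1) by blast
qed

text \<open>The singleton of \<open>i\<close> is not a separator, so some nonzero multiple of
  \<open>v i\<close> lies in the span of the others.\<close>

lemma conn_mem_span:
  assumes "conn v K" "i \<in> K" "K \<noteq> {i}"
  shows "v i \<in> spn v (K - {i})"
proof -
  have "\<not> spn v {i} \<inter> spn v (K - {i}) \<subseteq> {0}"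
    using assms(2,3) connD[OF assms(1), of "{i}"] by auto
  then obtain z where z: "z \<in> spn v {i}" "z \<in> spn v (K - {i})" "z \<noteq> 0" by auto
  from z(1) obtain c where c: "z = fscale c (v i)" by (auto simp: fvs.span_singleton)
  then have "c \<noteq> 0" using z(3) by auto
  then have "v i = fscale (inverse c) z" using c by simp
  then show ?thesis using fvs.span_scale[OF z(2), of "inverse c"] by simp
qed

text \<open>A family whose rank equals its size is independent, and then its singletons are
  separators. This is why a block of rank \<open>r \<ge> 2\<close> contains at least
  \<open>r + 1\<close> lines.\<close>

lemma conn_rank_less:
  assumes "finite K" "conn v K" "card K \<ge> 2"
  shows "fvs.dim (spn v K) < card K"
proof (rule ccontr)
  assume "\<not> ?thesis"
  then have i: "indep_fam K v" using assms(1) by (intro spanning_indep_fam) auto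
  obtain h where h: "h \<in> K" using assms(3) by fastforce
  have "K \<noteq> {h}" using assms(3) by auto
  then show False using conn_mem_span[OF assms(2) h] indep_fam_notin[OF i assms(1) h] by simp
qed

text \<open>A vanishing coefficient would place \<open>v h\<close> in the span of the others without
  \<open>v x\<close>, which contradicts the independence of \<open>T - {x}\<close>.\<close>

lemma circuit_coeffs:
  assumes "finite T" "h \<in> T" "\<And>x. x \<in> T \<Longrightarrow> indep_fam (T - {x}) v"
    and "v h = (\<Sum>t\<in>T - {h}. fscale (c t) (v t))" "x \<in> T - {h}"
  shows "c x \<noteq> 0"
proof
  assume c: "c x = 0"
  have "v h = (\<Sum>t\<in>T - {h} - {x}. fscale (c t) (v t))"
    using assms(1,4,5) c by (simp add: sum.remove[of "T - {h}" x])
  also have "\<dots> \<in> spn v (T - {h} - {x})" by (intro fvs.span_sum fvs.span_scale spn_mem)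
  finally have "v h \<in> spn v (T - {x} - {h})" by (simp add: Diff_insert2[symmetric] insert_commute)
  then show False using indep_fam_notin[OF assms(3)[of x], of h] assms(1,2,5) by auto
qed

text \<open>A spanning circuit cannot be cut: otherwise the relation between its members would leave
  a nonzero vector common to both sides. So the side that meets the circuit contains it and spans
  everything, and the other side, consisting of nonzero vectors, is empty.\<close>

lemma circuit_conn:
  assumes "finite K" "T \<subseteq> K" "T \<noteq> {}" and ind: "\<And>h. h \<in> T \<Longrightarrow> indep_fam (T - {h}) v"
    and sp: "\<And>h. h \<in> T \<Longrightarrow> spn v (T - {h}) = spn v K" and nz: "\<And>i. i \<in> K \<Longrightarrow> v i \<noteq> 0"
  shows "conn v K"
proof -
  have finT: "finite T" using assms finite_subset by blast
  \<comment> \<open>The cut is taken on the side containing a chosen \<open>h\<close> of the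
    circuit; a cut with \<open>h\<close> on the other side is reduced to this one by passing to
    \<open>K - S\<close>.\<close>
  have main: "S = {} \<or> S = K" if S: "S \<subseteq> K" "spn v S \<inter> spn v (K - S) \<subseteq> {0}" "h \<in> T" "h \<in> S" for S h
  proof -
    have TS: "T \<subseteq> S"
    proof (rule ccontr)
      assume "\<not> T \<subseteq> S"
      then obtain x where x: "x \<in> T" "x \<notin> S" by blast
      have "v h \<in> spn v (T - {h})" unfolding sp[OF S(3)] by (rule spn_mem) (use S(1,4) in auto)
      then obtain c where c: "v h = (\<Sum>t\<in>T - {h}. fscale (c t) (v t))"
        by (rule span_famE[OF finite_Diff[OF finT]])
      have xh: "x \<in> T - {h}" using x S(4) by auto
      have cx: "c x \<noteq> 0" by (rule circuit_coeffs[OF finT S(3) ind c xh])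
      \<comment> \<open>The share of the relation carried by indices outside \<open>S\<close>;
        solving the relation for it shows that it lies in both spans.\<close>
      let ?a = "\<Sum>t\<in>(T - {h}) - S. fscale (c t) (v t)"
      have "(\<Sum>t\<in>T - {h}. fscale (c t) (v t)) = (\<Sum>t\<in>(T - {h}) \<inter> S. fscale (c t) (v t)) + ?a"
        using finT by (simp add: sum.Int_Diff)
      then have e: "?a = v h - (\<Sum>t\<in>(T - {h}) \<inter> S. fscale (c t) (v t))" using c by (simp add: algebra_simps)
      have "?a \<in> spn v S" unfolding e using S(4) by (intro fvs.span_diff fvs.span_sum fvs.span_scale spn_mem) auto
      moreover have "?a \<in> spn v (K - S)" using assms(2) by (intro fvs.span_sum fvs.span_scale spn_mem) auto
      ultimately have "?a = 0" using subsetD[OF S(2), of ?a] by simp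
      moreover have "indep_fam ((T - {h}) - S) v"
        by (rule indep_fam_subset[OF ind[OF S(3)]]) (use finT in auto)
      ultimately have "c x = 0" using x(2) xh by (intro indep_famD[of "(T - {h}) - S" v]) auto
      then show False using cx by simp
    qed
    have sub: "spn v (K - S) \<subseteq> spn v S"
    proof -
      have "spn v (K - S) \<subseteq> spn v K" by (rule spn_mono) simp
      also have "\<dots> = spn v (T - {h})" using sp[OF S(3)] by simp
      also have "\<dots> \<subseteq> spn v S" by (rule spn_mono) (use TS in auto)
      finally show ?thesis .
    qed
    have "K - S = {}"
    proof (rule ccontr)
      assume "K - S \<noteq> {}"
      then obtain i where i: "i \<in> K - S" by blast
      then have "v i \<in> spn v (K - S)" by (rule spn_mem)
      then have "v i \<in> spn v S \<inter> spn v (K - S)" using subsetD[OF sub] by simp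
      then have "v i = 0" using subsetD[OF S(2)] by simp
      then show False using nz[of i] i by simp
    qed
    then show ?thesis using S(1) by blast
  qed
  obtain h where h: "h \<in> T" using assms(3) by blast
  show ?thesis
    unfolding conn_def
  proof (intro allI impI notI)
    fix S assume S: "S \<noteq> {} \<and> S \<subset> K" "spn v S \<inter> spn v (K - S) \<subseteq> {0}"
    show False
    proof (cases "h \<in> S")
      case True
      have "S = {} \<or> S = K" by (rule main[of S h]) (use S h True in auto)
      then show False using S(1) by blast
    next
      case False
      have KS: "K - (K - S) = S" using S(1) by blast
      have "K - S = {} \<or> K - S = K"
      proof (rule main[of "K - S" h])
        show "spn v (K - S) \<inter> spn v (K - (K - S)) \<subseteq> {0}"
          unfolding KS using S(2) by (simp only: Int_commute)
      qed (use h False assms(2) in auto)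
      then show False using S(1) by blast
    qed
  qed
qed

lemma spn_image:
  assumes "lin_on f V" "fvs.subspace V" "finite S" "y ` S \<subseteq> V"
  shows "spn (\<lambda>i. f (y i)) S = f ` spn y S"
  using lin_on_span[OF assms] by simp

lemma spn_subset: "fvs.subspace V \<Longrightarrow> y ` S \<subseteq> V \<Longrightarrow> spn y S \<subseteq> V"
  by (rule fvs.span_minimal)

lemma conn_image:
  assumes "lin_on f V" "inj_on f V" "fvs.subspace V" "finite K" "y ` K \<subseteq> V"
  shows "conn (\<lambda>i. f (y i)) K \<longleftrightarrow> conn y K"
proof -
  have "f ` A \<inter> f ` B \<subseteq> {0} \<longleftrightarrow> A \<inter> B \<subseteq> {0}" if "A \<subseteq> V" "B \<subseteq> V" for A B
  proof -
    have "f ` A \<inter> f ` B = f ` (A \<inter> B)" using that assms(2) by (simp add: inj_on_image_Int)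
    moreover have "f ` (A \<inter> B) \<subseteq> {0} \<longleftrightarrow> A \<inter> B \<subseteq> {0}"
      using that(1) lin_on_eq_0[OF assms(1-3)] lin_on_0[OF assms(1) fvs.subspace_0[OF assms(3)]] by auto
    ultimately show ?thesis by simp
  qed
  moreover have "spn (\<lambda>i. f (y i)) S = f ` spn y S \<and> spn y S \<subseteq> V" if "S \<subseteq> K" for S
  proof -
    have S: "finite S" "y ` S \<subseteq> V" using that assms(4,5) finite_subset by auto
    show ?thesis using spn_image[OF assms(1,3) S] spn_subset[OF assms(3) S(2)] by simp
  qed
  ultimately have "spn (\<lambda>i. f (y i)) S \<inter> spn (\<lambda>i. f (y i)) (K - S) \<subseteq> {0} \<longleftrightarrow> spn y S \<inter> spn y (K - S) \<subseteq> {0}"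
    if "S \<subseteq> K" for S using that by auto
  then show ?thesis unfolding conn_def by (simp add: psubset_eq)
qed

lemma dim_image:
  assumes "lin_on f V" "inj_on f V" "fvs.subspace V" "fin_dim U" "U \<subseteq> V"
  shows "fvs.dim (f ` U) = fvs.dim U"
proof -
  obtain u where u: "indep_fam {1..fvs.dim U} u" "fvs.span (u ` {1..fvs.dim U}) = U"
    by (rule fin_dim_basis_fam[OF assms(4)])
  have uV: "u ` {1..fvs.dim U} \<subseteq> V" using u(2) assms(5) fvs.span_superset[of "u ` {1..fvs.dim U}"] by simp
  have "f ` U = fvs.span ((\<lambda>t. f (u t)) ` {1..fvs.dim U})"
    using lin_on_span[OF assms(1,3) _ uV] u(2) by simp
  moreover have "indep_fam {1..fvs.dim U} (\<lambda>t. f (u t))"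
    using indep_fam_image[OF assms(1-3) _ uV] u(1) by simp
  ultimately show ?thesis using dim_span_indep_fam[of "{1..fvs.dim U}" "\<lambda>t. f (u t)"] by simp
qed

section \<open>Indecomposability of a flag of lines as connectedness of its generators\<close>

section \<open>Indecomposable multiple flags\<close>

lemma is_mflag_alt:
  "is_mflag m D \<longleftrightarrow> fin_dim (whole D) \<and> (\<forall>i\<in>{1..m}. fvs.subspace (part D i) \<and> part D i \<subseteq> whole D)"
  by (simp add: is_mflag_def fin_dim_def)

lemma trivial_mflag_iff: "is_mflag m D \<Longrightarrow> trivial_mflag m D \<longleftrightarrow> whole D = {0}"
proof
  assume D: "is_mflag m D"
  then have f: "fin_dim (whole D)" by (simp add: is_mflag_alt)
  {
    assume "trivial_mflag m D"
    then show "whole D = {0}" using fin_dim_dim_0[OF f] by (simp add: trivial_mflag_def has_dim_def)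
  next
    assume w: "whole D = {0}"
    have "fvs.dim (part D i) = 0" if i: "i \<in> {1..m}" for i
    proof -
      have s: "fvs.subspace (part D i)" "part D i \<subseteq> whole D" using D i by (simp_all add: is_mflag_alt)
      then have "part D i = {0}" using w fvs.subspace_0[OF s(1)] by auto
      then show ?thesis using fin_dim_dim_0[OF fin_dim_subset[OF f s(2,1)]] by simp
    qed
    then show "trivial_mflag m D" using D w fin_dim_dim_0[OF f] by (simp add: trivial_mflag_def has_dim_def)
  }
qed

lemma subspace_vsum:
  fixes V :: "('a \<Rightarrow> 'k::field) set" and W :: "('b \<Rightarrow> 'k) set"
  assumes "fvs.subspace V" "fvs.subspace W"
  shows "fvs.subspace (vsum V W)"
proof -
  have "(x + y) \<circ> Inl = (x \<circ> Inl) + (y \<circ> Inl)" "(x + y) \<circ> Inr = (x \<circ> Inr) + (y \<circ> Inr)"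
    "fscale c x \<circ> Inl = fscale c (x \<circ> Inl)" "fscale c x \<circ> Inr = fscale c (x \<circ> Inr)"
    "(0 :: 'a + 'b \<Rightarrow> 'k) \<circ> Inl = 0" "(0 :: 'a + 'b \<Rightarrow> 'k) \<circ> Inr = 0"
    for x y :: "'a + 'b \<Rightarrow> 'k" and c
    by (simp_all add: pointwise)
  then show ?thesis
    using assms unfolding fvs.subspace_def vsum_def mem_Collect_eq by simp
qed

text \<open>An internal decomposition respecting every part yields an external one: addition maps
  the direct sum of the two restricted flags isomorphically onto \<open>D\<close>. Both restricted
  flags stay in the space \<open>nat \<Rightarrow> 'k\<close>, so they are admissible witnesses in
  the definition of \<open>indecomposable\<close>.\<close>

lemma indecomposable_split:
  fixes D :: "(nat \<Rightarrow> 'k::field) mflag"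
  assumes D: "indecomposable m D"
    and U: "fvs.subspace U" "U \<subseteq> whole D" and W: "fvs.subspace W" "W \<subseteq> whole D"
    and UW: "U \<inter> W \<subseteq> {0}" "\<And>x. x \<in> whole D \<Longrightarrow> \<exists>a\<in>U. \<exists>b\<in>W. x = a + b"
    and part: "\<And>i. i \<in> {1..m} \<Longrightarrow> part D i \<subseteq> U \<or> part D i \<subseteq> W"
  shows "U = {0} \<or> W = {0}"
proof -
  have mD: "is_mflag m D" using D by (simp add: indecomposable_def)
  then have fD: "fin_dim (whole D)" and
    pD: "\<And>i. i \<in> {1..m} \<Longrightarrow> fvs.subspace (part D i)" "\<And>i. i \<in> {1..m} \<Longrightarrow> part D i \<subseteq> whole D"
    by (simp_all add: is_mflag_alt)
  define D1 where "D1 = \<lparr>whole = U, part = (\<lambda>i. part D i \<inter> U)\<rparr>"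
  define D2 where "D2 = \<lparr>whole = W, part = (\<lambda>i. part D i \<inter> W)\<rparr>"
  have m1: "is_mflag m D1" "is_mflag m D2"
    using fin_dim_subset[OF fD U(2,1)] fin_dim_subset[OF fD W(2,1)] pD U(1) W(1)
    by (auto simp: is_mflag_alt D1_def D2_def intro: fvs.subspace_inter)
  define g :: "(nat + nat \<Rightarrow> 'k) \<Rightarrow> nat \<Rightarrow> 'k" where "g w = (w \<circ> Inl) + (w \<circ> Inr)" for w
  have g_case: "g (case_sum a b) = a + b" for a b
    by (simp add: g_def pointwise)
  have sV: "fvs.subspace (vsum U W)" by (rule subspace_vsum[OF U(1) W(1)])
  have lin: "lin_on g (vsum U W)"
    unfolding lin_on_def g_def by (simp add: pointwise algebra_simps)
  have inj: "inj_on g (vsum U W)"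
  proof (rule lin_on_injI[OF lin sV])
    fix w assume w: "w \<in> vsum U W" "g w = 0"
    have "w \<circ> Inl = - (w \<circ> Inr)" using w(2) by (simp add: g_def eq_neg_iff_add_eq_0)
    moreover have "- (w \<circ> Inr) \<in> W" using w(1) fvs.subspace_neg[OF W(1)] by (simp add: vsum_def)
    ultimately have "w \<circ> Inl \<in> U \<inter> W" using w(1) by (simp add: vsum_def)
    then have l: "w \<circ> Inl = 0" using subsetD[OF UW(1)] by simp
    then have r: "w \<circ> Inr = 0" using w(2) by (simp add: g_def)
    have "w z = 0" for z
      using fun_cong[OF l] fun_cong[OF r] by (cases z) (simp_all add: zero_fun_apply)
    then show "w = 0" by (simp add: pointwise)
  qed
  have surj: "g ` vsum U W = whole D"
  proof
    show "g ` vsum U W \<subseteq> whole D"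
    proof clarify
      fix w assume "w \<in> vsum U W"
      then show "g w \<in> whole D"
        using U(2) W(2) fvs.subspace_add[OF fin_dim_subspace[OF fD]] by (auto simp: vsum_def g_def)
    qed
    show "whole D \<subseteq> g ` vsum U W"
    proof
      fix x assume "x \<in> whole D"
      then obtain a b where ab: "a \<in> U" "b \<in> W" "x = a + b" using UW(2)[of x] by auto
      have "case_sum a b \<in> vsum U W" using ab by (simp add: vsum_def case_sum_o_inj)
      then show "x \<in> g ` vsum U W" using g_case[of a b] ab(3) by (metis image_eqI)
    qed
  qed
  have parts: "g ` vsum (part D i \<inter> U) (part D i \<inter> W) = part D i" if i: "i \<in> {1..m}" for i
  proof
    show "g ` vsum (part D i \<inter> U) (part D i \<inter> W) \<subseteq> part D i"
      using fvs.subspace_add[OF pD(1)[OF i]] by (auto simp: vsum_def g_def)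
    show "part D i \<subseteq> g ` vsum (part D i \<inter> U) (part D i \<inter> W)"
    proof
      fix x assume x: "x \<in> part D i"
      have z: "0 \<in> part D i \<inter> U" "0 \<in> part D i \<inter> W"
        using fvs.subspace_0[OF pD(1)[OF i]] fvs.subspace_0[OF U(1)] fvs.subspace_0[OF W(1)] by simp_all
      have "\<exists>a b. a \<in> part D i \<inter> U \<and> b \<in> part D i \<inter> W \<and> x = a + b"
      proof (cases "part D i \<subseteq> U")
        case True then show ?thesis using x z by (intro exI[of _ x] exI[of _ 0]) auto
      next
        case False then show ?thesis using x z part[OF i] by (intro exI[of _ 0] exI[of _ x]) auto
      qed
      then obtain a b where ab: "a \<in> part D i \<inter> U" "b \<in> part D i \<inter> W" "x = a + b" by (elim exE conjE)
      have "case_sum a b \<in> vsum (part D i \<inter> U) (part D i \<inter> W)"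
        using ab by (simp add: vsum_def case_sum_o_inj)
      then show "x \<in> g ` vsum (part D i \<inter> U) (part D i \<inter> W)" using g_case[of a b] ab(3) by (metis image_eqI)
    qed
  qed
  have "mflag_iso m (D1 \<oplus>\<^sub>F D2) D"
    unfolding mflag_iso_def lin_iso_alt bij_betw_def mflag_sum_def D1_def D2_def
    using lin inj surj parts by (intro exI[of _ g]) simp
  moreover have "fvs.subspace (whole (D1 \<oplus>\<^sub>F D2))"
    using sV by (simp add: mflag_sum_def D1_def D2_def)
  moreover have "part (D1 \<oplus>\<^sub>F D2) i \<subseteq> whole (D1 \<oplus>\<^sub>F D2)" for i
    by (auto simp: mflag_sum_def D1_def D2_def vsum_def)
  ultimately have "mflag_iso m D (D1 \<oplus>\<^sub>F D2)" by (rule mflag_iso_sym)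
  then have "trivial_mflag m D1 \<or> trivial_mflag m D2"
    using D m1 unfolding indecomposable_def by auto
  then show ?thesis using trivial_mflag_iff[OF m1(1)] trivial_mflag_iff[OF m1(2)] by (simp add: D1_def D2_def)
qed

text \<open>Every decomposition of \<open>whole D\<close> into subspaces that each absorb some of
  the lines is a decomposition of the flag. A complement of \<open>spn y K\<close> contains no line
  and must be zero; a separator of the generators would give two nonzero summands.\<close>

lemma indecomposable_conn:
  fixes D :: "(nat \<Rightarrow> 'k::field) mflag"
  assumes D: "indecomposable m D" and K: "K \<noteq> {}" "K \<subseteq> {1..m}"
    and part: "\<And>i. i \<in> K \<Longrightarrow> part D i = fvs.span {y i}" "\<And>i. i \<in> {1..m} - K \<Longrightarrow> part D i = {0}"
    and nz: "\<And>i. i \<in> K \<Longrightarrow> y i \<noteq> 0"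
  shows "conn y K" "spn y K = whole D"
proof -
  have mD: "is_mflag m D" using D by (simp add: indecomposable_def)
  then have fD: "fin_dim (whole D)" and
    pD: "\<And>i. i \<in> {1..m} \<Longrightarrow> part D i \<subseteq> whole D" by (simp_all add: is_mflag_alt)
  have sub: "spn y S \<subseteq> whole D" if S: "S \<subseteq> K" for S
  proof (rule fvs.span_minimal[OF _ fin_dim_subspace[OF fD]])
    show "y ` S \<subseteq> whole D"
    proof clarify
      fix i assume "i \<in> S"
      then have "i \<in> K" "i \<in> {1..m}" using S K by auto
      then show "y i \<in> whole D" using part(1)[of i] pD[of i] fvs.span_base[of "y i" "{y i}"] by auto
    qed
  qed
  have nonzero: "spn y S \<noteq> {0}" if S: "S \<subseteq> K" "S \<noteq> {}" for S
  proof -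
    obtain i where i: "i \<in> S" using S(2) by auto
    then show ?thesis using nz[of i] S(1) spn_mem[OF i, of y] by auto
  qed
  have inS: "part D i \<subseteq> spn y S" if "i \<in> {1..m} - K \<or> i \<in> S" "S \<subseteq> K" for i S
  proof (cases "i \<in> K")
    case True
    then have iS: "i \<in> S" using that by auto
    have "fvs.span {y i} \<subseteq> spn y S" by (rule fvs.span_mono) (use iS in auto)
    then show ?thesis using part(1)[OF True] by simp
  next
    case False
    then have "i \<in> {1..m} - K" using that by auto
    then show ?thesis using part(2) fvs.span_zero[of "y ` S"] by simp
  qed
  obtain W where W: "fvs.subspace W" "W \<subseteq> whole D" "spn y K \<inter> W = {0}"
    "\<forall>x\<in>whole D. \<exists>a\<in>spn y K. \<exists>b\<in>W. x = a + b"
    by (rule complement_exists[OF fD fvs.subspace_span sub[OF order_refl]])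
  have "spn y K = {0} \<or> W = {0}"
  proof (rule indecomposable_split[OF D fvs.subspace_span sub[OF order_refl] W(1,2) _ bspec[OF W(4)]])
    show "part D i \<subseteq> spn y K \<or> part D i \<subseteq> W" if "i \<in> {1..m}" for i
      using inS[of i K] that by auto
  qed (use W(3) in auto)
  then have "W = {0}" using nonzero[OF order_refl K(1)] by simp
  then have "whole D \<subseteq> spn y K" using W(4) by auto
  then show eq: "spn y K = whole D" using sub[OF order_refl] by simp
  show "conn y K"
    unfolding conn_def
  proof (intro allI impI notI)
    fix S assume S: "S \<noteq> {} \<and> S \<subset> K" and z: "spn y S \<inter> spn y (K - S) \<subseteq> {0}"
    have s: "S \<subseteq> K" "K - S \<subseteq> K" "K - S \<noteq> {}" using S by auto
    have "spn y S = {0} \<or> spn y (K - S) = {0}"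
    proof (rule indecomposable_split[OF D fvs.subspace_span sub[OF s(1)] fvs.subspace_span sub[OF s(2)] z])
      fix x assume "x \<in> whole D"
      then have "x \<in> spn y (S \<union> (K - S))" using eq s(1) by (simp add: Un_absorb1)
      then show "\<exists>a\<in>spn y S. \<exists>b\<in>spn y (K - S). x = a + b" unfolding spn_Un by auto
    next
      show "part D i \<subseteq> spn y S \<or> part D i \<subseteq> spn y (K - S)" if "i \<in> {1..m}" for i
        using inS[of i S] inS[of i "K - S"] that s by auto
    qed
    then show False using nonzero[OF s(1)] nonzero[OF s(2,3)] S by simp
  qed
qed

text \<open>In an external decomposition each line lies in one of the two summands, and the indices
  whose line lies in the left one form a separator. Connectedness makes this set trivial, so one
  summand receives no generator and is zero.\<close>

lemma conn_indecomposable: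
  fixes D :: "(nat \<Rightarrow> 'k::field) mflag"
  assumes D: "is_mflag m D" and K: "K \<subseteq> {1..m}"
    and part: "\<And>i. i \<in> K \<Longrightarrow> part D i = fvs.span {y i}"
    and y: "conn y K" "spn y K = whole D"
  shows "indecomposable m D"
proof -
  have "trivial_mflag m D1 \<or> trivial_mflag m D2"
    if D12: "is_mflag m D1" "is_mflag m D2" and iso: "mflag_iso m D (D1 \<oplus>\<^sub>F D2)"
    for D1 D2 :: "(nat \<Rightarrow> 'k) mflag"
  proof -
    obtain f where f: "lin_iso f (whole D) (vsum (whole D1) (whole D2))"
      "\<And>i. i \<in> {1..m} \<Longrightarrow> f ` part D i = vsum (part D1 i) (part D2 i)"
      using iso unfolding mflag_iso_def mflag_sum_def by auto
    have lin: "lin_on f (whole D)" and inj: "inj_on f (whole D)" and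
      img: "f ` whole D = vsum (whole D1) (whole D2)"
      using f(1) by (simp_all add: lin_iso_alt bij_betw_def)
    have sD: "fvs.subspace (whole D)" using D by (simp add: is_mflag_alt fin_dim_subspace)
    have yD: "y i \<in> whole D" if "i \<in> K" for i using spn_mem[OF that, of y] y(2) by simp
    have z1: "0 \<in> whole D1" "0 \<in> whole D2"
      using D12 by (simp_all add: is_mflag_alt fin_dim_subspace fvs.subspace_0)
    have alt: "f (y i) \<circ> Inl = 0 \<or> f (y i) \<circ> Inr = 0" if i: "i \<in> K" for i
    proof -
      have im: "i \<in> {1..m}" using i K by auto
      have eq: "vsum (part D1 i) (part D2 i) = fvs.span {f (y i)}"
        using f(2)[OF im] part(1)[OF i] lin_on_span_singleton[OF lin sD yD[OF i]] by simp
      have z2: "0 \<in> part D2 i" using D12(2) im by (simp add: is_mflag_alt fvs.subspace_0)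
      have "f (y i) \<in> vsum (part D1 i) (part D2 i)" unfolding eq by (simp add: fvs.span_base)
      \<comment> \<open>The left component alone is again in the part, because the right part
        contains zero. As the part is a line, this is a multiple \<open>c\<close> of the generator:
        \<open>c = 0\<close> kills the left component, \<open>c \<noteq> 0\<close> the right
        one.\<close>
      then have "case_sum (f (y i) \<circ> Inl) 0 \<in> vsum (part D1 i) (part D2 i)"
        using z2 by (simp add: vsum_def case_sum_o_inj)
      then obtain c where c: "case_sum (f (y i) \<circ> Inl) 0 = fscale c (f (y i))"
        unfolding eq by (auto simp: fvs.span_singleton)
      have cl: "f (y i) (Inl x) = c * f (y i) (Inl x)" for x
        using fun_cong[OF c, of "Inl x"] by (simp add: fscale_apply)
      have cr: "0 = c * f (y i) (Inr x)" for x
        using fun_cong[OF c, of "Inr x"] by (simp add: fscale_apply zero_fun_apply)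
      show ?thesis
      proof (cases "c = 0")
        case True then show ?thesis using cl by (simp add: pointwise)
      next
        case False then show ?thesis using cr by (simp add: pointwise)
      qed
    qed
    have subsp: "fvs.subspace {x \<in> whole D. f x \<circ> h = 0}" for h :: "nat \<Rightarrow> nat + nat"
    proof -
      have "f 0 \<circ> h = 0" using lin_on_0[OF lin fvs.subspace_0[OF sD]] by (simp add: pointwise)
      moreover have "f (a + b) \<circ> h = 0" if "a \<in> whole D" "f a \<circ> h = 0" "b \<in> whole D" "f b \<circ> h = 0" for a b
        using lin_on_add[OF lin that(1,3)] that(2,4) by (simp add: pointwise)
      moreover have "f (fscale c a) \<circ> h = 0" if "a \<in> whole D" "f a \<circ> h = 0" for a c
        using lin_on_scale[OF lin that(1)] that(2) by (simp add: pointwise)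
      ultimately show ?thesis
        using fvs.subspace_0[OF sD] fvs.subspace_add[OF sD] fvs.subspace_scale[OF sD]
        unfolding fvs.subspace_def mem_Collect_eq by simp
    qed
    have vanish: "f z \<circ> h = 0" if "z \<in> spn y S" "S \<subseteq> K" "\<And>i. i \<in> S \<Longrightarrow> f (y i) \<circ> h = 0"
      for z S and h :: "nat \<Rightarrow> nat + nat"
    proof -
      have "spn y S \<subseteq> {x \<in> whole D. f x \<circ> h = 0}"
        by (rule fvs.span_minimal[OF _ subsp]) (use that(2,3) yD in auto)
      then show ?thesis using that(1) by auto
    qed
    define S where "S = {i \<in> K. f (y i) \<circ> Inr = 0}"
    have SK: "S \<subseteq> K" by (auto simp: S_def)
    have "spn y S \<inter> spn y (K - S) \<subseteq> {0}"
    proof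
      fix z assume z: "z \<in> spn y S \<inter> spn y (K - S)"
      have r: "f z \<circ> Inr = 0" by (rule vanish[of z S]) (use z in \<open>auto simp: S_def\<close>)
      have l: "f z \<circ> Inl = 0" by (rule vanish[of z "K - S"]) (use z alt in \<open>auto simp: S_def\<close>)
      have "f z t = 0" for t
        using fun_cong[OF l] fun_cong[OF r] by (cases t) (simp_all add: zero_fun_apply)
      then have "f z = 0" by (simp add: pointwise)
      moreover have "z \<in> whole D" using z spn_mono[OF SK, of y] y(2) by auto
      ultimately show "z \<in> {0}" using lin_on_eq_0[OF lin inj sD] by simp
    qed
    then have "S = {} \<or> S = K" by (rule connD[OF y(1) SK])
    then show ?thesis
    proof
      \<comment> \<open>Now every generator has zero left component, and the generators span
        \<open>whole D\<close>, so the left summand is zero. The case \<open>S = K\<close> is the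
        mirror image.\<close>
      assume S: "S = {}"
      have "whole D1 = {0}"
      proof -
        have "a = 0" if a: "a \<in> whole D1" for a
        proof -
          have "case_sum a 0 \<in> f ` whole D" unfolding img using a z1 by (simp add: vsum_def case_sum_o_inj)
          then obtain x where x: "x \<in> whole D" "case_sum a 0 = f x" by auto
          have "f x \<circ> Inl = 0" by (rule vanish[of x K]) (use x y(2) S alt in \<open>auto simp: S_def\<close>)
          then show "a = 0" using x(2)[symmetric] by (simp add: case_sum_o_inj)
        qed
        then show ?thesis using z1 by auto
      qed
      then show ?thesis using trivial_mflag_iff[OF D12(1)] by simp
    next
      assume S: "S = K"
      have "whole D2 = {0}"
      proof -
        have "a = 0" if a: "a \<in> whole D2" for a
        proof -
          have "case_sum 0 a \<in> f ` whole D" unfolding img using a z1 by (simp add: vsum_def case_sum_o_inj)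
          then obtain x where x: "x \<in> whole D" "case_sum 0 a = f x" by auto
          have "f x \<circ> Inr = 0" by (rule vanish[of x K]) (use x y(2) S in \<open>auto simp: S_def\<close>)
          then show "a = 0" using x(2)[symmetric] by (simp add: case_sum_o_inj)
        qed
        then show ?thesis using z1 by auto
      qed
      then show ?thesis using trivial_mflag_iff[OF D12(2)] by simp
    qed
  qed
  then show ?thesis using D unfolding indecomposable_def by metis
qed

text \<open>Covers summands with an empty block, which have no lines for a connectedness argument.
  Two nonzero summands would contribute two non-proportional vectors to a space spanned by one
  vector.\<close>

lemma dim_1_indecomposable:
  fixes D :: "(nat \<Rightarrow> 'k::field) mflag"
  assumes D: "is_mflag m D" and d: "fvs.dim (whole D) = 1"
  shows "indecomposable m D"
proof -
  have fD: "fin_dim (whole D)" using D by (simp add: is_mflag_alt)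
  obtain y where y: "y \<noteq> 0" "whole D = fvs.span {y}" by (rule fin_dim_dim_1[OF fD d])
  have "trivial_mflag m D1 \<or> trivial_mflag m D2"
    if D12: "is_mflag m D1" "is_mflag m D2" and iso: "mflag_iso m D (D1 \<oplus>\<^sub>F D2)"
    for D1 D2 :: "(nat \<Rightarrow> 'k) mflag"
  proof (rule ccontr)
    assume n: "\<not> ?thesis"
    obtain f where f: "lin_iso f (whole D) (vsum (whole D1) (whole D2))"
      using iso unfolding mflag_iso_def mflag_sum_def by auto
    have z1: "0 \<in> whole D1" "0 \<in> whole D2"
      using D12 by (simp_all add: is_mflag_alt fin_dim_subspace fvs.subspace_0)
    obtain a b where a: "a \<in> whole D1" "a \<noteq> 0" and b: "b \<in> whole D2" "b \<noteq> 0"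
      using n z1 trivial_mflag_iff[OF D12(1)] trivial_mflag_iff[OF D12(2)] by auto
    have "y \<in> whole D" unfolding y(2) by (simp add: fvs.span_base)
    then have img: "vsum (whole D1) (whole D2) = fvs.span {f y}"
      using f lin_on_span_singleton[of f "whole D" y] fin_dim_subspace[OF fD] y(2)
      by (simp add: lin_iso_alt bij_betw_def)
    have "case_sum a 0 \<in> vsum (whole D1) (whole D2)" "case_sum 0 b \<in> vsum (whole D1) (whole D2)"
      using a b z1 by (simp_all add: vsum_def case_sum_o_inj)
    then obtain c e where c: "case_sum a 0 = fscale c (f y)" and e: "case_sum 0 b = fscale e (f y)"
      unfolding img by (auto simp: fvs.span_singleton)
    obtain s t where s: "a s \<noteq> 0" and t: "b t \<noteq> 0" using a(2) b(2) by (auto simp: pointwise)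
    have "a s = c * f y (Inl s)" "0 = c * f y (Inr t)" "0 = e * f y (Inl s)" "b t = e * f y (Inr t)"
      using fun_cong[OF c, of "Inl s"] fun_cong[OF c, of "Inr t"]
        fun_cong[OF e, of "Inl s"] fun_cong[OF e, of "Inr t"] by (simp_all add: fscale_apply zero_fun_apply)
    then show False using s t by auto
  qed
  then show ?thesis using D unfolding indecomposable_def by metis
qed

section \<open>Uniform bookkeeping for the four kinds of summands\<close>

section \<open>Summands of a multiple flag\<close>

text \<open>\<open>Inl k\<close> stands for the \<open>k\<close>-th summand $F_{\emptyset,k}$, the other summands are named by the
  corresponding member of \<open>p\<close>.\<close>

type_synonym summand = "nat + nat set + nat set + nat set \<times> nat"

definition summands :: "nat \<Rightarrow> ptuple \<Rightarrow> summand set" where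
  "summands n p = {1..n - rank_p p} <+> (fst p <+> (fst (snd p) <+> snd (snd p)))"

lemma summands_simps [simp]:
  "Inl k \<in> summands n p \<longleftrightarrow> k \<in> {1..n - rank_p p}"
  "Inr (Inl I) \<in> summands n p \<longleftrightarrow> I \<in> fst p"
  "Inr (Inr (Inl J)) \<in> summands n p \<longleftrightarrow> J \<in> fst (snd p)"
  "Inr (Inr (Inr K)) \<in> summands n p \<longleftrightarrow> K \<in> snd (snd p)"
  by (auto simp: summands_def)

definition blk :: "summand \<Rightarrow> nat set" where
  "blk = case_sum (\<lambda>k. {}) (case_sum id (case_sum id fst))"

definition rk :: "summand \<Rightarrow> nat" where
  "rk = case_sum (\<lambda>k. 1) (case_sum (\<lambda>I. 1) (case_sum (\<lambda>J. card J - 1) snd))"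

type_synonym coord = "(nat \<times> nat) + (nat set \<times> nat) + (nat set \<times> nat) + ((nat set \<times> nat) \<times> nat)"

text \<open>The coordinates of a fourfold direct sum form a nested sum of products. Regrouped as a
  summand together with a position in it, they can be treated without distinguishing the four
  kinds.\<close>

fun pos :: "summand \<times> nat \<Rightarrow> coord" where
  "pos (Inl k, x) = Inl (k, x)"
| "pos (Inr (Inl I), x) = Inr (Inl (I, x))"
| "pos (Inr (Inr (Inl J)), x) = Inr (Inr (Inl (J, x)))"
| "pos (Inr (Inr (Inr K)), x) = Inr (Inr (Inr (K, x)))"

fun unpos :: "coord \<Rightarrow> summand \<times> nat" where
  "unpos (Inl (k, x)) = (Inl k, x)"
| "unpos (Inr (Inl (I, x))) = (Inr (Inl I), x)"
| "unpos (Inr (Inr (Inl (J, x)))) = (Inr (Inr (Inl J)), x)"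
| "unpos (Inr (Inr (Inr (K, x)))) = (Inr (Inr (Inr K)), x)"

lemma unpos_pos [simp]: "unpos (pos t) = t"
  by (cases t rule: pos.cases) auto

lemma pos_unpos [simp]: "pos (unpos z) = z"
  by (cases z rule: unpos.cases) auto

definition cmp :: "(coord \<Rightarrow> 'k) \<Rightarrow> summand \<Rightarrow> nat \<Rightarrow> 'k" where
  "cmp w s = (\<lambda>x. w (pos (s, x)))"

definition emb :: "summand \<Rightarrow> (nat \<Rightarrow> 'k::field) \<Rightarrow> coord \<Rightarrow> 'k" where
  "emb s y = (\<lambda>z. if fst (unpos z) = s then y (snd (unpos z)) else 0)"

lemma cmp_emb: "cmp (emb s y) s' = (if s' = s then y else 0)"
  by (simp add: cmp_def emb_def pointwise)

lemma cmp_eqI: "(\<And>s. cmp w s = cmp w' s) \<Longrightarrow> w = w'"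
proof
  fix z assume "\<And>s. cmp w s = cmp w' s"
  then have "cmp w (fst (unpos z)) (snd (unpos z)) = cmp w' (fst (unpos z)) (snd (unpos z))" by simp
  then show "w z = w' z" by (simp add: cmp_def)
qed

lemma cmp_add: "cmp (w + w') s = cmp w s + cmp w' s"
  and cmp_scale: "cmp (fscale c w) s = fscale c (cmp w s)"
  and cmp_zero: "cmp 0 s = 0"
  by (simp_all add: cmp_def pointwise)

lemma lin_on_emb: "lin_on (emb s) V"
  by (simp add: lin_on_def emb_def pointwise)

lemma inj_emb: "inj_on (emb s) V"
  by (metis cmp_emb inj_onI)

definition bsum :: "summand set \<Rightarrow> (summand \<Rightarrow> (nat \<Rightarrow> 'k::field) set) \<Rightarrow> (coord \<Rightarrow> 'k) set" where
  "bsum S V = {w. (\<forall>s\<in>S. cmp w s \<in> V s) \<and> (\<forall>s. s \<notin> S \<longrightarrow> cmp w s = 0)}"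

definition bigsum :: "nat \<Rightarrow> ptuple \<Rightarrow> (summand \<Rightarrow> (nat \<Rightarrow> 'k::field) mflag) \<Rightarrow> (coord \<Rightarrow> 'k) mflag" where
  "bigsum n p fam = mflag_Sum {1..n - rank_p p} (\<lambda>k. fam (Inl k)) \<oplus>\<^sub>F mflag_Sum (fst p) (\<lambda>I. fam (Inr (Inl I)))
     \<oplus>\<^sub>F mflag_Sum (fst (snd p)) (\<lambda>J. fam (Inr (Inr (Inl J)))) \<oplus>\<^sub>F mflag_Sum (snd (snd p)) (\<lambda>K. fam (Inr (Inr (Inr K))))"

text \<open>Turns the nested direct sum into a single one over \<open>summands n p\<close>, which is
  the form used from here on.\<close>

lemma vsum_bsum:
  "vsum (vSum {1..n - rank_p p} (\<lambda>k. V (Inl k))) (vsum (vSum (fst p) (\<lambda>I. V (Inr (Inl I))))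
     (vsum (vSum (fst (snd p)) (\<lambda>J. V (Inr (Inr (Inl J))))) (vSum (snd (snd p)) (\<lambda>K. V (Inr (Inr (Inr K)))))))
   = bsum (summands n p) V" (is "?L = ?R")
proof -
  have all: "(\<forall>s. P s) \<longleftrightarrow> (\<forall>k. P (Inl k)) \<and> (\<forall>I. P (Inr (Inl I))) \<and> (\<forall>J. P (Inr (Inr (Inl J))))
      \<and> (\<forall>K. P (Inr (Inr (Inr K))))" for P :: "summand \<Rightarrow> bool"
    by (metis sum.exhaust)
  have zero: "f = 0 \<longleftrightarrow> (\<forall>x. f x = 0)" for f :: "nat \<Rightarrow> 'a" by (simp add: pointwise)
  have "w \<in> ?L \<longleftrightarrow> w \<in> ?R" for w
    unfolding vsum_def vSum_def bsum_def mem_Collect_eq Ball_def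
    unfolding all zero
    by (simp add: cmp_def o_def) blast
  then show ?thesis by blast
qed

lemma whole_bigsum: "whole (bigsum n p fam) = bsum (summands n p) (\<lambda>s. whole (fam s))"
  unfolding vsum_bsum[symmetric] by (simp add: bigsum_def mflag_sum_def mflag_Sum_def)

lemma part_bigsum: "part (bigsum n p fam) i = bsum (summands n p) (\<lambda>s. part (fam s) i)"
  unfolding vsum_bsum[symmetric] by (simp add: bigsum_def mflag_sum_def mflag_Sum_def)

lemma constructible_alt:
  fixes F :: "('x \<Rightarrow> 'k::field) mflag"
  shows "constructible n m p F \<longleftrightarrow> (\<exists>fam. (\<forall>s\<in>summands n p. indecomposable m (fam s)
     \<and> has_dim m (fam s) (dvec (blk s) (rk s))) \<and> mflag_iso m F (bigsum n p fam))"
proof -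
  obtain Is Js Ks where p: "p = (Is, Js, Ks)" by (metis prod_cases3)
  show ?thesis
  proof
    assume "constructible n m p F"
    then obtain F0 :: "nat \<Rightarrow> (nat \<Rightarrow> 'k) mflag" and Fa :: "nat set \<Rightarrow> (nat \<Rightarrow> 'k) mflag"
      and D :: "nat set \<Rightarrow> (nat \<Rightarrow> 'k) mflag" and E :: "nat set \<times> nat \<Rightarrow> (nat \<Rightarrow> 'k) mflag" where
      1: "\<forall>k\<in>{1..n - rank_p p}. indecomposable m (F0 k) \<and> has_dim m (F0 k) (dvec {} 1)"
      and 2: "\<forall>I\<in>Is. indecomposable m (Fa I) \<and> has_dim m (Fa I) (dvec I 1)"
      and 3: "\<forall>J\<in>Js. indecomposable m (D J) \<and> has_dim m (D J) (dvec J (card J - 1))"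
      and 4: "\<forall>(K, r)\<in>Ks. indecomposable m (E (K, r)) \<and> has_dim m (E (K, r)) (dvec K r)"
      and 5: "mflag_iso m F (mflag_Sum {1..n - rank_p p} F0 \<oplus>\<^sub>F mflag_Sum Is Fa \<oplus>\<^sub>F mflag_Sum Js D \<oplus>\<^sub>F mflag_Sum Ks E)"
      unfolding constructible_def p prod.case by (elim exE conjE)
    let ?fam = "case_sum F0 (case_sum Fa (case_sum D E))"
    have "\<forall>s\<in>summands n p. indecomposable m (?fam s) \<and> has_dim m (?fam s) (dvec (blk s) (rk s))"
      using 1 2 3 4 by (auto simp: summands_def blk_def rk_def p)
    moreover have "mflag_iso m F (bigsum n p ?fam)" using 5 by (simp add: bigsum_def p)
    ultimately show "\<exists>fam. (\<forall>s\<in>summands n p. indecomposable m (fam s)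
     \<and> has_dim m (fam s) (dvec (blk s) (rk s))) \<and> mflag_iso m F (bigsum n p fam)" by (intro exI conjI)
  next
    assume "\<exists>fam. (\<forall>s\<in>summands n p. indecomposable m (fam s)
     \<and> has_dim m (fam s) (dvec (blk s) (rk s))) \<and> mflag_iso m F (bigsum n p fam)"
    then obtain fam where fam: "\<forall>s\<in>summands n p. indecomposable m (fam s) \<and> has_dim m (fam s) (dvec (blk s) (rk s))"
      and iso: "mflag_iso m F (bigsum n p fam)" by (elim exE conjE)
    have "\<forall>k\<in>{1..n - rank_p p}. indecomposable m (fam (Inl k)) \<and> has_dim m (fam (Inl k)) (dvec {} 1)"
    proof
      fix k assume "k \<in> {1..n - rank_p p}"
      then show "indecomposable m (fam (Inl k)) \<and> has_dim m (fam (Inl k)) (dvec {} 1)"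
        using bspec[OF fam, of "Inl k"] by (simp add: blk_def rk_def)
    qed
    moreover have "\<forall>I\<in>Is. indecomposable m (fam (Inr (Inl I))) \<and> has_dim m (fam (Inr (Inl I))) (dvec I 1)"
    proof
      fix I assume "I \<in> Is"
      then show "indecomposable m (fam (Inr (Inl I))) \<and> has_dim m (fam (Inr (Inl I))) (dvec I 1)"
        using bspec[OF fam, of "Inr (Inl I)"] by (simp add: blk_def rk_def p)
    qed
    moreover have "\<forall>J\<in>Js. indecomposable m (fam (Inr (Inr (Inl J)))) \<and> has_dim m (fam (Inr (Inr (Inl J)))) (dvec J (card J - 1))"
    proof
      fix J assume "J \<in> Js"
      then show "indecomposable m (fam (Inr (Inr (Inl J)))) \<and> has_dim m (fam (Inr (Inr (Inl J)))) (dvec J (card J - 1))"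
        using bspec[OF fam, of "Inr (Inr (Inl J))"] by (simp add: blk_def rk_def p)
    qed
    moreover have "\<forall>(K, r)\<in>Ks. indecomposable m (fam (Inr (Inr (Inr (K, r))))) \<and> has_dim m (fam (Inr (Inr (Inr (K, r))))) (dvec K r)"
    proof clarify
      fix K r assume "(K, r) \<in> Ks"
      then show "indecomposable m (fam (Inr (Inr (Inr (K, r))))) \<and> has_dim m (fam (Inr (Inr (Inr (K, r))))) (dvec K r)"
        using bspec[OF fam, of "Inr (Inr (Inr (K, r)))"] by (simp add: blk_def rk_def p)
    qed
    ultimately show "constructible n m p F"
      using iso unfolding constructible_def p prod.case
      by (intro exI[of _ "\<lambda>k. fam (Inl k)"] exI[of _ "\<lambda>I. fam (Inr (Inl I))"] exI[of _ "\<lambda>J. fam (Inr (Inr (Inl J)))"]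
          exI[of _ "\<lambda>K. fam (Inr (Inr (Inr K)))"] conjI) (simp_all add: bigsum_def)
  qed
qed

definition rep :: "(nat set \<times> nat \<Rightarrow> nat \<Rightarrow> (nat \<Rightarrow> 'k::field) set) \<Rightarrow> summand \<Rightarrow> (nat \<Rightarrow> 'k) mflag" where
  "rep q = case_sum (\<lambda>k. Frep {}) (case_sum Frep (case_sum Drep (\<lambda>(K, r). Erep K r (q (K, r)))))"

lemma Fpq_alt: "Fpq n p q = bigsum n p (rep q)"
  by (cases p) (simp add: Fpq_def bigsum_def rep_def)

subsection \<open>Index sets\<close>

text \<open>The conditions on \<open>p\<close> in terms of summands. The ranks add up to
  \<open>n\<close> because the summands with empty block fill the gap \<open>n - rank_p p\<close>.
  The last property treats the second and third family alike: rank at least two, and more lines than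
  the rank.\<close>

lemma Pset_summands:
  assumes "p \<in> Pset n m"
  shows summands_disjoint: "\<And>s t i. s \<in> summands n p \<Longrightarrow> t \<in> summands n p \<Longrightarrow> i \<in> blk s \<Longrightarrow> i \<in> blk t \<Longrightarrow> s = t"
    and summands_cover: "\<And>i. i \<in> {1..m} \<Longrightarrow> \<exists>s\<in>summands n p. i \<in> blk s"
    and blk_subset: "\<And>s. s \<in> summands n p \<Longrightarrow> blk s \<subseteq> {1..m}"
    and finite_summands: "finite (summands n p)"
    and sum_rk: "(\<Sum>s\<in>summands n p. rk s) = n"
    and blk_empty: "\<And>s. s \<in> summands n p \<Longrightarrow> blk s = {} \<Longrightarrow> rk s = 1"
    and rk_cases: "\<And>s. s \<in> summands n p \<Longrightarrow> rk s \<noteq> 1 \<Longrightarrow> 2 \<le> rk s \<and> rk s + 1 \<le> card (blk s)"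
proof -
  obtain Is Js Ks where p: "p = (Is, Js, Ks)" by (metis prod_cases3)
  have dis: "disjoint_family_on (case_sum id (case_sum id fst)) (Is <+> (Js <+> Ks))"
    and un: "\<Union>Is \<union> \<Union>Js \<union> \<Union>(fst ` Ks) = {1..m}"
    and Is: "\<forall>I\<in>Is. 1 \<le> card I" and Js: "\<forall>J\<in>Js. 3 \<le> card J"
    and Ks: "\<forall>(K, r)\<in>Ks. 4 \<le> r + 2 \<and> r + 2 \<le> card K"
    and rank: "rank_p p \<le> n"
    using assms by (simp_all add: Pset_def p)
  show cover: "\<exists>s\<in>summands n p. i \<in> blk s" if i: "i \<in> {1..m}" for i
  proof -
    have "i \<in> \<Union>Is \<union> \<Union>Js \<union> \<Union>(fst ` Ks)" using i un by simp
    then consider I where "I \<in> Is" "i \<in> I" | J where "J \<in> Js" "i \<in> J" | K where "K \<in> Ks" "i \<in> fst K" by blast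
    then show ?thesis
    proof cases
      case 1 then show ?thesis by (intro bexI[of _ "Inr (Inl I)"]) (auto simp: summands_def blk_def p)
    next
      case 2 then show ?thesis by (intro bexI[of _ "Inr (Inr (Inl J))"]) (auto simp: summands_def blk_def p)
    next
      case 3 then show ?thesis by (intro bexI[of _ "Inr (Inr (Inr K))"]) (auto simp: summands_def blk_def p)
    qed
  qed
  show sub: "blk s \<subseteq> {1..m}" if "s \<in> summands n p" for s
    using that un[symmetric] by (auto simp: summands_def blk_def p)
  have "Is \<subseteq> Pow {1..m}" "Js \<subseteq> Pow {1..m}" "fst ` Ks \<subseteq> Pow {1..m}" using un by auto
  then have fin: "finite Is" "finite Js" "finite (fst ` Ks)" by (auto intro: finite_subset)
  have disD: "case_sum id (case_sum id fst) a \<inter> case_sum id (case_sum id fst) b = {}"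
    if "a \<in> Is <+> (Js <+> Ks)" "b \<in> Is <+> (Js <+> Ks)" "a \<noteq> b" for a b
    using dis that by (simp add: disjoint_family_on_def)
  \<comment> \<open>Nonempty members of a disjoint family are distinct, so no block occurs with two
    ranks; finiteness of \<open>Ks\<close> follows from that of its set of blocks.\<close>
  have "inj_on fst Ks"
  proof (rule inj_onI)
    fix K L assume *: "K \<in> Ks" "L \<in> Ks" "fst K = fst L"
    have "fst K \<noteq> {}" using Ks * by fastforce
    then show "K = L" using disD[of "Inr (Inr K)" "Inr (Inr L)"] * by auto
  qed
  then have finK: "finite Ks" using fin(3) finite_imageD by blast
  show "finite (summands n p)" using fin finK by (simp add: summands_def p)
  show "s = t" if st: "s \<in> summands n p" "t \<in> summands n p" "i \<in> blk s" "i \<in> blk t" for s t i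
  proof -
    obtain a b where s: "s = Inr a" and t: "t = Inr b"
      using st(3,4) by (cases s; cases t) (simp_all add: blk_def)
    have "a \<in> Is <+> (Js <+> Ks)" "b \<in> Is <+> (Js <+> Ks)"
      using st(1,2) by (auto simp: summands_def p s t)
    then show ?thesis using disD[of a b] st(3,4) by (auto simp: blk_def s t)
  qed
  have "(\<Sum>s\<in>summands n p. rk s) = (n - rank_p p) + rank_p p"
    using fin finK by (simp add: summands_def p sum.Plus rk_def rank_p_def case_prod_unfold)
  then show "(\<Sum>s\<in>summands n p. rk s) = n" using rank by simp
  show "rk s = 1" if "s \<in> summands n p" "blk s = {}" for s
    using that Is Js Ks by (auto simp: summands_def blk_def rk_def p)
  show "2 \<le> rk s \<and> rk s + 1 \<le> card (blk s)" if "s \<in> summands n p" "rk s \<noteq> 1" for s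
    using that Is Js Ks by (fastforce simp: summands_def blk_def rk_def p)
qed

text \<open>Blocks are disjoint, so only the summand whose block contains \<open>i\<close>
  contributes to part \<open>i\<close>.\<close>

lemma part_bigsum_blk:
  assumes p: "p \<in> Pset n m" and i: "i \<in> {1..m}" and s: "s \<in> summands n p" "i \<in> blk s"
    and zero: "\<And>t. t \<in> summands n p \<Longrightarrow> i \<notin> blk t \<Longrightarrow> part (fam t) i = {0}"
  shows "part (bigsum n p fam) i = emb s ` part (fam s) i"
proof
  have "0 \<in> part (fam t) i" if t: "t \<in> summands n p" "t \<noteq> s" for t
    using zero[OF t(1)] summands_disjoint[OF p s(1) t(1) s(2)] t(2) by auto
  then show "emb s ` part (fam s) i \<subseteq> part (bigsum n p fam) i"
    using s(1) by (auto simp: part_bigsum bsum_def cmp_emb)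
  show "part (bigsum n p fam) i \<subseteq> emb s ` part (fam s) i"
  proof
    fix w assume w: "w \<in> part (bigsum n p fam) i"
    have "cmp w t = cmp (emb s (cmp w s)) t" for t
    proof (cases "t = s")
      case True then show ?thesis by (simp add: cmp_emb)
    next
      case False
      then have "t \<in> summands n p \<Longrightarrow> i \<notin> blk t" using summands_disjoint[OF p s(1) _ s(2)] by auto
      then have "t \<in> summands n p \<Longrightarrow> cmp w t \<in> {0}" using w zero by (auto simp: part_bigsum bsum_def)
      then show ?thesis using w False by (cases "t \<in> summands n p") (auto simp: part_bigsum bsum_def cmp_emb)
    qed
    then have "w = emb s (cmp w s)" by (rule cmp_eqI)
    moreover have "cmp w s \<in> part (fam s) i" using w s by (auto simp: part_bigsum bsum_def)
    ultimately show "w \<in> emb s ` part (fam s) i" by (rule image_eqI)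
  qed
qed

lemma has_dim_part_zero:
  assumes "has_dim m D (dvec K r)" "i \<in> {1..m}" "i \<notin> K"
  shows "part D i = {0}"
proof -
  have D: "is_mflag m D" "fvs.dim (part D i) = 0" using assms by (simp_all add: has_dim_def dvec_def)
  then have "fin_dim (part D i)" using assms(2) fin_dim_subset[of "whole D" "part D i"] by (simp add: is_mflag_alt)
  then show ?thesis using fin_dim_dim_0[of "part D i"] D(2) by simp
qed

section \<open>Constructibility as a condition on blocks, and its unique solution\<close>

section \<open>Types of line configurations\<close>

text \<open>The counterpart of constructibility without quantifiers over flags: every block is a
  connected separator of the prescribed rank. Summands with empty block impose no condition, since
  their number is determined by \<open>n\<close> and the other ranks.\<close>

definition btype :: "nat \<Rightarrow> nat \<Rightarrow> ptuple \<Rightarrow> (nat \<Rightarrow> nat \<Rightarrow> 'k::field) \<Rightarrow> bool" where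
  "btype n m p v \<longleftrightarrow> (\<forall>s\<in>summands n p. blk s \<noteq> {} \<longrightarrow> conn v (blk s) \<and> fvs.dim (spn v (blk s)) = rk s
     \<and> spn v (blk s) \<inter> spn v ({1..m} - blk s) \<subseteq> {0})"

definition line_flag :: "nat \<Rightarrow> (nat \<Rightarrow> nat \<Rightarrow> 'k::field) \<Rightarrow> (nat \<Rightarrow> 'k) mflag" where
  "line_flag n v = \<lparr>whole = Kpow n, part = (\<lambda>i. fvs.span {v i})\<rparr>"

definition vecs :: "nat \<Rightarrow> nat \<Rightarrow> (nat \<Rightarrow> nat \<Rightarrow> 'k::field) \<Rightarrow> bool" where
  "vecs n m v \<longleftrightarrow> (\<forall>i\<in>{1..m}. v i \<in> Kpow n \<and> v i \<noteq> 0)"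

lemma vecsD: "vecs n m v \<Longrightarrow> i \<in> {1..m} \<Longrightarrow> v i \<in> Kpow n" "vecs n m v \<Longrightarrow> i \<in> {1..m} \<Longrightarrow> v i \<noteq> 0"
  by (simp_all add: vecs_def)

lemma subspace_bsum:
  assumes "\<And>s. s \<in> S \<Longrightarrow> fvs.subspace (V s)"
  shows "fvs.subspace (bsum S V)"
  unfolding fvs.subspace_def bsum_def mem_Collect_eq cmp_add cmp_scale cmp_zero
  using fvs.subspace_0[OF assms] fvs.subspace_add[OF assms] fvs.subspace_scale[OF assms] by simp

text \<open>Under the isomorphism the vectors of a block land in the corresponding summand, where
  indecomposability makes them connected and spanning. Connectedness and rank are then pulled back
  along injective linear maps.\<close>

lemma btype_if_iso:
  fixes v :: "nat \<Rightarrow> nat \<Rightarrow> 'k::field"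
  assumes p: "p \<in> Pset n m" and v: "vecs n m v"
    and fam: "\<And>s. s \<in> summands n p \<Longrightarrow> indecomposable m (fam s) \<and> has_dim m (fam s) (dvec (blk s) (rk s))"
    and iso: "mflag_iso m (line_flag n v) (bigsum n p fam)"
  shows "btype n m p v"
proof -
  let ?S = "summands n p"
  obtain f where f: "lin_iso f (Kpow n) (bsum ?S (\<lambda>s. whole (fam s)))"
    and fp: "\<And>i. i \<in> {1..m} \<Longrightarrow> f ` fvs.span {v i} = part (bigsum n p fam) i"
    using iso unfolding mflag_iso_def line_flag_def whole_bigsum by auto
  have lin: "lin_on f (Kpow n)" and inj: "inj_on f (Kpow n)" using f by (simp_all add: lin_iso_alt bij_betw_def)
  have zero: "part (fam s) i = {0}" if "s \<in> ?S" "i \<in> {1..m}" "i \<notin> blk s" for s i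
    using fam[OF that(1)] that(2,3) has_dim_part_zero[of m "fam s" "blk s" "rk s" i] by simp
  have vspan: "f ` fvs.span {v i} = fvs.span {f (v i)}" if "i \<in> {1..m}" for i
    by (rule lin_on_span_singleton[OF lin subspace_Kpow]) (use vecsD(1)[OF v that] in simp)
  have pe: "fvs.span {f (v i)} = emb s ` part (fam s) i" if s: "s \<in> ?S" "i \<in> blk s" for s i
  proof -
    have i: "i \<in> {1..m}" using blk_subset[OF p s(1)] s(2) by auto
    have "part (bigsum n p fam) i = emb s ` part (fam s) i"
      by (rule part_bigsum_blk[OF p i s]) (rule zero[OF _ i])
    then show ?thesis using fp[OF i] vspan[OF i] by simp
  qed
  have "conn v (blk s) \<and> fvs.dim (spn v (blk s)) = rk s \<and> spn v (blk s) \<inter> spn v ({1..m} - blk s) \<subseteq> {0}"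
    if s: "s \<in> ?S" and ne: "blk s \<noteq> {}" for s
  proof -
    let ?K = "blk s"
    \<comment> \<open>For \<open>i\<close> in the block, \<open>f (v i)\<close> is concentrated in
      component \<open>s\<close>, so its component there carries all the information.\<close>
    let ?y = "\<lambda>i. cmp (f (v i)) s"
    have K: "?K \<subseteq> {1..m}" by (rule blk_subset[OF p s])
    have finK: "finite ?K" by (rule finite_subset[OF K]) simp
    have y: "f (v i) = emb s (?y i)" "part (fam s) i = fvs.span {?y i}" "?y i \<noteq> 0" if i: "i \<in> ?K" for i
    proof -
      have "f (v i) \<in> emb s ` part (fam s) i" using pe[OF s i] fvs.span_base[of "f (v i)" "{f (v i)}"] by simp
      then show e: "f (v i) = emb s (?y i)" by (auto simp: cmp_emb)
      have "emb s ` fvs.span {?y i} = fvs.span {f (v i)}"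
        using lin_on_span_singleton[OF lin_on_emb[of s UNIV] fvs.subspace_UNIV, of "?y i"] e by simp
      then show "part (fam s) i = fvs.span {?y i}"
        using pe[OF s i] inj_image_eq_iff[OF inj_emb[of s UNIV]] by metis
      have im: "i \<in> {1..m}" using K i by auto
      have "f (v i) \<noteq> 0" using lin_on_eq_0[OF lin inj subspace_Kpow] vecsD[OF v im] by blast
      moreover have "emb s (0 :: nat \<Rightarrow> 'k) = 0" using lin_on_0[OF lin_on_emb[of s UNIV]] by simp
      ultimately show "?y i \<noteq> 0" using e by metis
    qed
    have ind: "indecomposable m (fam s)" and hd: "has_dim m (fam s) (dvec ?K (rk s))" using fam[OF s] by simp_all
    have z: "part (fam s) i = {0}" if "i \<in> {1..m} - ?K" for i using zero[OF s] that by simp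
    have c: "conn ?y ?K" and sp: "spn ?y ?K = whole (fam s)"
      using indecomposable_conn[OF ind ne K y(2) z y(3)] by simp_all
    have vK: "v ` ?K \<subseteq> Kpow n" using vecsD(1)[OF v] K by auto
    have "conn (\<lambda>i. f (v i)) ?K \<longleftrightarrow> conn (\<lambda>i. emb s (?y i)) ?K"
      by (rule conn_cong) (use y(1) in simp)
    then have 1: "conn v ?K"
      using c conn_image[OF lin inj subspace_Kpow finK vK]
        conn_image[OF lin_on_emb[of s UNIV] inj_emb[of s UNIV] fvs.subspace_UNIV finK, of ?y] by simp
    have img: "f ` spn v ?K = emb s ` spn ?y ?K"
    proof -
      have "f ` spn v ?K = spn (\<lambda>i. f (v i)) ?K" by (rule lin_on_span[OF lin subspace_Kpow finK vK])
      also have "(\<lambda>i. f (v i)) ` ?K = (\<lambda>i. emb s (?y i)) ` ?K" using y(1) by (intro image_cong) auto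
      also have "fvs.span \<dots> = emb s ` spn ?y ?K"
        by (rule lin_on_span[OF lin_on_emb[of s UNIV] fvs.subspace_UNIV finK, symmetric]) simp
      finally show ?thesis .
    qed
    have vsub: "spn v ?K \<subseteq> Kpow n" by (rule spn_subset[OF subspace_Kpow vK])
    have "fvs.dim (spn v ?K) = fvs.dim (f ` spn v ?K)"
      by (rule dim_image[OF lin inj subspace_Kpow fin_dim_spn[OF finK] vsub, symmetric])
    also have "\<dots> = fvs.dim (spn ?y ?K)"
      unfolding img by (rule dim_image[OF lin_on_emb inj_emb fvs.subspace_UNIV fin_dim_spn[OF finK]]) simp
    also have "\<dots> = rk s" using hd unfolding sp has_dim_def dvec_def by simp
    finally have 2: "fvs.dim (spn v ?K) = rk s" .
    \<comment> \<open>The first span allows \<open>f z\<close> a component in \<open>s\<close> only,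
      the second none in \<open>s\<close>.\<close>
    have 3: "spn v ?K \<inter> spn v ({1..m} - ?K) \<subseteq> {0}"
    proof
      fix z assume z: "z \<in> spn v ?K \<inter> spn v ({1..m} - ?K)"
      have c1: "cmp (f z) t = 0" if "t \<noteq> s" for t
      proof -
        have "f z \<in> emb s ` spn ?y ?K" using z img by auto
        then show ?thesis using that by (auto simp: cmp_emb)
      qed
      have vM: "v ` ({1..m} - ?K) \<subseteq> Kpow n" using vecsD(1)[OF v] by auto
      have "fvs.subspace {w. cmp w s = (0 :: nat \<Rightarrow> 'k)}"
        unfolding fvs.subspace_def mem_Collect_eq cmp_add cmp_scale cmp_zero by simp
      moreover have "(\<lambda>i. f (v i)) ` ({1..m} - ?K) \<subseteq> {w. cmp w s = 0}"
      proof clarify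
        fix i assume i: "i \<in> {1..m}" "i \<notin> ?K"
        obtain t where t: "t \<in> ?S" "i \<in> blk t" using summands_cover[OF p i(1)] by auto
        then have "t \<noteq> s" using i by auto
        moreover have "f (v i) \<in> emb t ` part (fam t) i" using pe[OF t] fvs.span_base[of "f (v i)" "{f (v i)}"] by simp
        ultimately show "cmp (f (v i)) s = 0" by (auto simp: cmp_emb)
      qed
      ultimately have "spn (\<lambda>i. f (v i)) ({1..m} - ?K) \<subseteq> {w. cmp w s = 0}" by (intro fvs.span_minimal)
      moreover have "f ` spn v ({1..m} - ?K) = spn (\<lambda>i. f (v i)) ({1..m} - ?K)"
        by (rule lin_on_span[OF lin subspace_Kpow _ vM]) simp
      ultimately have "cmp (f z) s = 0" using z by auto
      then have "f z = 0" using c1 by (intro cmp_eqI) (metis cmp_zero)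
      then show "z \<in> {0}" using lin_on_eq_0[OF lin inj subspace_Kpow, of z] subsetD[OF vsub] z by simp
    qed
    show ?thesis using 1 2 3 by simp
  qed
  then show ?thesis unfolding btype_def by simp
qed

subsection \<open>Adapted bases\<close>

abbreviation slots :: "nat \<Rightarrow> ptuple \<Rightarrow> (summand \<times> nat) set" where
  "slots n p \<equiv> Sigma (summands n p) (\<lambda>s. {1..rk s})"

definition block_sum :: "nat \<Rightarrow> (nat \<Rightarrow> nat \<Rightarrow> 'k::field) \<Rightarrow> (nat \<Rightarrow> 'k) \<Rightarrow> nat \<Rightarrow> 'k" where
  "block_sum r u y = (\<Sum>x\<in>{1..r}. fscale (y x) (u x))"

lemma lin_on_block_sum: "lin_on (block_sum r u) V"
proof -
  have "block_sum r u (x + y) = block_sum r u x + block_sum r u y" for x y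
    by (simp add: block_sum_def plus_fun_apply fvs.scale_left_distrib sum.distrib)
  moreover have "block_sum r u (fscale c x) = fscale c (block_sum r u x)" for c x
    by (simp add: block_sum_def fscale_apply fvs.scale_sum_right)
  ultimately show ?thesis by (simp add: lin_on_def)
qed

lemma inj_block_sum:
  assumes "indep_fam {1..r} u" shows "inj_on (block_sum r u) (Kpow r)"
proof (rule lin_on_injI[OF lin_on_block_sum subspace_Kpow])
  fix x assume x: "x \<in> Kpow r" "block_sum r u x = 0"
  have "x i = 0" for i
    using indep_famD[OF assms, of x i] x by (cases "i \<in> {1..r}") (auto simp: block_sum_def Kpow_def)
  then show "x = 0" by (simp add: pointwise)
qed

lemma block_sum_Kpow: "block_sum r u ` Kpow r = fvs.span (u ` {1..r})"
proof
  show "block_sum r u ` Kpow r \<subseteq> fvs.span (u ` {1..r})"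
    unfolding block_sum_def by (intro image_subsetI fvs.span_sum fvs.span_scale spn_mem)
  show "fvs.span (u ` {1..r}) \<subseteq> block_sum r u ` Kpow r"
  proof
    fix x assume "x \<in> fvs.span (u ` {1..r})"
    then obtain c where c: "x = (\<Sum>t\<in>{1..r}. fscale (c t) (u t))" by (rule span_famE[OF finite_atLeastAtMost])
    let ?y = "\<lambda>t. if t \<in> {1..r} then c t else 0"
    have "x = block_sum r u ?y" unfolding c block_sum_def by (intro sum.cong) auto
    moreover have "?y \<in> Kpow r" by (simp add: Kpow_def)
    ultimately show "x \<in> block_sum r u ` Kpow r" by (rule image_eqI)
  qed
qed

text \<open>The linear map that sends the unit vector at position \<open>x\<close> of summand
  \<open>s\<close> to \<open>u s x\<close>; with an adapted basis \<open>u\<close> it identifies the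
  direct sum with K^n.\<close>

definition assemble :: "nat \<Rightarrow> ptuple \<Rightarrow> (summand \<Rightarrow> nat \<Rightarrow> nat \<Rightarrow> 'k::field) \<Rightarrow> (coord \<Rightarrow> 'k) \<Rightarrow> nat \<Rightarrow> 'k" where
  "assemble n p u w = (\<Sum>s\<in>summands n p. block_sum (rk s) (u s) (cmp w s))"

lemma assemble_emb:
  assumes "p \<in> Pset n m" "s \<in> summands n p"
  shows "assemble n p u (emb s y) = block_sum (rk s) (u s) y"
proof -
  have "assemble n p u (emb s y) = (\<Sum>t\<in>summands n p. if t = s then block_sum (rk s) (u s) y else 0)"
    unfolding assemble_def by (rule sum.cong) (auto simp: cmp_emb block_sum_def zero_fun_apply)
  then show ?thesis using assms finite_summands[OF assms(1)] by simp
qed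

text \<open>There are exactly \<open>n\<close> slots by \<open>sum_rk\<close>, so an independent
  family indexed by them is already a basis.\<close>

lemma lin_iso_assemble:
  fixes u :: "summand \<Rightarrow> nat \<Rightarrow> nat \<Rightarrow> 'k::field"
  assumes p: "p \<in> Pset n m"
    and u: "indep_fam (slots n p) (case_prod u)" "\<And>s x. s \<in> summands n p \<Longrightarrow> x \<in> {1..rk s} \<Longrightarrow> u s x \<in> Kpow n"
  shows "lin_iso (assemble n p u) (bsum (summands n p) (\<lambda>s. Kpow (rk s))) (Kpow n)"
proof -
  let ?S = "summands n p"
  let ?Z = "bsum ?S (\<lambda>s. Kpow (rk s)) :: (coord \<Rightarrow> 'k) set"
  have finS: "finite ?S" by (rule finite_summands[OF p])
  have finT: "finite (slots n p)" using finS by simp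
  have alt: "assemble n p u w = (\<Sum>t\<in>slots n p. fscale (w (pos t)) (case_prod u t))" for w
    unfolding assemble_def block_sum_def cmp_def using finS by (subst sum.Sigma) (auto simp: case_prod_unfold)
  have sZ: "fvs.subspace ?Z" by (rule subspace_bsum) simp
  have lin: "lin_on (assemble n p u) ?Z"
  proof -
    have "assemble n p u (x + y) = assemble n p u x + assemble n p u y" for x y
      unfolding alt by (simp add: plus_fun_apply fvs.scale_left_distrib sum.distrib)
    moreover have "assemble n p u (fscale c x) = fscale c (assemble n p u x)" for c x
      unfolding alt by (simp add: fscale_apply fvs.scale_sum_right)
    ultimately show ?thesis by (simp add: lin_on_def)
  qed
  have inj: "inj_on (assemble n p u) ?Z"
  proof (rule lin_on_injI[OF lin sZ])
    fix w assume w: "w \<in> ?Z" "assemble n p u w = 0"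
    have "w (pos (s, x)) = 0" for s x
    proof (cases "(s, x) \<in> slots n p")
      case True then show ?thesis using indep_famD[OF u(1), of "\<lambda>t. w (pos t)"] w(2) by (simp only: alt)
    next
      case False
      show ?thesis
      proof (cases "s \<in> ?S")
        case True
        then have "cmp w s \<in> Kpow (rk s)" using w(1) by (simp add: bsum_def)
        then show ?thesis using False True by (auto simp: Kpow_def cmp_def)
      next
        case False
        then have "cmp w s = 0" using w(1) by (simp add: bsum_def)
        from fun_cong[OF this, of x] show ?thesis by (simp add: cmp_def zero_fun_apply)
      qed
    qed
    then have "cmp w s = cmp 0 s" for s by (simp add: cmp_def pointwise)
    then show "w = 0" by (rule cmp_eqI)
  qed
  have uK: "case_prod u ` slots n p \<subseteq> Kpow n" using u(2) by auto
  have "fvs.span (case_prod u ` slots n p) = Kpow n"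
    by (rule indep_fam_spans[OF fin_dim_Kpow u(1) finT uK]) (use sum_rk[OF p] finS in simp)
  moreover have "assemble n p u ` ?Z = fvs.span (case_prod u ` slots n p)"
  proof
    show "assemble n p u ` ?Z \<subseteq> fvs.span (case_prod u ` slots n p)"
      unfolding alt by (intro image_subsetI fvs.span_sum fvs.span_scale spn_mem)
    show "fvs.span (case_prod u ` slots n p) \<subseteq> assemble n p u ` ?Z"
    proof
      fix x assume "x \<in> fvs.span (case_prod u ` slots n p)"
      then obtain c where c: "x = (\<Sum>t\<in>slots n p. fscale (c t) (case_prod u t))" by (rule span_famE[OF finT])
      let ?w = "\<lambda>z. if unpos z \<in> slots n p then c (unpos z) else 0"
      have "x = assemble n p u ?w" unfolding c alt by (intro sum.cong) auto
      moreover have "?w \<in> ?Z" by (auto simp: bsum_def Kpow_def cmp_def pointwise)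
      ultimately show "x \<in> assemble n p u ` ?Z" by (rule image_eqI)
    qed
  qed
  ultimately show ?thesis using lin inj by (simp add: lin_iso_alt bij_betw_def)
qed

text \<open>Indices are added one at a time: as long as fewer than \<open>fvs.dim V\<close> vectors
  are present, some vector of \<open>V\<close> lies outside their span. Prescribed vectors keep
  their index, which a basis extension of sets would not record.\<close>

lemma extend_indep_fam:
  assumes V: "fin_dim V" and T: "finite T" "card T \<le> fvs.dim V" "T0 \<subseteq> T"
    and u: "indep_fam T0 u" "u ` T0 \<subseteq> V"
  shows "\<exists>u'. (\<forall>t\<in>T0. u' t = u t) \<and> indep_fam T u' \<and> u' ` T \<subseteq> V"
proof -
  have "\<exists>u'. (\<forall>t\<in>T0. u' t = u t) \<and> indep_fam (T0 \<union> R) u' \<and> u' ` (T0 \<union> R) \<subseteq> V" if "R \<subseteq> T - T0" for R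
    using finite_subset[OF that finite_Diff[OF T(1)]] that
  proof (induction R)
    case empty
    show ?case by (rule exI[of _ u]) (use u in simp)
  next
    case (insert a R)
    then have "R \<subseteq> T - T0" by simp
    from insert.IH[OF this] obtain u' where u': "\<forall>t\<in>T0. u' t = u t" "indep_fam (T0 \<union> R) u'" "u' ` (T0 \<union> R) \<subseteq> V"
      by (elim exE conjE)
    have fin: "finite (T0 \<union> R)" using insert finite_subset[OF T(3,1)] by simp
    have a: "a \<in> T" "a \<notin> T0 \<union> R" using insert by auto
    have "T0 \<union> R \<subset> T" using insert T(3) by auto
    then have "card (T0 \<union> R) < card T" by (rule psubset_card_mono[OF T(1)])
    then have "fvs.span (u' ` (T0 \<union> R)) \<noteq> V" using dim_span_indep_fam[OF fin u'(2)] T(2) by auto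
    moreover have "fvs.span (u' ` (T0 \<union> R)) \<subseteq> V" by (rule fvs.span_minimal[OF u'(3) fin_dim_subspace[OF V]])
    ultimately obtain x where x: "x \<in> V" "x \<notin> fvs.span (u' ` (T0 \<union> R))" by auto
    let ?u = "u'(a := x)"
    have eq: "\<And>t. t \<in> T0 \<union> R \<Longrightarrow> ?u t = u' t" using a(2) by auto
    have im: "?u ` (T0 \<union> R) = u' ` (T0 \<union> R)" using eq by (rule image_cong[OF refl])
    have "indep_fam (T0 \<union> R) ?u" using u'(2) indep_fam_cong[of "T0 \<union> R" ?u u', OF eq] by simp
    then have "indep_fam (insert a (T0 \<union> R)) ?u" by (rule indep_fam_insert[OF _ fin]) (use x im in simp)
    moreover have "?u ` insert a (T0 \<union> R) \<subseteq> V"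
      unfolding image_insert im fun_upd_same using u'(3) x(1) by (rule insert_subsetI[rotated])
    moreover have "\<forall>t\<in>T0. ?u t = u t" using u'(1) a(2) by auto
    ultimately show ?case by (intro exI[of _ ?u]) (simp only: Un_insert_right simp_thms)
  qed
  from this[OF order_refl] show ?thesis using T(3) by (simp add: Un_absorb1)
qed

text \<open>In a relation, the contribution of one block is minus the sum of the others, hence lies
  in the span of the block and in that of its complement. Separation makes it vanish, and
  independence within the block does the rest.\<close>

lemma indep_fam_blocks:
  fixes u :: "'s \<Rightarrow> 'j \<Rightarrow> 'x \<Rightarrow> 'k::field" and v :: "'i \<Rightarrow> 'x \<Rightarrow> 'k"
  assumes fin: "finite S" "\<And>s. s \<in> S \<Longrightarrow> finite (X s)"
    and blocks: "\<And>s. s \<in> S \<Longrightarrow> K s \<subseteq> M" "\<And>s t. s \<in> S \<Longrightarrow> t \<in> S \<Longrightarrow> s \<noteq> t \<Longrightarrow> K s \<inter> K t = {}"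
    and sep: "\<And>s. s \<in> S \<Longrightarrow> spn v (K s) \<inter> spn v (M - K s) \<subseteq> {0}"
    and u: "\<And>s. s \<in> S \<Longrightarrow> indep_fam (X s) (u s)" "\<And>s x. s \<in> S \<Longrightarrow> x \<in> X s \<Longrightarrow> u s x \<in> spn v (K s)"
  shows "indep_fam (Sigma S X) (case_prod u)"
  unfolding indep_fam_def
proof (intro allI impI ballI)
  fix c t assume c: "(\<Sum>t\<in>Sigma S X. fscale (c t) (case_prod u t)) = 0" and t: "t \<in> Sigma S X"
  obtain s x where s: "t = (s, x)" "s \<in> S" "x \<in> X s" using t by auto
  let ?z = "\<lambda>s. \<Sum>x\<in>X s. fscale (c (s, x)) (u s x)"
  have z: "?z s \<in> spn v (K s)" if "s \<in> S" for s
    by (intro fvs.span_sum fvs.span_scale u(2) that)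
  have "(\<Sum>s\<in>S. ?z s) = (\<Sum>t\<in>Sigma S X. fscale (c t) (case_prod u t))"
    using fin by (subst sum.Sigma) (auto simp: case_prod_unfold)
  then have "?z s + (\<Sum>r\<in>S - {s}. ?z r) = 0" using c fin(1) s(2) by (simp add: sum.remove[of S s])
  then have "?z s = - (\<Sum>r\<in>S - {s}. ?z r)" by (simp add: eq_neg_iff_add_eq_0)
  also have "\<dots> \<in> spn v (M - K s)"
  proof (rule fvs.span_neg, rule fvs.span_sum)
    fix r assume r: "r \<in> S - {s}"
    then have "K r \<subseteq> M - K s" using blocks(1)[of r] blocks(2)[of r s] s(2) by auto
    from spn_mono[OF this, of v] show "?z r \<in> spn v (M - K s)" using z[of r] r by auto
  qed
  finally have "?z s \<in> {0}" using z[OF s(2)] subsetD[OF sep[OF s(2)], of "?z s"] by simp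
  then show "c t = 0" using indep_famD[OF u(1)[OF s(2)], of "\<lambda>x. c (s, x)" x] s by simp
qed

text \<open>Bases of the block spans are jointly independent because blocks are separators; the
  slots of the summands with empty block are filled by any extension to a basis of K^n.\<close>

lemma adapted_basis:
  fixes v :: "nat \<Rightarrow> nat \<Rightarrow> 'k::field"
  assumes p: "p \<in> Pset n m" and v: "vecs n m v" and bt: "btype n m p v"
    and u: "\<And>s. s \<in> summands n p \<Longrightarrow> blk s \<noteq> {} \<Longrightarrow> indep_fam {1..rk s} (u s)"
      "\<And>s. s \<in> summands n p \<Longrightarrow> blk s \<noteq> {} \<Longrightarrow> fvs.span (u s ` {1..rk s}) = spn v (blk s)"
  shows "\<exists>u'. (\<forall>s\<in>summands n p. blk s \<noteq> {} \<longrightarrow> (\<forall>x\<in>{1..rk s}. u' s x = u s x))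
    \<and> lin_iso (assemble n p u') (bsum (summands n p) (\<lambda>s. Kpow (rk s))) (Kpow n)"
proof -
  let ?S = "{s \<in> summands n p. blk s \<noteq> {}}"
  let ?T0 = "Sigma ?S (\<lambda>s. {1..rk s})"
  have vK: "spn v (blk s) \<subseteq> Kpow n" if "s \<in> ?S" for s
    using vecsD(1)[OF v] subsetD[OF blk_subset[OF p, of s]] that by (intro spn_subset[OF subspace_Kpow]) blast
  have mem: "u s x \<in> spn v (blk s)" if "s \<in> ?S" "x \<in> {1..rk s}" for s x
    using u(2)[of s] that fvs.span_base[of "u s x" "u s ` {1..rk s}"] by auto
  have ind: "indep_fam ?T0 (case_prod u)"
  proof (rule indep_fam_blocks[where K = blk and M = "{1..m}" and v = v])
    show "blk s \<inter> blk t = {}" if "s \<in> ?S" "t \<in> ?S" "s \<noteq> t" for s t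
      using summands_disjoint[OF p] that by blast
    show "spn v (blk s) \<inter> spn v ({1..m} - blk s) \<subseteq> {0}" if "s \<in> ?S" for s
      using bt that unfolding btype_def by simp
  qed (use finite_summands[OF p] blk_subset[OF p] u(1) mem in auto)
  have im: "case_prod u ` ?T0 \<subseteq> Kpow n"
  proof clarify
    fix s x assume "s \<in> summands n p" "blk s \<noteq> {}" "x \<in> {1..rk s}"
    then show "u s x \<in> Kpow n" using mem[of s x] vK[of s] by auto
  qed
  have "finite (slots n p)" using finite_summands[OF p] by simp
  moreover have "card (slots n p) \<le> fvs.dim (Kpow n :: (nat \<Rightarrow> 'k) set)"
    using sum_rk[OF p] finite_summands[OF p] by simp
  moreover have "?T0 \<subseteq> slots n p" by auto
  ultimately have "\<exists>u'. (\<forall>t\<in>?T0. u' t = case_prod u t) \<and> indep_fam (slots n p) u' \<and> u' ` slots n p \<subseteq> Kpow n"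
    by (rule extend_indep_fam[OF fin_dim_Kpow _ _ _ ind im])
  then obtain u' where u': "\<forall>t\<in>?T0. u' t = case_prod u t" "indep_fam (slots n p) u'" "u' ` slots n p \<subseteq> Kpow n"
    by (elim exE conjE)
  let ?u = "\<lambda>s x. u' (s, x)"
  have "lin_iso (assemble n p ?u) (bsum (summands n p) (\<lambda>s. Kpow (rk s))) (Kpow n)"
    by (rule lin_iso_assemble[OF p]) (use u'(2,3) in auto)
  then show ?thesis using u'(1) by (intro exI[of _ ?u]) simp
qed

lemma bsum_cong: "(\<And>s. s \<in> S \<Longrightarrow> V s = W s) \<Longrightarrow> bsum S V = bsum S W"
  by (simp add: bsum_def)

lemma assemble_bigsum:
  assumes p: "p \<in> Pset n m"
    and u: "lin_iso (assemble n p u) (bsum (summands n p) (\<lambda>s. Kpow (rk s))) (Kpow n)"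
    and fam: "\<And>s. s \<in> summands n p \<Longrightarrow> whole (fam s) = Kpow (rk s)"
      "\<And>s i. s \<in> summands n p \<Longrightarrow> i \<in> {1..m} \<Longrightarrow> i \<notin> blk s \<Longrightarrow> part (fam s) i = {0}"
      "\<And>s i. s \<in> summands n p \<Longrightarrow> i \<in> blk s \<Longrightarrow> block_sum (rk s) (u s) ` part (fam s) i = fvs.span {v i}"
  shows "lin_iso (assemble n p u) (whole (bigsum n p fam)) (Kpow n)"
    and "\<And>i. i \<in> {1..m} \<Longrightarrow> assemble n p u ` part (bigsum n p fam) i = fvs.span {v i}"
proof -
  have "whole (bigsum n p fam) = bsum (summands n p) (\<lambda>s. Kpow (rk s))"
    unfolding whole_bigsum by (rule bsum_cong) (rule fam(1))
  then show "lin_iso (assemble n p u) (whole (bigsum n p fam)) (Kpow n)" using u by simp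
  fix i assume i: "i \<in> {1..m}"
  obtain s where s: "s \<in> summands n p" "i \<in> blk s" using summands_cover[OF p i] by auto
  have "part (bigsum n p fam) i = emb s ` part (fam s) i"
    by (rule part_bigsum_blk[OF p i s]) (rule fam(2)[OF _ i])
  then have "assemble n p u ` part (bigsum n p fam) i = block_sum (rk s) (u s) ` part (fam s) i"
    by (simp add: image_image assemble_emb[OF p s(1)])
  then show "assemble n p u ` part (bigsum n p fam) i = fvs.span {v i}" using fam(3)[OF s] by simp
qed

lemma subspace_whole_bigsum:
  assumes "\<And>s. s \<in> summands n p \<Longrightarrow> is_mflag m (fam s)"
  shows "fvs.subspace (whole (bigsum n p fam))" and "i \<in> {1..m} \<Longrightarrow> part (bigsum n p fam) i \<subseteq> whole (bigsum n p fam)"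
proof -
  have fam: "fvs.subspace (whole (fam s))" "\<And>i. i \<in> {1..m} \<Longrightarrow> part (fam s) i \<subseteq> whole (fam s)"
    if "s \<in> summands n p" for s
    using assms[OF that] by (simp_all add: is_mflag_alt fin_dim_subspace)
  show "fvs.subspace (whole (bigsum n p fam))"
    unfolding whole_bigsum by (rule subspace_bsum) (rule fam(1))
  show "part (bigsum n p fam) i \<subseteq> whole (bigsum n p fam)" if "i \<in> {1..m}"
    unfolding whole_bigsum part_bigsum bsum_def using subsetD[OF fam(2)[OF _ that]] by blast
qed

text \<open>Each block span is identified with \<open>Kpow (rk s)\<close> through a basis. The
  coordinate vectors of the lines make up the summand, and their connectedness makes it
  indecomposable.\<close>

lemma constructible_if_btype:
  fixes v :: "nat \<Rightarrow> nat \<Rightarrow> 'k::field"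
  assumes p: "p \<in> Pset n m" and v: "vecs n m v" and bt: "btype n m p v"
  shows "constructible n m p (line_flag n v)"
proof -
  let ?S = "summands n p"
  have finK: "finite (blk s)" if "s \<in> ?S" for s by (rule finite_subset[OF blk_subset[OF p that]]) simp
  have "\<exists>u. s \<in> ?S \<longrightarrow> blk s \<noteq> {} \<longrightarrow> indep_fam {1..rk s} u \<and> fvs.span (u ` {1..rk s}) = spn v (blk s)" for s
  proof (cases "s \<in> ?S \<and> blk s \<noteq> {}")
    case True
    then have "fvs.dim (spn v (blk s)) = rk s" using bt unfolding btype_def by simp
    then obtain u where "indep_fam {1..rk s} u" "fvs.span (u ` {1..rk s}) = spn v (blk s)"
      using fin_dim_basis_fam[OF fin_dim_spn[OF finK]] True by metis
    then show ?thesis by (intro exI[of _ u]) simp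
  qed simp
  then obtain u0 where u0: "\<And>s. s \<in> ?S \<Longrightarrow> blk s \<noteq> {} \<Longrightarrow> indep_fam {1..rk s} (u0 s)"
    "\<And>s. s \<in> ?S \<Longrightarrow> blk s \<noteq> {} \<Longrightarrow> fvs.span (u0 s ` {1..rk s}) = spn v (blk s)" by metis
  have "\<exists>u. (\<forall>s\<in>?S. blk s \<noteq> {} \<longrightarrow> (\<forall>x\<in>{1..rk s}. u s x = u0 s x))
    \<and> lin_iso (assemble n p u) (bsum ?S (\<lambda>s. Kpow (rk s))) (Kpow n)"
    by (rule adapted_basis[OF p v bt]) (rule u0; assumption)+
  then obtain u where u: "\<forall>s\<in>?S. blk s \<noteq> {} \<longrightarrow> (\<forall>x\<in>{1..rk s}. u s x = u0 s x)"
    and iso: "lin_iso (assemble n p u) (bsum ?S (\<lambda>s. Kpow (rk s))) (Kpow n)"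
    by (elim exE conjE)
  have ui: "indep_fam {1..rk s} (u s)" and us: "block_sum (rk s) (u s) ` Kpow (rk s) = spn v (blk s)"
    if "s \<in> ?S" "blk s \<noteq> {}" for s
  proof -
    have e: "\<And>x. x \<in> {1..rk s} \<Longrightarrow> u s x = u0 s x" using u that by simp
    show "indep_fam {1..rk s} (u s)" using u0(1)[OF that] indep_fam_cong[of "{1..rk s}" "u s" "u0 s", OF e] by simp
    have "u s ` {1..rk s} = u0 s ` {1..rk s}" using e by (intro image_cong) simp_all
    then show "block_sum (rk s) (u s) ` Kpow (rk s) = spn v (blk s)"
      unfolding block_sum_Kpow using u0(2)[OF that] by simp
  qed
  define y where "y s i = inv_into (Kpow (rk s)) (block_sum (rk s) (u s)) (v i)" for s i
  have y: "y s i \<in> Kpow (rk s)" "block_sum (rk s) (u s) (y s i) = v i" if s: "s \<in> ?S" and i: "i \<in> blk s" for s i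
  proof -
    have "v i \<in> block_sum (rk s) (u s) ` Kpow (rk s)" using us[OF s] spn_mem[OF i, of v] i by auto
    then show "y s i \<in> Kpow (rk s)" "block_sum (rk s) (u s) (y s i) = v i"
      by (simp_all add: y_def inv_into_into f_inv_into_f)
  qed
  have y0: "y s i \<noteq> 0" if s: "s \<in> ?S" and i: "i \<in> blk s" for s i
  proof
    assume "y s i = 0"
    then have "v i = 0" using y[OF s i] lin_on_0[OF lin_on_block_sum[of "rk s" "u s" UNIV]] by auto
    then show False using vecsD(2)[OF v] blk_subset[OF p s] i by auto
  qed
  define fam where "fam s = \<lparr>whole = Kpow (rk s), part = (\<lambda>i. if i \<in> blk s then fvs.span {y s i} else {0})\<rparr>" for s
  have mf: "is_mflag m (fam s)" if s: "s \<in> ?S" for s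
  proof -
    have "fvs.span {y s i} \<subseteq> Kpow (rk s)" if "i \<in> blk s" for i
      by (rule fvs.span_minimal) (use y(1)[OF s that] in simp_all)
    moreover have "(0 :: nat \<Rightarrow> 'k) \<in> Kpow (rk s)" by (rule fvs.subspace_0[OF subspace_Kpow])
    ultimately show ?thesis by (simp add: is_mflag_alt fam_def)
  qed
  have hd: "has_dim m (fam s) (dvec (blk s) (rk s))" if s: "s \<in> ?S" for s
  proof -
    have "fvs.dim ({0} :: (nat \<Rightarrow> 'k) set) = 0" using fin_dim_dim_0[OF fin_dim_span[of "{}"]] by simp
    then show ?thesis using mf[OF s] y0[OF s] by (simp add: has_dim_def dvec_def fam_def dim_line del: fvs.dim_span)
  qed
  have ind: "indecomposable m (fam s)" if s: "s \<in> ?S" for s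
  proof (cases "blk s = {}")
    case True
    then have "rk s = 1" using blk_empty[OF p s] by simp
    then show ?thesis using dim_1_indecomposable[OF mf[OF s]] by (simp add: fam_def)
  next
    case False
    let ?L = "block_sum (rk s) (u s)"
    have inj: "inj_on ?L (Kpow (rk s))" by (rule inj_block_sum[OF ui[OF s False]])
    have yK: "y s ` blk s \<subseteq> Kpow (rk s)" using y(1)[OF s] by auto
    have eq: "(\<lambda>i. ?L (y s i)) ` blk s = v ` blk s" using y(2)[OF s] by (intro image_cong) simp_all
    have "conn (\<lambda>i. ?L (y s i)) (blk s) \<longleftrightarrow> conn v (blk s)"
      by (rule conn_cong) (simp add: y(2)[OF s])
    moreover have "conn v (blk s)" using bt s False unfolding btype_def by simp
    ultimately have c: "conn (y s) (blk s)"
      using conn_image[OF lin_on_block_sum inj subspace_Kpow finK[OF s] yK] by simp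
    have "?L ` spn (y s) (blk s) = ?L ` Kpow (rk s)"
      using lin_on_span[OF lin_on_block_sum subspace_Kpow finK[OF s] yK] eq us[OF s False] by simp
    then have "spn (y s) (blk s) = Kpow (rk s)"
      using inj_on_image_eq_iff[OF inj spn_subset[OF subspace_Kpow yK] order_refl] by simp
    then show ?thesis using c by (intro conn_indecomposable[OF mf[OF s] blk_subset[OF p s]]) (simp_all add: fam_def)
  qed
  have pt: "block_sum (rk s) (u s) ` part (fam s) i = fvs.span {v i}" if s: "s \<in> ?S" and i: "i \<in> blk s" for s i
    using lin_on_span_singleton[OF lin_on_block_sum fvs.subspace_UNIV, of "y s i" "rk s" "u s"] y(2)[OF s i] i
    by (simp add: fam_def)
  have "mflag_iso m (bigsum n p fam) (line_flag n v)"
  proof -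
    have 1: "\<And>s. s \<in> ?S \<Longrightarrow> whole (fam s) = Kpow (rk s)" by (simp add: fam_def)
    have 2: "\<And>s i. s \<in> ?S \<Longrightarrow> i \<in> {1..m} \<Longrightarrow> i \<notin> blk s \<Longrightarrow> part (fam s) i = {0}" by (simp add: fam_def)
    show ?thesis
      unfolding mflag_iso_def
      using assemble_bigsum[OF p iso 1 2 pt] by (intro exI[of _ "assemble n p u"]) (simp add: line_flag_def)
  qed
  then have "mflag_iso m (line_flag n v) (bigsum n p fam)"
    by (rule mflag_iso_sym) (use subspace_whole_bigsum[of n p m fam] mf in simp_all)
  then show ?thesis unfolding constructible_alt using ind hd by (intro exI[of _ fam]) simp
qed

lemma constructible_iff_btype:
  assumes "p \<in> Pset n m" "vecs n m v"
  shows "constructible n m p (line_flag n v) \<longleftrightarrow> btype n m p v"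
proof
  assume "constructible n m p (line_flag n v)"
  then obtain fam where "\<forall>s\<in>summands n p. indecomposable m (fam s) \<and> has_dim m (fam s) (dvec (blk s) (rk s))"
    "mflag_iso m (line_flag n v) (bigsum n p fam)"
    unfolding constructible_alt by (elim exE conjE)
  then show "btype n m p v" by (intro btype_if_iso[OF assms]) simp_all
qed (rule constructible_if_btype[OF assms])

subsection \<open>Existence and uniqueness of the type\<close>

text \<open>The connected separators that partition the index set are sorted into the three families
  by comparing rank and size.\<close>

lemma btype_exists:
  fixes v :: "nat \<Rightarrow> nat \<Rightarrow> 'k::field"
  assumes v: "vecs n m v"
  shows "\<exists>p\<in>Pset n m. btype n m p v"
proof -
  let ?M = "{1..m}"
  let ?r = "\<lambda>K. fvs.dim (spn v K)"
  have "spn v ?M \<inter> spn v (?M - ?M) \<subseteq> {0}" by simp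
  from connected_partition[OF _ order_refl this]
  obtain P where P: "\<Union>P = ?M" "disjoint P" "{} \<notin> P" "\<forall>K\<in>P. conn v K \<and> spn v K \<inter> spn v (?M - K) \<subseteq> {0}"
    by auto
  have sub: "K \<subseteq> ?M" if "K \<in> P" for K using P(1) that by auto
  have finP: "finite P" using P(1) finite_UnionD[of P] by simp
  have finK: "finite K" if "K \<in> P" for K by (rule finite_subset[OF sub[OF that]]) simp
  have r1: "1 \<le> ?r K" if K: "K \<in> P" for K
  proof -
    have "K \<noteq> {}" using P(3) K by metis
    then obtain i where i: "i \<in> K" by auto
    then have "v i \<noteq> 0" "v i \<in> spn v K" using vecsD(2)[OF v] sub[OF K] spn_mem by auto
    then have "spn v K \<noteq> {0}" by auto
    then show ?thesis using fin_dim_dim_0[OF fin_dim_spn[OF finK[OF K]], of v] by simp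
  qed
  have r2: "?r K + 1 \<le> card K" if K: "K \<in> P" "2 \<le> ?r K" for K
  proof -
    have "?r K \<le> card (v ` K)" unfolding fvs.dim_span using fvs.dim_le_card'[of "v ` K"] finK[OF K(1)] by simp
    also have "\<dots> \<le> card K" by (rule card_image_le[OF finK[OF K(1)]])
    finally have "2 \<le> card K" using K(2) by simp
    then show ?thesis using conn_rank_less[OF finK[OF K(1)]] P(4) K(1) by fastforce
  qed
  \<comment> \<open>Nothing is left over: rank 0 is impossible because the vectors are nonzero, and
    a block of rank at least 2 has more elements than its rank by connectedness.\<close>
  let ?A = "{K\<in>P. ?r K = 1}" and ?B = "{K\<in>P. 2 \<le> ?r K \<and> card K = ?r K + 1}"
    and ?C = "{K\<in>P. 2 \<le> ?r K \<and> ?r K + 2 \<le> card K}"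
  let ?g = "\<lambda>K. (K, ?r K)"
  let ?p = "(?A, ?B, ?g ` ?C)"
  have cases: "P = ?A \<union> ?B \<union> ?C" using r1 r2 by fastforce
  have inj: "inj_on ?g ?C" by (simp add: inj_on_def)
  have "rank_p ?p = (\<Sum>K\<in>?A. ?r K) + (\<Sum>K\<in>?B. ?r K) + (\<Sum>K\<in>?C. ?r K)"
  proof -
    have "(\<Sum>(K, r)\<in>?g ` ?C. r) = (\<Sum>K\<in>?C. ?r K)" by (subst sum.reindex[OF inj]) (simp add: o_def)
    then show ?thesis by (simp add: rank_p_def)
  qed
  also have "\<dots> = (\<Sum>K\<in>?A \<union> ?B \<union> ?C. ?r K)"
  proof -
    have "finite ?A" "finite ?B" "finite ?C" using finP by simp_all
    moreover have "?A \<inter> ?B = {}" "(?A \<union> ?B) \<inter> ?C = {}" by auto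
    ultimately show ?thesis by (simp add: sum.union_disjoint)
  qed
  also have "\<dots> = (\<Sum>K\<in>P. ?r K)" using cases by simp
  \<comment> \<open>Bases of the block spans together form an independent family in K^n.\<close>
  also have "\<dots> \<le> n"
  proof -
    have "\<exists>u. K \<in> P \<longrightarrow> indep_fam {1..?r K} u \<and> fvs.span (u ` {1..?r K}) = spn v K" for K
    proof (cases "K \<in> P")
      case True
      obtain u where "indep_fam {1..?r K} u" "fvs.span (u ` {1..?r K}) = spn v K"
        by (rule fin_dim_basis_fam[OF fin_dim_spn[OF finK[OF True]]])
      then show ?thesis by (intro exI[of _ u]) simp
    qed simp
    then obtain u where u: "\<And>K. K \<in> P \<Longrightarrow> indep_fam {1..?r K} (u K)"
      "\<And>K. K \<in> P \<Longrightarrow> fvs.span (u K ` {1..?r K}) = spn v K" by metis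
    have mem: "u K x \<in> spn v K" if "K \<in> P" "x \<in> {1..?r K}" for K x
      using u(2)[OF that(1)] spn_mem[OF that(2), of "u K"] by simp
    have "indep_fam (Sigma P (\<lambda>K. {1..?r K})) (case_prod u)"
    proof (rule indep_fam_blocks[where K = "\<lambda>K. K" and M = ?M and v = v])
      show "K \<inter> L = {}" if "K \<in> P" "L \<in> P" "K \<noteq> L" for K L using P(2) that by (rule disjointD)
    qed (use finP sub P(4) u(1) mem in auto)
    moreover have "case_prod u ` Sigma P (\<lambda>K. {1..?r K}) \<subseteq> Kpow n"
    proof clarify
      fix K x assume K: "K \<in> P" and x: "x \<in> {1..?r K}"
      have "v ` K \<subseteq> Kpow n" using vecsD(1)[OF v] subsetD[OF sub[OF K]] by blast
      then have "spn v K \<subseteq> Kpow n" by (rule spn_subset[OF subspace_Kpow])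
      then show "u K x \<in> Kpow n" using mem[OF K x] by auto
    qed
    ultimately have "card (Sigma P (\<lambda>K. {1..?r K})) \<le> fvs.dim (Kpow n :: (nat \<Rightarrow> 'k) set)"
      using finP by (intro indep_fam_card_le[OF fin_dim_Kpow]) simp_all
    then show ?thesis using finP by simp
  qed
  finally have rank: "rank_p ?p \<le> n" .
  have "?p \<in> Pset n m"
    unfolding Pset_def mem_Collect_eq prod.case
  proof (intro conjI)
    show "disjoint_family_on (case_sum id (case_sum id fst)) (?A <+> (?B <+> ?g ` ?C))"
      unfolding disjoint_family_on_def
    proof (intro ballI impI)
      let ?F = "case_sum id (case_sum id fst)"
      fix a b assume ab: "a \<in> ?A <+> (?B <+> ?g ` ?C)" "b \<in> ?A <+> (?B <+> ?g ` ?C)" "a \<noteq> b"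
      have "?F a \<in> P" "?F b \<in> P" using ab(1,2) by (auto simp: Plus_def)
      moreover have "?F a \<noteq> ?F b" using ab by (auto simp: Plus_def)
      ultimately show "?F a \<inter> ?F b = {}" by (rule disjointD[OF P(2)])
    qed
    show "\<Union>?A \<union> \<Union>?B \<union> \<Union>(fst ` ?g ` ?C) = {1..m}"
    proof -
      have "fst ` ?g ` ?C = ?C" by (simp add: image_image)
      then have "\<Union>?A \<union> \<Union>?B \<union> \<Union>(fst ` ?g ` ?C) = \<Union>(?A \<union> ?B \<union> ?C)" by (simp only: Union_Un_distrib)
      also have "\<dots> = \<Union>P" by (rule arg_cong[where f = Union, OF cases[symmetric]])
      also have "\<dots> = {1..m}" by (rule P(1))
      finally show ?thesis .
    qed
    show "\<forall>I\<in>?A. 1 \<le> card I" using P(3) finK by (auto simp: Suc_le_eq card_gt_0_iff)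
    show "rank_p ?p \<le> n" by (rule rank)
  qed auto
  moreover have "btype n m ?p v"
    unfolding btype_def
  proof (intro ballI impI)
    fix s assume s: "s \<in> summands n ?p" "blk s \<noteq> {}"
    have "blk s \<in> P \<and> ?r (blk s) = rk s"
      using s by (auto simp: summands_def blk_def rk_def)
    then show "conn v (blk s) \<and> ?r (blk s) = rk s \<and> spn v (blk s) \<inter> spn v (?M - blk s) \<subseteq> {0}"
      using P(4) by simp
  qed
  ultimately show ?thesis by (intro bexI[of _ ?p])
qed

text \<open>Block and rank reveal the family: the rank is 1 in the first,
  \<open>card - 1 \<ge> 2\<close> in the second, and between 2 and \<open>card - 2\<close> in the
  third.\<close>

lemma summand_eq_if_same_block:
  assumes "p \<in> Pset n m" "q \<in> Pset n m" "s \<in> summands n p" "t \<in> summands n q"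
    and "blk s = blk t" "blk s \<noteq> {}" "rk s = rk t"
  shows "s = t"
proof -
  obtain Is Js Ks where p: "p = (Is, Js, Ks)" by (metis prod_cases3)
  obtain Is' Js' Ks' where q: "q = (Is', Js', Ks')" by (metis prod_cases3)
  have "\<forall>J\<in>Js. 3 \<le> card J" "\<forall>J\<in>Js'. 3 \<le> card J" "\<forall>(K, r)\<in>Ks. 4 \<le> r + 2 \<and> r + 2 \<le> card K"
    "\<forall>(K, r)\<in>Ks'. 4 \<le> r + 2 \<and> r + 2 \<le> card K"
    using assms(1,2) by (auto simp: Pset_def p q)
  then show ?thesis using assms(3-7) by (fastforce simp: summands_def blk_def rk_def p q)
qed

text \<open>Blocks of \<open>p\<close> and of \<open>q\<close> that share an index are both
  connected separators of the same vectors, so each contains the other; equal blocks have equal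
  rank.\<close>

lemma btype_summand_subset:
  assumes p: "p \<in> Pset n m" "btype n m p v" and q: "q \<in> Pset n m" "btype n m q v"
    and s: "s \<in> summands n p" "blk s \<noteq> {}"
  shows "s \<in> summands n q"
proof -
  obtain i where i: "i \<in> blk s" using s(2) by auto
  then have "i \<in> {1..m}" using blk_subset[OF p(1) s(1)] by auto
  then obtain t where t: "t \<in> summands n q" "i \<in> blk t" using summands_cover[OF q(1)] by auto
  have tne: "blk t \<noteq> {}" using t by auto
  have bs: "conn v (blk s)" "fvs.dim (spn v (blk s)) = rk s" "spn v (blk s) \<inter> spn v ({1..m} - blk s) \<subseteq> {0}"
    using p(2) s unfolding btype_def by simp_all
  have bt: "conn v (blk t)" "fvs.dim (spn v (blk t)) = rk t" "spn v (blk t) \<inter> spn v ({1..m} - blk t) \<subseteq> {0}"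
    using q(2) t(1) tne unfolding btype_def by simp_all
  have "blk s \<subseteq> blk t"
    by (rule connected_separators_meet[OF _ blk_subset[OF p(1) s(1)] bs(1) bt(3)]) (use i t in auto)
  moreover have "blk t \<subseteq> blk s"
    by (rule connected_separators_meet[OF _ blk_subset[OF q(1) t(1)] bt(1) bs(3)]) (use i t in auto)
  ultimately have "blk s = blk t" by simp
  then have "s = t" using bs(2) bt(2) summand_eq_if_same_block[OF p(1) q(1) s(1) t(1) _ s(2)] by simp
  then show ?thesis using t by simp
qed

lemma btype_unique:
  assumes p: "p \<in> Pset n m" "btype n m p v" and q: "q \<in> Pset n m" "btype n m q v"
  shows "p = q"
proof -
  have *: "s \<in> summands n p \<longleftrightarrow> s \<in> summands n q" if "blk s \<noteq> {}" for s
    using btype_summand_subset[OF p q _ that] btype_summand_subset[OF q p _ that] by auto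
  \<comment> \<open>Only the padding summands \<open>Inl k\<close> have an empty block, so
    \<open>btype\<close> tests every member of \<open>p\<close> and of \<open>q\<close>.\<close>
  have ne: "blk (Inr s) \<noteq> {}" if "Inr s \<in> summands n p \<or> Inr s \<in> summands n q" for s
  proof -
    have "blk (Inr s) \<noteq> {}" if r: "r \<in> Pset n m" "Inr s \<in> summands n r" for r
    proof -
      obtain Is Js Ks where e: "r = (Is, Js, Ks)" by (metis prod_cases3)
      show ?thesis using r unfolding e by (fastforce simp: Pset_def summands_def blk_def)
    qed
    then show ?thesis using p(1) q(1) that by metis
  qed
  then have **: "Inr s \<in> summands n p \<longleftrightarrow> Inr s \<in> summands n q" for s using * by metis
  have "fst p = fst q" "fst (snd p) = fst (snd q)" "snd (snd p) = snd (snd q)"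
    using **[of "Inl _"] **[of "Inr (Inl _)"] **[of "Inr (Inr _)"] by auto
  then show ?thesis by (simp add: prod_eq_iff)
qed

lemma finite_Pset: "finite (Pset n m)"
proof (rule finite_subset)
  show "Pset n m \<subseteq> Pow (Pow {1..m}) \<times> Pow (Pow {1..m}) \<times> Pow (Pow {1..m} \<times> {..m})"
  proof
    fix p assume "p \<in> Pset n m"
    moreover obtain Is Js Ks where p: "p = (Is, Js, Ks)" by (metis prod_cases3)
    ultimately have un: "\<Union>Is \<union> \<Union>Js \<union> \<Union>(fst ` Ks) = {1..m}" and Ks: "\<forall>(K, r)\<in>Ks. 4 \<le> r + 2 \<and> r + 2 \<le> card K"
      by (simp_all add: Pset_def)
    have "(K, r) \<in> Pow {1..m} \<times> {..m}" if K: "(K, r) \<in> Ks" for K r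
    proof -
      have s: "K \<subseteq> {1..m}" unfolding un[symmetric] using K by force
      then have "card K \<le> card {1..m}" by (intro card_mono) simp_all
      moreover have "r \<le> card K" using Ks K by auto
      ultimately show ?thesis using s by simp
    qed
    moreover have "Is \<subseteq> Pow {1..m}" "Js \<subseteq> Pow {1..m}" unfolding un[symmetric] by auto
    ultimately show "p \<in> Pow (Pow {1..m}) \<times> Pow (Pow {1..m}) \<times> Pow (Pow {1..m} \<times> {..m})"
      by (simp add: subset_iff p)
  qed
qed simp

section \<open>Projective frames, normal forms and the parameter of a generic tuple\<close>

section \<open>Configurations in general position\<close>

lemma bij_index_in:
  assumes "finite K"
  shows "bij_betw (index_in K) K {1..card K}"
proof -
  have less: "index_in K i < index_in K j" if "i \<in> K" "j \<in> K" "i < j" for i j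
  proof -
    have "{l \<in> K. l \<le> i} \<subseteq> {l \<in> K. l \<le> j}" "j \<in> {l \<in> K. l \<le> j}" "j \<notin> {l \<in> K. l \<le> i}"
      using that by auto
    then have "{l \<in> K. l \<le> i} \<subset> {l \<in> K. l \<le> j}" by blast
    then show ?thesis unfolding index_in_def by (rule psubset_card_mono[rotated]) (use assms in simp)
  qed
  have inj: "inj_on (index_in K) K"
    by (rule linorder_inj_onI) (use less in \<open>auto dest: less_imp_neq\<close>)
  have "index_in K ` K \<subseteq> {1..card K}"
  proof clarify
    fix i assume i: "i \<in> K"
    have "index_in K i \<le> card K" unfolding index_in_def by (rule card_mono[OF assms]) auto
    moreover have "0 < index_in K i" unfolding index_in_def card_gt_0_iff using i assms by auto
    ultimately show "index_in K i \<in> {1..card K}" by simp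
  qed
  moreover have "card (index_in K ` K) = card {1..card K}" using inj by (simp add: card_image)
  ultimately show ?thesis using inj by (simp add: bij_betw_def card_subset_eq)
qed

text \<open>Inverse of \<open>index_in K\<close>: representatives number the lines of a block by
  position, vector tuples by element.\<close>

definition kth :: "nat set \<Rightarrow> nat \<Rightarrow> nat" where
  "kth K = inv_into K (index_in K)"

lemma kth:
  assumes "finite K"
  shows kth_mem: "x \<in> {1..card K} \<Longrightarrow> kth K x \<in> K"
    and index_in_kth: "x \<in> {1..card K} \<Longrightarrow> index_in K (kth K x) = x"
    and kth_index_in: "i \<in> K \<Longrightarrow> kth K (index_in K i) = i"
    and index_in_mem: "i \<in> K \<Longrightarrow> index_in K i \<in> {1..card K}"
  using bij_index_in[OF assms] unfolding kth_def bij_betw_def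
  by (metis inv_into_into, metis f_inv_into_f, metis inv_into_f_f, metis imageI)

lemma inj_kth: "finite K \<Longrightarrow> inj_on (kth K) {1..card K}"
  by (metis index_in_kth inj_onI)

lemma kth_image: "finite K \<Longrightarrow> kth K ` {1..card K} = K"
proof
  assume K: "finite K"
  show "kth K ` {1..card K} \<subseteq> K" using kth_mem[OF K] by blast
  show "K \<subseteq> kth K ` {1..card K}"
  proof
    fix i assume "i \<in> K"
    then show "i \<in> kth K ` {1..card K}" using kth_index_in[OF K] index_in_mem[OF K] by (metis image_eqI)
  qed
qed

lemma indep_fam_reindex:
  assumes "inj_on g A" "finite A"
  shows "indep_fam A (\<lambda>x. v (g x)) \<longleftrightarrow> indep_fam (g ` A) v"
proof -
  have "inj_on (\<lambda>x. v (g x)) A \<longleftrightarrow> inj_on v (g ` A)"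
    using comp_inj_on_iff[OF assms(1), of v] by (simp add: o_def)
  then show ?thesis using assms(2) by (simp add: indep_fam_iff image_image)
qed

lemma indep_fam_scale:
  assumes "\<And>t. t \<in> T \<Longrightarrow> c t \<noteq> 0" "\<And>t. t \<in> T \<Longrightarrow> w t = fscale (c t) (v t)" "indep_fam T v"
  shows "indep_fam T w"
  unfolding indep_fam_def
proof (intro allI impI ballI)
  fix d t assume d: "(\<Sum>t\<in>T. fscale (d t) (w t)) = 0" and t: "t \<in> T"
  have "(\<Sum>t\<in>T. fscale (d t * c t) (v t)) = (\<Sum>t\<in>T. fscale (d t) (w t))"
    by (rule sum.cong) (simp_all add: assms(2))
  then have "d t * c t = 0" using indep_famD[OF assms(3), of "\<lambda>t. d t * c t" t] d t by simp
  then show "d t = 0" using assms(1)[OF t] by simp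
qed

text \<open>In a block of rank \<open>r\<close> this says that the first \<open>r + 1\<close>
  vectors form a circuit. Letting \<open>h\<close> range over all positions states at once that the
  first \<open>r\<close> are independent and that the last one has only nonzero coefficients in
  them.\<close>

definition generic_at :: "(nat \<Rightarrow> 'x \<Rightarrow> 'k::field) \<Rightarrow> nat set \<Rightarrow> nat \<Rightarrow> bool" where
  "generic_at v K r \<longleftrightarrow> (\<forall>h\<in>{1..r + 1}. indep_fam ({1..r + 1} - {h}) (\<lambda>x. v (kth K x)))"

definition generic :: "nat \<Rightarrow> ptuple \<Rightarrow> (nat \<Rightarrow> 'x \<Rightarrow> 'k::field) \<Rightarrow> bool" where
  "generic n p v \<longleftrightarrow> (\<forall>s\<in>summands n p. 2 \<le> rk s \<longrightarrow> generic_at v (blk s) (rk s))"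

lemma generic_at_spans:
  assumes g: "generic_at v K r" and K: "finite K" "r + 1 \<le> card K" and d: "fvs.dim (spn v K) \<le> r"
    and h: "h \<in> {1..r + 1}"
  shows "fvs.span ((\<lambda>x. v (kth K x)) ` ({1..r + 1} - {h})) = spn v K"
proof (rule indep_fam_spans)
  show "(\<lambda>x. v (kth K x)) ` ({1..r + 1} - {h}) \<subseteq> spn v K"
  proof (rule image_subsetI)
    fix x assume "x \<in> {1..r + 1} - {h}"
    then show "v (kth K x) \<in> spn v K" using K by (intro spn_mem kth_mem) auto
  qed
  show "fvs.dim (spn v K) \<le> card ({1..r + 1} - {h})" using h d by (simp del: fvs.dim_span)
qed (use g h K in \<open>auto simp: generic_at_def fin_dim_spn\<close>)

text \<open>With rank at most \<open>r\<close> the circuit spans the block, so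
  \<open>circuit_conn\<close> applies. Connectedness of the representatives and of perturbed tuples
  thus comes from genericity.\<close>

lemma generic_at_conn:
  assumes g: "generic_at v K r" and K: "finite K" "r + 1 \<le> card K" and d: "fvs.dim (spn v K) \<le> r"
    and nz: "\<And>i. i \<in> K \<Longrightarrow> v i \<noteq> 0"
  shows "conn v K"
proof -
  let ?T = "kth K ` {1..r + 1}"
  have sub: "{1..r + 1} \<subseteq> {1..card K}" using K by auto
  have inj: "inj_on (kth K) {1..r + 1}" using inj_on_subset[OF inj_kth[OF K(1)] sub] .
  have T: "?T - {kth K h} = kth K ` ({1..r + 1} - {h})" if "h \<in> {1..r + 1}" for h
    using inj_on_image_set_diff[OF inj, of "{1..r + 1}" "{h}"] that by simp
  show ?thesis
  proof (rule circuit_conn[OF K(1), of ?T])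
    show "?T \<subseteq> K" using image_mono[OF sub, of "kth K"] kth_image[OF K(1)] by simp
    fix i assume "i \<in> ?T"
    then obtain h where h: "h \<in> {1..r + 1}" "i = kth K h" by auto
    have "inj_on (kth K) ({1..r + 1} - {h})" by (rule inj_on_subset[OF inj]) auto
    then show "indep_fam (?T - {i}) v"
      using g h unfolding generic_at_def h(2) T[OF h(1)] by (simp add: indep_fam_reindex[symmetric])
    show "spn v (?T - {i}) = spn v K"
      unfolding h(2) T[OF h(1)] using generic_at_spans[OF g K d h(1)] by (simp add: image_image)
  qed (use nz in auto)
qed

text \<open>Asking for \<open>a \<in> Kpow r\<close> fixes the values outside \<open>{1..r}\<close>,
  so that the choice is unique as soon as the first \<open>r\<close> vectors are independent and
  span the block.\<close>

definition coef :: "(nat \<Rightarrow> 'x \<Rightarrow> 'k::field) \<Rightarrow> nat set \<Rightarrow> nat \<Rightarrow> nat \<Rightarrow> nat \<Rightarrow> 'k" where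
  "coef v K r i = (SOME a. a \<in> Kpow r \<and> (\<Sum>x\<in>{1..r}. fscale (a x) (v (kth K x))) = v i)"

text \<open>The coordinates of \<open>v i\<close> in the basis formed by those multiples of the first \<open>r\<close> vectors of the
  block \<open>K\<close> whose sum is the vector number \<open>r + 1\<close>.\<close>

definition ncoord :: "(nat \<Rightarrow> 'x \<Rightarrow> 'k::field) \<Rightarrow> nat set \<Rightarrow> nat \<Rightarrow> nat \<Rightarrow> nat \<Rightarrow> 'k" where
  "ncoord v K r i = (\<lambda>x. coef v K r i x / coef v K r (kth K (r + 1)) x)"

context
  fixes v :: "nat \<Rightarrow> nat \<Rightarrow> 'k::field" and K r
  assumes g: "generic_at v K r" and K: "finite K" "r + 1 \<le> card K" and d: "fvs.dim (spn v K) = r"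
begin

lemma generic_at_indep: "indep_fam {1..r} (\<lambda>x. v (kth K x))"
proof -
  have "{1..r + 1} - {r + 1} = {1..r}" by auto
  then show ?thesis using g unfolding generic_at_def by (metis atLeastAtMost_iff le_add2 order_refl)
qed

lemma coef:
  assumes "i \<in> K"
  shows "coef v K r i \<in> Kpow r" "(\<Sum>x\<in>{1..r}. fscale (coef v K r i x) (v (kth K x))) = v i"
proof -
  have "{1..r + 1} - {r + 1} = {1..r}" by auto
  then have "fvs.span ((\<lambda>x. v (kth K x)) ` {1..r}) = spn v K"
    using generic_at_spans[OF g K, of "r + 1"] d by simp
  then have "v i \<in> block_sum r (\<lambda>x. v (kth K x)) ` Kpow r"
    unfolding block_sum_Kpow using spn_mem[OF assms, of v] by simp
  then obtain a where "a \<in> Kpow r" "(\<Sum>x\<in>{1..r}. fscale (a x) (v (kth K x))) = v i"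
    unfolding block_sum_def by auto
  then have "\<exists>a. a \<in> Kpow r \<and> (\<Sum>x\<in>{1..r}. fscale (a x) (v (kth K x))) = v i" by (intro exI conjI)
  from someI_ex[OF this, folded coef_def]
  show "coef v K r i \<in> Kpow r" "(\<Sum>x\<in>{1..r}. fscale (coef v K r i x) (v (kth K x))) = v i" by simp_all
qed

lemma coef_eqI:
  assumes "i \<in> K" "(\<Sum>x\<in>{1..r}. fscale (a x) (v (kth K x))) = v i" "x \<in> {1..r}"
  shows "coef v K r i x = a x"
proof (rule indep_fam_coeffs_eq[OF generic_at_indep _ assms(3)])
  show "(\<Sum>x\<in>{1..r}. fscale (coef v K r i x) (v (kth K x))) = (\<Sum>x\<in>{1..r}. fscale (a x) (v (kth K x)))"
    using coef(2)[OF assms(1)] assms(2) by simp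
qed

lemma kth_last: "kth K (r + 1) \<in> K"
  by (rule kth_mem[OF K(1)]) (use K in auto)

lemma coef_last_nonzero:
  assumes "x \<in> {1..r}" shows "coef v K r (kth K (r + 1)) x \<noteq> 0"
proof -
  have e: "{1..r + 1} - {r + 1} = {1..r}" by auto
  have "v (kth K (r + 1)) = (\<Sum>x\<in>{1..r}. fscale (coef v K r (kth K (r + 1)) x) (v (kth K x)))"
    using coef(2)[OF kth_last] by simp
  then show ?thesis
    using circuit_coeffs[of "{1..r + 1}" "r + 1" "\<lambda>x. v (kth K x)" "coef v K r (kth K (r + 1))" x] g assms
    unfolding e generic_at_def by simp
qed

text \<open>The basis belonging to the projective frame of the block: the first \<open>r\<close>
  lines give its directions, and line \<open>r + 1\<close>, the unit point, fixes the relative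
  scaling of its vectors.\<close>

definition frame :: "nat \<Rightarrow> nat \<Rightarrow> 'k" where
  "frame x = fscale (coef v K r (kth K (r + 1)) x) (v (kth K x))"

lemma frame_sum: "(\<Sum>x\<in>{1..r}. frame x) = v (kth K (r + 1))"
  unfolding frame_def by (rule coef(2)[OF kth_last])

lemma frame_span: "x \<in> {1..r} \<Longrightarrow> fvs.span {frame x} = fvs.span {v (kth K x)}"
proof (cases "v (kth K x) = 0")
  case True then show ?thesis by (simp add: frame_def)
next
  case False
  assume x: "x \<in> {1..r}"
  show ?thesis
    using span_singleton_eq_iff[OF False, of "frame x"] coef_last_nonzero[OF x] unfolding frame_def by auto
qed

lemma frame_indep: "indep_fam {1..r} frame"
  by (rule indep_fam_scale[where c = "coef v K r (kth K (r + 1))", OF coef_last_nonzero _ generic_at_indep])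
     (simp_all add: frame_def)

lemma frame_spans: "fvs.span (frame ` {1..r}) = spn v K"
proof (rule indep_fam_spans[OF fin_dim_spn[OF K(1)] frame_indep])
  show "frame ` {1..r} \<subseteq> spn v K"
  proof clarify
    fix x assume "x \<in> {1..r}"
    then show "frame x \<in> spn v K" unfolding frame_def using K by (intro fvs.span_scale spn_mem kth_mem) auto
  qed
qed (use d in simp_all)

lemma ncoord:
  assumes "i \<in> K"
  shows "ncoord v K r i \<in> Kpow r" "block_sum r frame (ncoord v K r i) = v i" "v i \<noteq> 0 \<Longrightarrow> ncoord v K r i \<noteq> 0"
proof -
  show "ncoord v K r i \<in> Kpow r" using coef(1)[OF assms] by (auto simp: Kpow_def ncoord_def)
  have "block_sum r frame (ncoord v K r i) = (\<Sum>x\<in>{1..r}. fscale (coef v K r i x) (v (kth K x)))"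
    unfolding block_sum_def frame_def ncoord_def
    by (rule sum.cong) (use coef_last_nonzero in auto)
  then show e: "block_sum r frame (ncoord v K r i) = v i" using coef(2)[OF assms] by simp
  show "ncoord v K r i \<noteq> 0" if "v i \<noteq> 0"
    using that e lin_on_0[OF lin_on_block_sum[of r frame UNIV]] by auto
qed

end

subsection \<open>The representatives\<close>

text \<open>Unit vectors and unit point as one family, so that \<open>Drep\<close> and
  \<open>Erep\<close> are treated alike at the first \<open>r + 1\<close> positions.\<close>

definition stdframe :: "nat \<Rightarrow> nat \<Rightarrow> nat \<Rightarrow> 'k::field" where
  "stdframe r x = (if x \<le> r then unit_vec x else \<Sum>h=1..r. unit_vec h)"

lemma stdframe_apply: "j \<in> {1..r} \<Longrightarrow> stdframe r x j = (if x \<le> r \<and> x \<noteq> j then 0 else 1)"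
  by (auto simp: stdframe_def sum_fun_apply unit_vec_def)

lemma stdframe_Kpow: "x \<in> {1..r + 1} \<Longrightarrow> stdframe r x \<in> Kpow r"
  by (auto simp: stdframe_def unit_vec_in_Kpow intro!: fvs.subspace_sum)

text \<open>Coordinate \<open>j\<close> of a relation reads \<open>c j + c (r + 1) = 0\<close>, up
  to the term of the removed index. If \<open>h \<le> r\<close>, coordinate \<open>h\<close> gives
  \<open>c (r + 1) = 0\<close>, and then the other coordinates give the rest.\<close>

lemma stdframe_generic:
  assumes h: "h \<in> {1..r + 1}"
  shows "indep_fam ({1..r + 1} - {h}) (stdframe r :: nat \<Rightarrow> nat \<Rightarrow> 'k::field)"
  unfolding indep_fam_def
proof (intro allI impI ballI)
  fix c and t assume c: "(\<Sum>t\<in>{1..r + 1} - {h}. fscale (c t) (stdframe r t :: nat \<Rightarrow> 'k)) = 0" and t: "t \<in> {1..r + 1} - {h}"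
  have val: "(if j \<noteq> h then c j else 0) + (if h \<noteq> r + 1 then c (r + 1) else 0) = 0" if j: "j \<in> {1..r}" for j
  proof -
    have "0 = (\<Sum>t\<in>{1..r + 1} - {h}. fscale (c t) (stdframe r t :: nat \<Rightarrow> 'k)) j" using c by (simp add: zero_fun_apply)
    also have "\<dots> = (\<Sum>t\<in>{1..r + 1} - {h}. c t * (if t \<le> r \<and> t \<noteq> j then 0 else 1))"
      by (simp add: sum_fun_apply fscale_apply stdframe_apply[OF j])
    also have "\<dots> = (\<Sum>t\<in>({1..r + 1} - {h}) \<inter> {j, r + 1}. c t)"
      by (rule sum.mono_neutral_cong_right) (use j in auto)
    also have "\<dots> = (if j \<noteq> h then c j else 0) + (if h \<noteq> r + 1 then c (r + 1) else 0)"
    proof -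
      have "({1..r + 1} - {h}) \<inter> {j, r + 1} = (if j \<noteq> h then {j} else {}) \<union> (if h \<noteq> r + 1 then {r + 1} else {})"
        using j h by auto
      then show ?thesis using j by auto
    qed
    finally show ?thesis by simp
  qed
  have last: "h \<noteq> r + 1 \<Longrightarrow> c (r + 1) = 0" using val[of h] h by auto
  show "c t = 0"
  proof (cases "t = r + 1")
    case True then show ?thesis using last t by auto
  next
    case False then show ?thesis using val[of t] last t by (auto split: if_splits)
  qed
qed

text \<open>The algebraic content of membership in \<open>Params\<close>, without topology or
  extensionality, so that it makes sense over any field.\<close>

definition valid_param :: "ptuple \<Rightarrow> (nat set \<times> nat \<Rightarrow> nat \<Rightarrow> (nat \<Rightarrow> 'k::field) set) \<Rightarrow> bool" where
  "valid_param p q \<longleftrightarrow> (\<forall>(K, r)\<in>snd (snd p). \<forall>h\<in>{r + 2..card K}. \<exists>y\<in>Kpow r. y \<noteq> 0 \<and> q (K, r) h = fvs.span {y})"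

lemma Kpow_1: "(Kpow 1 :: (nat \<Rightarrow> 'k::field) set) = fvs.span {unit_vec 1}"
  by (simp only: Kpow_eq_span) simp

lemma unit_vec_nonzero: "(unit_vec h :: nat \<Rightarrow> 'k::field) \<noteq> 0"
  by (auto simp: unit_vec_def fun_eq_iff zero_fun_apply)

lemma stdframe_nonzero: "1 \<le> r \<Longrightarrow> 1 \<le> x \<Longrightarrow> (stdframe r x :: nat \<Rightarrow> 'k::field) \<noteq> 0"
proof
  assume r: "1 \<le> r" "1 \<le> x" "(stdframe r x :: nat \<Rightarrow> 'k) = 0"
  define j where "j = (if x \<le> r then x else 1)"
  have "j \<in> {1..r}" "x \<le> r \<longrightarrow> x = j" using r by (auto simp: j_def)
  then have "(stdframe r x :: nat \<Rightarrow> 'k) j = 1" using stdframe_apply[of j r x] by auto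
  then show False using r(3) by (simp add: zero_fun_apply)
qed

lemma rep_whole: "whole (rep q s) = Kpow (rk s)"
  by (auto simp: rep_def rk_def Frep_def Drep_def Erep_def Let_def split: sum.split)

lemma rep_part_zero: "i \<notin> blk s \<Longrightarrow> part (rep q s) i = {0}"
  by (auto simp: rep_def blk_def Frep_def Drep_def Erep_def Let_def split: sum.splits)

lemma rep_part_rank1:
  assumes "p \<in> Pset n m" "s \<in> summands n p" "i \<in> blk s" "rk s = 1"
  shows "part (rep q s) i = Kpow 1"
proof -
  obtain Is Js Ks where p: "p = (Is, Js, Ks)" by (metis prod_cases3)
  have "\<forall>J\<in>Js. 3 \<le> card J" "\<forall>(K, r)\<in>Ks. 4 \<le> r + 2 \<and> r + 2 \<le> card K"
    using assms(1) by (auto simp: Pset_def p)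
  then show ?thesis using assms(2-4) by (fastforce simp: summands_def blk_def rk_def p rep_def Frep_def)
qed

lemma rep_part_frame:
  assumes "p \<in> Pset n m" "s \<in> summands n p" "i \<in> blk s" "2 \<le> rk s" "index_in (blk s) i \<le> rk s + 1"
  shows "part (rep q s) i = fvs.span {stdframe (rk s) (index_in (blk s) i)}"
proof -
  obtain a where a: "s = Inr (Inr a)" using assms(3,4) by (cases s rule: sum.exhaust; auto simp: rk_def split: sum.splits)
  show ?thesis
    using assms(3-5) by (cases a) (auto simp: a rep_def blk_def rk_def Drep_def Erep_def Let_def stdframe_def)
qed

lemma rep_part_param:
  assumes "r + 1 < index_in K i" "i \<in> K"
  shows "part (rep q (Inr (Inr (Inr (K, r))))) i = q (K, r) (index_in K i)"
  using assms by (simp add: rep_def Erep_def)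

text \<open>More than \<open>rk s + 1\<close> lines exclude the second family, whose blocks have
  exactly that many.\<close>

lemma summand_param:
  assumes "p \<in> Pset n m" "s \<in> summands n p" "2 \<le> rk s" "rk s + 1 < card (blk s)"
  obtains K r where "s = Inr (Inr (Inr (K, r)))" "(K, r) \<in> snd (snd p)" "K = blk s" "r = rk s"
proof -
  have "\<exists>a. s = Inr (Inr (Inr a))" using assms(3,4)
    by (cases s rule: sum.exhaust; auto simp: rk_def blk_def split: sum.splits)
  then obtain K r where s: "s = Inr (Inr (Inr (K, r)))" by auto
  show ?thesis
  proof (rule that[OF s])
    show "(K, r) \<in> snd (snd p)" using assms(2) unfolding s by simp
  qed (simp_all add: s blk_def rk_def)
qed

lemma rep_part_vec:
  fixes q :: "nat set \<times> nat \<Rightarrow> nat \<Rightarrow> (nat \<Rightarrow> 'k::field) set"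
  assumes p: "p \<in> Pset n m" and q: "valid_param p q" and s: "s \<in> summands n p" and i: "i \<in> blk s"
  shows "\<exists>y. y \<in> Kpow (rk s) \<and> y \<noteq> 0 \<and> part (rep q s) i = fvs.span {y}
    \<and> (2 \<le> rk s \<longrightarrow> index_in (blk s) i \<le> rk s + 1 \<longrightarrow> y = stdframe (rk s) (index_in (blk s) i))"
proof (cases "rk s = 1")
  case True
  have "part (rep q s) i = fvs.span {unit_vec 1}" using rep_part_rank1[OF p s i True] Kpow_1 by metis
  then show ?thesis using True unit_vec_in_Kpow[of 1 1] unit_vec_nonzero[of 1] by (intro exI[of _ "unit_vec 1"]) simp
next
  case False
  have r: "2 \<le> rk s" "rk s + 1 \<le> card (blk s)" using rk_cases[OF p s False] by simp_all
  have fin: "finite (blk s)" by (rule finite_subset[OF blk_subset[OF p s]]) simp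
  have ii: "index_in (blk s) i \<in> {1..card (blk s)}" by (rule index_in_mem[OF fin i])
  show ?thesis
  proof (cases "index_in (blk s) i \<le> rk s + 1")
    case True
    have "(stdframe (rk s) (index_in (blk s) i) :: nat \<Rightarrow> 'k) \<in> Kpow (rk s)"
      by (rule stdframe_Kpow) (use True ii in simp)
    moreover have "(stdframe (rk s) (index_in (blk s) i) :: nat \<Rightarrow> 'k) \<noteq> 0"
      by (rule stdframe_nonzero) (use ii r in simp_all)
    ultimately show ?thesis
      using rep_part_frame[OF p s i r(1) True, of q]
      by (intro exI[of _ "stdframe (rk s) (index_in (blk s) i)"]) simp
  next
    case big: False
    then have "rk s + 1 < card (blk s)" using ii by simp
    then obtain K r where K: "s = Inr (Inr (Inr (K, r)))" "(K, r) \<in> snd (snd p)" "K = blk s" "r = rk s"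
      by (rule summand_param[OF p s r(1)])
    have h: "index_in K i \<in> {r + 2..card K}" using big ii K(3,4) by auto
    have "\<forall>h\<in>{r + 2..card K}. \<exists>y\<in>Kpow r. y \<noteq> 0 \<and> q (K, r) h = fvs.span {y}"
      using q K(2) unfolding valid_param_def by auto
    from bspec[OF this h] obtain y where y: "y \<in> Kpow r" "y \<noteq> 0" "q (K, r) (index_in K i) = fvs.span {y}" by auto
    have "part (rep q s) i = fvs.span {y}"
      unfolding K(1) using rep_part_param[of r K i q] h y(3) i K(3) by simp
    then show ?thesis using y(1,2) big K(4) by (intro exI[of _ y]) simp
  qed
qed

text \<open>At the first \<open>rk s + 1\<close> positions the generators are the standard frame
  itself and not just proportional to it; the comparison of scalars in
  \<open>normal_form_unique\<close> relies on this.\<close>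

lemma rep_vectors:
  fixes q :: "nat set \<times> nat \<Rightarrow> nat \<Rightarrow> (nat \<Rightarrow> 'k::field) set"
  assumes p: "p \<in> Pset n m" and q: "valid_param p q" and s: "s \<in> summands n p"
  obtains y where "\<forall>i\<in>blk s. y i \<in> Kpow (rk s) \<and> y i \<noteq> 0 \<and> part (rep q s) i = fvs.span {y i}"
    "2 \<le> rk s \<longrightarrow> generic_at y (blk s) (rk s)
      \<and> (\<forall>x\<in>{1..rk s + 1}. y (kth (blk s) x) = stdframe (rk s) x)"
proof -
  have "\<forall>i\<in>blk s. \<exists>y. y \<in> Kpow (rk s) \<and> y \<noteq> 0 \<and> part (rep q s) i = fvs.span {y}
    \<and> (2 \<le> rk s \<longrightarrow> index_in (blk s) i \<le> rk s + 1 \<longrightarrow> y = stdframe (rk s) (index_in (blk s) i))"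
    using rep_part_vec[OF p q s] by (rule ballI)
  from bchoice[OF this] obtain y where y: "\<forall>i\<in>blk s. y i \<in> Kpow (rk s) \<and> y i \<noteq> 0 \<and> part (rep q s) i = fvs.span {y i}
    \<and> (2 \<le> rk s \<longrightarrow> index_in (blk s) i \<le> rk s + 1 \<longrightarrow> y i = stdframe (rk s) (index_in (blk s) i))" by (elim exE)
  have fin: "finite (blk s)" by (rule finite_subset[OF blk_subset[OF p s]]) simp
  have std: "y (kth (blk s) x) = stdframe (rk s) x" if r: "2 \<le> rk s" and x: "x \<in> {1..rk s + 1}" for x
  proof -
    have "x \<in> {1..card (blk s)}" using x rk_cases[OF p s] r by fastforce
    then show ?thesis using bspec[OF y kth_mem[OF fin]] index_in_kth[OF fin] x r by simp
  qed
  have "generic_at y (blk s) (rk s)" if r: "2 \<le> rk s"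
    unfolding generic_at_def
  proof
    fix h assume h: "h \<in> {1..rk s + 1}"
    have "\<And>x. x \<in> {1..rk s + 1} - {h} \<Longrightarrow> y (kth (blk s) x) = stdframe (rk s) x" using std[OF r] by simp
    then have "indep_fam ({1..rk s + 1} - {h}) (\<lambda>x. y (kth (blk s) x))
        \<longleftrightarrow> indep_fam ({1..rk s + 1} - {h}) (stdframe (rk s) :: nat \<Rightarrow> nat \<Rightarrow> 'k)"
      by (rule indep_fam_cong)
    then show "indep_fam ({1..rk s + 1} - {h}) (\<lambda>x. y (kth (blk s) x))"
      using stdframe_generic[OF h] by blast
  qed
  then show ?thesis using that[of y] y std by simp
qed

text \<open>Rank 1 is settled by dimension. Otherwise the standard frame makes the block generic,
  hence connected, for every value of the parameter.\<close>

lemma rep_props: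
  fixes q :: "nat set \<times> nat \<Rightarrow> nat \<Rightarrow> (nat \<Rightarrow> 'k::field) set"
  assumes p: "p \<in> Pset n m" and q: "valid_param p q" and s: "s \<in> summands n p"
  shows "indecomposable m (rep q s)" "has_dim m (rep q s) (dvec (blk s) (rk s))"
proof -
  obtain y where y0: "\<forall>i\<in>blk s. y i \<in> Kpow (rk s) \<and> y i \<noteq> 0 \<and> part (rep q s) i = fvs.span {y i}"
    "2 \<le> rk s \<longrightarrow> generic_at y (blk s) (rk s) \<and> (\<forall>x\<in>{1..rk s + 1}. y (kth (blk s) x) = stdframe (rk s) x)"
    by (rule rep_vectors[OF p q s])
  have y: "\<And>i. i \<in> blk s \<Longrightarrow> y i \<in> Kpow (rk s)" "\<And>i. i \<in> blk s \<Longrightarrow> y i \<noteq> 0"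
    "\<And>i. i \<in> blk s \<Longrightarrow> part (rep q s) i = fvs.span {y i}" "2 \<le> rk s \<Longrightarrow> generic_at y (blk s) (rk s)"
    using y0 by simp_all
  have fin: "finite (blk s)" by (rule finite_subset[OF blk_subset[OF p s]]) simp
  have parts: "fvs.subspace (part (rep q s) i) \<and> part (rep q s) i \<subseteq> Kpow (rk s)" for i
  proof (cases "i \<in> blk s")
    case True
    then show ?thesis using y(1)[OF True] y(3)[OF True] by (simp add: fvs.span_minimal)
  next
    case False
    moreover have "(0 :: nat \<Rightarrow> 'k) \<in> Kpow (rk s)" by (rule fvs.subspace_0[OF subspace_Kpow])
    ultimately show ?thesis using rep_part_zero[OF False, of q] by simp
  qed
  then have mf: "is_mflag m (rep q s)" by (simp add: is_mflag_alt rep_whole)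
  have "fvs.dim ({0} :: (nat \<Rightarrow> 'k) set) = 0" using fin_dim_dim_0[OF fin_dim_span[of "{}"]] by simp
  moreover have "fvs.dim (part (rep q s) i) = 1" if "i \<in> blk s" for i
    using y(3)[OF that] dim_line[OF y(2)[OF that]] by simp
  ultimately show "has_dim m (rep q s) (dvec (blk s) (rk s))"
    using mf rep_part_zero[of _ s q] by (simp add: has_dim_def dvec_def rep_whole)
  show "indecomposable m (rep q s)"
  proof (cases "rk s = 1")
    case True
    then show ?thesis by (intro dim_1_indecomposable[OF mf]) (simp add: rep_whole)
  next
    case False
    then have r: "2 \<le> rk s" "rk s + 1 \<le> card (blk s)" using rk_cases[OF p s] by simp_all
    have yK: "spn y (blk s) \<subseteq> Kpow (rk s)" by (rule spn_subset[OF subspace_Kpow]) (use y(1) in auto)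
    have d: "fvs.dim (spn y (blk s)) \<le> rk s"
    proof -
      obtain B where B: "indep_fam {1..fvs.dim (spn y (blk s))} B" "spn B {1..fvs.dim (spn y (blk s))} = spn y (blk s)"
        by (rule fin_dim_basis_fam[OF fin_dim_spn[OF fin]])
      have "B ` {1..fvs.dim (spn y (blk s))} \<subseteq> Kpow (rk s)"
        using yK fvs.span_superset[of "B ` {1..fvs.dim (spn y (blk s))}"] B(2) by simp
      from indep_fam_card_le[OF fin_dim_Kpow B(1) _ this] show ?thesis by simp
    qed
    have c: "conn y (blk s)" by (rule generic_at_conn[OF y(4)[OF r(1)] fin r(2) d y(2)])
    have e: "{1..rk s + 1} - {rk s + 1} = {1..rk s}" by auto
    have ind: "indep_fam {1..rk s} (\<lambda>x. y (kth (blk s) x))"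
      using y(4)[OF r(1)] unfolding generic_at_def using e by (metis atLeastAtMost_iff le_add2 order_refl)
    have sub: "(\<lambda>x. y (kth (blk s) x)) ` {1..rk s} \<subseteq> y ` blk s"
    proof clarify
      fix x assume "x \<in> {1..rk s}"
      then show "y (kth (blk s) x) \<in> y ` blk s" using r(2) by (intro imageI kth_mem[OF fin]) simp
    qed
    have "fvs.span ((\<lambda>x. y (kth (blk s) x)) ` {1..rk s}) = Kpow (rk s)"
      by (rule indep_fam_spans[OF fin_dim_Kpow ind]) (use sub y(1) in auto)
    then have "Kpow (rk s) \<subseteq> spn y (blk s)" using fvs.span_mono[OF sub] by simp
    then have "spn y (blk s) = whole (rep q s)" using yK by (simp add: rep_whole)
    then show ?thesis using c y(3) by (intro conn_indecomposable[OF mf blk_subset[OF p s]]) simp_all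
  qed
qed

subsection \<open>Normal forms\<close>

text \<open>Both restrictions make the value extensional, as points of the nested product topology
  have to be.\<close>

definition qparam :: "ptuple \<Rightarrow> (nat \<Rightarrow> nat \<Rightarrow> 'k::field) \<Rightarrow> nat set \<times> nat \<Rightarrow> nat \<Rightarrow> (nat \<Rightarrow> 'k) set" where
  "qparam p v = (\<lambda>(K, r)\<in>snd (snd p). \<lambda>h\<in>{r + 2..card K}. fvs.span {ncoord v K r (kth K h)})"

lemma block_sum_cong: "(\<And>x. x \<in> {1..r} \<Longrightarrow> u x = w x) \<Longrightarrow> block_sum r u y = block_sum r w y"
  unfolding block_sum_def by (rule sum.cong) simp_all

lemma block_sum_unit_vec: "x \<in> {1..r} \<Longrightarrow> block_sum r u (unit_vec x) = u x"
proof -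
  assume x: "x \<in> {1..r}"
  have "block_sum r u (unit_vec x) = (\<Sum>t\<in>{1..r}. if t = x then u x else 0)"
    unfolding block_sum_def by (rule sum.cong) (auto simp: unit_vec_def)
  then show ?thesis using x by simp
qed

lemma block_sum_stdframe:
  assumes "x \<in> {1..r + 1}"
  shows "block_sum r u (stdframe r x) = (if x \<le> r then u x else \<Sum>h\<in>{1..r}. u h)"
proof (cases "x \<le> r")
  case True
  then show ?thesis using assms block_sum_unit_vec[of x r u] by (simp add: stdframe_def)
next
  case False
  have "block_sum r u (stdframe r x) = (\<Sum>h\<in>{1..r}. u h)"
    unfolding block_sum_def by (rule sum.cong) (use False in \<open>simp_all add: stdframe_apply\<close>)
  then show ?thesis using False by simp
qed

lemma param_summand:
  assumes p: "p \<in> Pset n m" and K: "(K, r) \<in> snd (snd p)"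
  shows "Inr (Inr (Inr (K, r))) \<in> summands n p" "finite K" "K \<subseteq> {1..m}" "K \<noteq> {}" "2 \<le> r" "r + 2 \<le> card K"
proof -
  show s: "Inr (Inr (Inr (K, r))) \<in> summands n p" using K by simp
  show sub: "K \<subseteq> {1..m}" using blk_subset[OF p s] by (simp add: blk_def)
  show "finite K" by (rule finite_subset[OF sub]) simp
  obtain Is Js Ks where p': "p = (Is, Js, Ks)" by (metis prod_cases3)
  show r: "2 \<le> r" "r + 2 \<le> card K" using p K unfolding p' Pset_def by auto
  then show "K \<noteq> {}" by auto
qed

lemma generic_param:
  assumes p: "p \<in> Pset n m" and K: "(K, r) \<in> snd (snd p)"
  shows "generic n p v \<Longrightarrow> generic_at v K r"
    and "btype n m p v \<Longrightarrow> fvs.dim (spn v K) = r"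
proof -
  note ps = param_summand[OF p K]
  show "generic_at v K r" if "generic n p v"
    using bspec[OF that[unfolded generic_def] ps(1)] ps(5) by (simp add: blk_def rk_def)
  show "fvs.dim (spn v K) = r" if "btype n m p v"
    using bspec[OF that[unfolded btype_def] ps(1)] ps(4) by (simp add: blk_def rk_def)
qed

lemma valid_qparam:
  fixes v :: "nat \<Rightarrow> nat \<Rightarrow> 'k::field"
  assumes p: "p \<in> Pset n m" and v: "vecs n m v" and bt: "btype n m p v" and g: "generic n p v"
  shows "valid_param p (qparam p v)"
  unfolding valid_param_def
proof clarify
  fix K r h assume K: "(K, r) \<in> snd (snd p)" and h: "h \<in> {r + 2..card K}"
  note ps = param_summand[OF p K]
  have mem: "kth K h \<in> K" by (rule kth_mem[OF ps(2)]) (use h in auto)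
  have "r + 1 \<le> card K" using ps(6) by simp
  note n = ncoord[OF generic_param(1)[OF p K g] ps(2) this generic_param(2)[OF p K bt] mem]
  have "v (kth K h) \<noteq> 0" using vecsD(2)[OF v] mem ps(3) by auto
  then show "\<exists>y\<in>Kpow r. y \<noteq> 0 \<and> qparam p v (K, r) h = fvs.span {y}"
    using n(1,3) K h by (intro bexI[of _ "ncoord v K r (kth K h)"]) (simp_all add: qparam_def)
qed

lemma rank1_block_line:
  assumes "finite K" "fvs.dim (spn v K) = 1" "i \<in> K" "v i \<noteq> 0"
  shows "spn v K = fvs.span {v i}"
proof -
  have "fvs.span (v ` {i}) = spn v K"
    by (rule indep_fam_spans[OF fin_dim_spn[OF assms(1)] indep_fam_single[of v, OF assms(4)]])
       (use assms spn_mem[OF assms(3), of v] in simp_all)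
  then show ?thesis by simp
qed

text \<open>With the frame of each block as adapted basis, unit vectors go to the first lines, the
  unit point to line \<open>r + 1\<close>, and the coordinate vectors \<open>ncoord\<close> to the
  remaining lines.\<close>

lemma normal_form:
  fixes v :: "nat \<Rightarrow> nat \<Rightarrow> 'k::field"
  assumes p: "p \<in> Pset n m" and v: "vecs n m v" and bt: "btype n m p v" and g: "generic n p v"
  shows "\<exists>f. lin_iso f (whole (Fpq n p (qparam p v))) (Kpow n)
    \<and> (\<forall>i\<in>{1..m}. f ` part (Fpq n p (qparam p v)) i = fvs.span {v i})"
proof -
  let ?S = "summands n p"
  \<comment> \<open>A block of rank 1 may consist of a single vector, where no circuit and so no
    frame is available; its first vector is a basis anyway.\<close>
  define u0 where "u0 s = (if rk s = 1 then (\<lambda>x. v (kth (blk s) 1)) else frame v (blk s) (rk s))" for s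
  have finK: "finite (blk s)" if "s \<in> ?S" for s by (rule finite_subset[OF blk_subset[OF p that]]) simp
  have v0: "v i \<noteq> 0" if "s \<in> ?S" "i \<in> blk s" for s i
    using vecsD(2)[OF v] blk_subset[OF p that(1)] that(2) by auto
  have dim: "fvs.dim (spn v (blk s)) = rk s" if "s \<in> ?S" "blk s \<noteq> {}" for s
    using bt that unfolding btype_def by simp
  have big: "generic_at v (blk s) (rk s)" "rk s + 1 \<le> card (blk s)" "2 \<le> rk s" if s: "s \<in> ?S" "rk s \<noteq> 1" for s
  proof -
    show "2 \<le> rk s" "rk s + 1 \<le> card (blk s)" using rk_cases[OF p s] by simp_all
    then show "generic_at v (blk s) (rk s)" using g s(1) unfolding generic_def by simp
  qed
  have first: "kth (blk s) 1 \<in> blk s" if s: "s \<in> ?S" "blk s \<noteq> {}" for s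
    by (rule kth_mem[OF finK[OF s(1)]]) (use s finK[OF s(1)] in \<open>simp add: Suc_le_eq card_gt_0_iff\<close>)
  have u0: "indep_fam {1..rk s} (u0 s) \<and> fvs.span (u0 s ` {1..rk s}) = spn v (blk s)"
    if s: "s \<in> ?S" "blk s \<noteq> {}" for s
  proof (cases "rk s = 1")
    case True
    have "indep_fam {1} (u0 s)"
      by (rule indep_fam_single) (use v0[OF s(1) first[OF s]] in \<open>simp add: u0_def True\<close>)
    moreover have "fvs.span {v (kth (blk s) 1)} = spn v (blk s)"
      using rank1_block_line[of "blk s" v "kth (blk s) 1"] finK[OF s(1)] first[OF s] v0[OF s(1) first[OF s]] dim[OF s] True
      by simp
    ultimately show ?thesis by (simp add: True u0_def)
  next
    case False
    note b = big[OF s(1) False]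
    show ?thesis
      using frame_indep[OF b(1) finK[OF s(1)] b(2) dim[OF s]] frame_spans[OF b(1) finK[OF s(1)] b(2) dim[OF s]] False
      by (simp add: u0_def)
  qed
  have "\<exists>u. (\<forall>s\<in>?S. blk s \<noteq> {} \<longrightarrow> (\<forall>x\<in>{1..rk s}. u s x = u0 s x))
    \<and> lin_iso (assemble n p u) (bsum ?S (\<lambda>s. Kpow (rk s))) (Kpow n)"
    by (rule adapted_basis[OF p v bt]) (rule conjunct1[OF u0] conjunct2[OF u0]; assumption)+
  then obtain u where u: "\<forall>s\<in>?S. blk s \<noteq> {} \<longrightarrow> (\<forall>x\<in>{1..rk s}. u s x = u0 s x)"
    and iso: "lin_iso (assemble n p u) (bsum ?S (\<lambda>s. Kpow (rk s))) (Kpow n)"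
    by (elim exE conjE)
  have eq: "block_sum (rk s) (u s) y = block_sum (rk s) (u0 s) y" if "s \<in> ?S" "i \<in> blk s" for s i y
    by (rule block_sum_cong) (use u that in auto)
  have parts: "block_sum (rk s) (u s) ` part (rep (qparam p v) s) i = fvs.span {v i}"
    if s: "s \<in> ?S" and i: "i \<in> blk s" for s i
  proof -
    have ne: "blk s \<noteq> {}" using i by auto
    have line: "block_sum (rk s) (u0 s) ` fvs.span {y} = fvs.span {block_sum (rk s) (u0 s) y}" for y
      by (rule lin_on_span_singleton[OF lin_on_block_sum fvs.subspace_UNIV]) simp
    have "block_sum (rk s) (u0 s) ` part (rep (qparam p v) s) i = fvs.span {v i}"
    proof (cases "rk s = 1")
      case True
      have "block_sum (rk s) (u0 s) ` Kpow 1 = spn v (blk s)"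
        using block_sum_Kpow[of "rk s" "u0 s"] u0[OF s ne] True by simp
      then show ?thesis
        using rep_part_rank1[OF p s i True, of "qparam p v"] rank1_block_line[of "blk s" v i] finK[OF s] i v0[OF s i] dim[OF s ne] True
        by simp
    next
      case False
      note b = big[OF s False]
      have u0f: "u0 s = frame v (blk s) (rk s)" using False by (simp add: u0_def)
      let ?x = "index_in (blk s) i"
      have x: "?x \<in> {1..card (blk s)}" by (rule index_in_mem[OF finK[OF s] i])
      have ki: "kth (blk s) ?x = i" by (rule kth_index_in[OF finK[OF s] i])
      show ?thesis
      proof (cases "?x \<le> rk s + 1")
        case True
        have "block_sum (rk s) (u0 s) ` part (rep (qparam p v) s) i
            = fvs.span {block_sum (rk s) (u0 s) (stdframe (rk s) ?x)}"
          using rep_part_frame[OF p s i b(3) True, of "qparam p v"] line by simp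
        also have "\<dots> = fvs.span {v i}"
        proof (cases "?x \<le> rk s")
          case True
          then show ?thesis
            using block_sum_stdframe[of ?x "rk s" "u0 s"] x ki
              frame_span[OF b(1) finK[OF s] b(2) dim[OF s ne], of ?x] by (simp add: u0f)
        next
          case False
          then have "?x = rk s + 1" using \<open>?x \<le> rk s + 1\<close> by simp
          then show ?thesis
            using block_sum_stdframe[of ?x "rk s" "u0 s"] frame_sum[OF b(1) finK[OF s] b(2) dim[OF s ne]] ki
            by (simp add: u0f)
        qed
        finally show ?thesis .
      next
        case big': False
        then have "rk s + 1 < card (blk s)" using x by simp
        then obtain K r where K: "s = Inr (Inr (Inr (K, r)))" "(K, r) \<in> snd (snd p)" "K = blk s" "r = rk s"
          by (rule summand_param[OF p s b(3)])
        have xr: "r + 1 < index_in K i" "i \<in> K" "index_in K i \<in> {r + 2..card K}" using big' K(3,4) i x by auto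
        have "part (rep (qparam p v) s) i = qparam p v (K, r) (index_in K i)"
          unfolding K(1) by (rule rep_part_param[OF xr(1,2)])
        also have "\<dots> = fvs.span {ncoord v (blk s) (rk s) i}"
          using K(2) xr(3) ki unfolding qparam_def K(3,4) by simp
        finally show ?thesis
          using line ncoord(2)[OF b(1) finK[OF s] b(2) dim[OF s ne] i] by (simp add: u0f)
      qed
    qed
    then show ?thesis using eq[OF s i] by simp
  qed
  have zero: "\<And>s i. s \<in> ?S \<Longrightarrow> i \<in> {1..m} \<Longrightarrow> i \<notin> blk s \<Longrightarrow> part (rep (qparam p v) s) i = {0}"
    by (rule rep_part_zero)
  show ?thesis
    unfolding Fpq_alt
    using assemble_bigsum[OF p iso rep_whole zero parts] by (intro exI[of _ "assemble n p u"]) simp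
qed

text \<open>An identification of F(p,q) with the flag of \<open>v\<close> sends the standard frame
  of each summand to multiples of the first \<open>r + 1\<close> vectors of its block. These
  multiples agree with the frame of \<open>v\<close> up to one common factor, so the remaining lines
  of the summand have the coordinates recorded by \<open>qparam\<close>.\<close>

lemma normal_form_unique:
  fixes v :: "nat \<Rightarrow> nat \<Rightarrow> 'k::field"
  assumes p: "p \<in> Pset n m" and v: "vecs n m v" and q: "valid_param p q"
    and f: "lin_iso f (whole (Fpq n p q)) (Kpow n)"
    and fp: "\<And>i. i \<in> {1..m} \<Longrightarrow> f ` part (Fpq n p q) i = fvs.span {v i}"
  shows "btype n m p v" "generic n p v"
    and "\<And>K r h. (K, r) \<in> snd (snd p) \<Longrightarrow> h \<in> {r + 2..card K} \<Longrightarrow> q (K, r) h = qparam p v (K, r) h"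
proof -
  let ?S = "summands n p"
  let ?W = "whole (Fpq n p q)"
  have mf: "is_mflag m (rep q s)" if "s \<in> ?S" for s
    using rep_props(2)[OF p q that] by (simp add: has_dim_def)
  have sW: "fvs.subspace ?W" and pW: "\<And>i. i \<in> {1..m} \<Longrightarrow> part (Fpq n p q) i \<subseteq> ?W"
    unfolding Fpq_alt using subspace_whole_bigsum[of n p m "rep q"] mf by simp_all
  have "mflag_iso m (Fpq n p q) (line_flag n v)"
    unfolding mflag_iso_def line_flag_def using f fp by (intro exI[of _ f]) simp
  then have "mflag_iso m (line_flag n v) (Fpq n p q)" by (rule mflag_iso_sym[OF _ sW pW])
  then show bt: "btype n m p v"
    unfolding Fpq_alt by (rule btype_if_iso[OF p v, rotated]) (use rep_props[OF p q] in simp)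
  have lin: "lin_on f ?W" and inj: "inj_on f ?W" using f by (simp_all add: lin_iso_alt bij_betw_def)
  define \<phi> where "\<phi> s = f \<circ> emb s" for s
  have WS: "?W = bsum ?S (\<lambda>s. Kpow (rk s))"
    unfolding Fpq_alt whole_bigsum by (rule bsum_cong) (rule rep_whole)
  have embW: "emb s ` Kpow (rk s) \<subseteq> ?W" if s: "s \<in> ?S" for s
  proof (rule image_subsetI)
    fix y :: "nat \<Rightarrow> 'k" assume y: "y \<in> Kpow (rk s)"
    have "(0 :: nat \<Rightarrow> 'k) \<in> Kpow r" for r by (rule fvs.subspace_0[OF subspace_Kpow])
    then show "emb s y \<in> ?W" unfolding WS bsum_def using y s by (simp add: cmp_emb)
  qed
  have linp: "lin_on (\<phi> s) (Kpow (rk s))" and injp: "inj_on (\<phi> s) (Kpow (rk s))" if s: "s \<in> ?S" for s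
  proof -
    show "lin_on (\<phi> s) (Kpow (rk s))" unfolding \<phi>_def by (rule lin_on_comp[OF lin_on_emb lin embW[OF s]])
    show "inj_on (\<phi> s) (Kpow (rk s))"
      unfolding \<phi>_def by (rule comp_inj_on[OF inj_emb inj_on_subset[OF inj embW[OF s]]])
  qed
  have phi_part: "\<phi> s ` part (rep q s) i = fvs.span {v i}" if s: "s \<in> ?S" "i \<in> blk s" for s i
  proof -
    have i: "i \<in> {1..m}" using blk_subset[OF p s(1)] s(2) by auto
    have "part (Fpq n p q) i = emb s ` part (rep q s) i"
      unfolding Fpq_alt by (rule part_bigsum_blk[OF p i s]) (rule rep_part_zero)
    then show ?thesis using fp[OF i] by (simp add: \<phi>_def image_comp)
  qed
  have scal: "\<exists>c. c \<noteq> 0 \<and> \<phi> s y = fscale c (v i)"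
    if s: "s \<in> ?S" "i \<in> blk s" and y: "y \<in> Kpow (rk s)" "part (rep q s) i = fvs.span {y}" for s i y
  proof -
    have i: "i \<in> {1..m}" using blk_subset[OF p s(1)] s(2) by auto
    have "fvs.span {v i} = fvs.span {\<phi> s y}"
      using phi_part[OF s] y lin_on_span_singleton[OF linp[OF s(1)] subspace_Kpow y(1)] by simp
    then show ?thesis using span_singleton_eq_iff[OF vecsD(2)[OF v i]] by simp
  qed
  show g: "generic n p v"
    unfolding generic_def
  proof (intro ballI impI)
    fix s assume s: "s \<in> ?S" "2 \<le> rk s"
    let ?K = "blk s" and ?r = "rk s"
    have fin: "finite ?K" by (rule finite_subset[OF blk_subset[OF p s(1)]]) simp
    have c: "?r + 1 \<le> card ?K" using rk_cases[OF p s(1)] s(2) by simp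
    obtain y where y0: "\<forall>i\<in>?K. y i \<in> Kpow ?r \<and> y i \<noteq> 0 \<and> part (rep q s) i = fvs.span {y i}"
      "2 \<le> ?r \<longrightarrow> generic_at y ?K ?r \<and> (\<forall>x\<in>{1..?r + 1}. y (kth ?K x) = stdframe ?r x)"
      by (rule rep_vectors[OF p q s(1)])
    have km: "kth ?K x \<in> ?K" if "x \<in> {1..?r + 1}" for x by (rule kth_mem[OF fin]) (use that c in auto)
    have "\<forall>i\<in>?K. \<exists>c. c \<noteq> 0 \<and> \<phi> s (y i) = fscale c (v i)"
      using scal[OF s(1)] y0(1) by simp
    from bchoice[OF this] obtain c where c: "\<forall>i\<in>?K. c i \<noteq> 0 \<and> \<phi> s (y i) = fscale (c i) (v i)" by (elim exE)
    show "generic_at v ?K ?r"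
      unfolding generic_at_def
    proof
      fix h assume h: "h \<in> {1..?r + 1}"
      let ?T = "{1..?r + 1} - {h}"
      have "indep_fam ?T (\<lambda>x. y (kth ?K x))" using y0(2) s(2) h unfolding generic_at_def by simp
      moreover have "(\<lambda>x. y (kth ?K x)) ` ?T \<subseteq> Kpow ?r" using y0(1) km by auto
      ultimately have "indep_fam ?T (\<lambda>x. \<phi> s (y (kth ?K x)))"
        using indep_fam_image[OF linp[OF s(1)] injp[OF s(1)] subspace_Kpow, of ?T "\<lambda>x. y (kth ?K x)"] by simp
      then show "indep_fam ?T (\<lambda>x. v (kth ?K x))"
        by (rule indep_fam_scale[where c = "\<lambda>x. inverse (c (kth ?K x))", rotated 2]) (use c km in auto)
    qed
  qed
  fix K r h assume K: "(K, r) \<in> snd (snd p)" and h: "h \<in> {r + 2..card K}"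
  note ps = param_summand[OF p K]
  let ?s = "Inr (Inr (Inr (K, r)))"
  have s: "?s \<in> ?S" "blk ?s = K" "rk ?s = r" using ps(1) by (simp_all add: blk_def rk_def)
  have c1: "r + 1 \<le> card K" using ps(6) by simp
  note gK = generic_param(1)[OF p K g] ps(2) c1 generic_param(2)[OF p K bt]
  obtain y where y0: "\<forall>i\<in>blk ?s. y i \<in> Kpow (rk ?s) \<and> y i \<noteq> 0 \<and> part (rep q ?s) i = fvs.span {y i}"
    "2 \<le> rk ?s \<longrightarrow> generic_at y (blk ?s) (rk ?s) \<and> (\<forall>x\<in>{1..rk ?s + 1}. y (kth (blk ?s) x) = stdframe (rk ?s) x)"
    by (rule rep_vectors[OF p q s(1)])
  have km: "kth K x \<in> K" if "x \<in> {1..card K}" for x by (rule kth_mem[OF ps(2) that])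
  have "\<forall>i\<in>K. \<exists>c. c \<noteq> 0 \<and> \<phi> ?s (y i) = fscale c (v i)"
    using scal[OF s(1)] y0(1) s(2,3) by simp
  from bchoice[OF this] obtain c where c: "\<forall>i\<in>K. c i \<noteq> 0 \<and> \<phi> ?s (y i) = fscale (c i) (v i)" by (elim exE)
  \<comment> \<open>The unit point is sent to \<open>?\<mu>\<close> times vector number
    \<open>r + 1\<close>, the unit vectors to the multiples \<open>c (kth K x)\<close> of the first
    \<open>r\<close> vectors. Comparing the two determines \<open>coef\<close> of that vector as a
    quotient.\<close>
  let ?\<mu> = "c (kth K (r + 1))"
  have last: "kth K (r + 1) \<in> K" by (rule km) (use c1 in simp)
  have ystd: "y (kth K x) = stdframe r x" if "x \<in> {1..r + 1}" for x using y0(2) that s ps(5) by simp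
  have phi_unit: "\<phi> ?s (unit_vec x) = fscale (c (kth K x)) (v (kth K x))" if x: "x \<in> {1..r}" for x
  proof -
    have "kth K x \<in> K" by (rule km) (use x c1 in simp)
    from bspec[OF c this] show ?thesis using ystd[of x] x by (simp add: stdframe_def)
  qed
  have phi_sum: "\<phi> ?s z = (\<Sum>x\<in>{1..r}. fscale (z x * c (kth K x)) (v (kth K x)))" if z: "z \<in> Kpow r" for z
  proof -
    have "\<phi> ?s z = \<phi> ?s (\<Sum>x\<in>{1..r}. fscale (z x) (unit_vec x))" using Kpow_expand[OF z] by simp
    also have "\<dots> = (\<Sum>x\<in>{1..r}. fscale (z x) (\<phi> ?s (unit_vec x)))"
      by (rule lin_on_sum[OF linp[OF s(1)] subspace_Kpow]) (simp_all only: s finite_atLeastAtMost unit_vec_in_Kpow)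
    also have "\<dots> = (\<Sum>x\<in>{1..r}. fscale (z x * c (kth K x)) (v (kth K x)))"
      by (rule sum.cong) (simp_all add: phi_unit)
    finally show ?thesis .
  qed
  have cx: "coef v K r (kth K (r + 1)) x = c (kth K x) / ?\<mu>" if x: "x \<in> {1..r}" for x
  proof (rule coef_eqI[OF gK last _ x])
    have "fscale ?\<mu> (v (kth K (r + 1))) = \<phi> ?s (stdframe r (r + 1))" using bspec[OF c last] ystd[of "r + 1"] by simp
    also have "\<dots> = (\<Sum>x\<in>{1..r}. fscale (stdframe r (r + 1) x * c (kth K x)) (v (kth K x)))"
      by (rule phi_sum[OF stdframe_Kpow]) simp
    also have "\<dots> = (\<Sum>x\<in>{1..r}. fscale (c (kth K x)) (v (kth K x)))"
      by (rule sum.cong) (simp_all add: stdframe_apply)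
    finally have "fscale (inverse ?\<mu>) (fscale ?\<mu> (v (kth K (r + 1))))
        = fscale (inverse ?\<mu>) (\<Sum>x\<in>{1..r}. fscale (c (kth K x)) (v (kth K x)))" by simp
    then show "(\<Sum>x\<in>{1..r}. fscale (c (kth K x) / ?\<mu>) (v (kth K x))) = v (kth K (r + 1))"
      using bspec[OF c last] by (simp add: fvs.scale_sum_right field_simps)
  qed
  let ?i = "kth K h"
  have i: "?i \<in> K" by (rule km) (use h in auto)
  let ?z = "ncoord v K r ?i"
  have z: "?z \<in> Kpow r" by (rule ncoord(1)[OF gK i])
  \<comment> \<open>The factors \<open>c (kth K x)\<close> cancel against the denominators in
    \<open>ncoord\<close>. Only the common factor \<open>?\<mu>\<close> survives, and it does not
    change the line.\<close>
  have "\<phi> ?s ?z = (\<Sum>x\<in>{1..r}. fscale (?z x * c (kth K x)) (v (kth K x)))" by (rule phi_sum[OF z])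
  also have "\<dots> = (\<Sum>x\<in>{1..r}. fscale ?\<mu> (fscale (coef v K r ?i x) (v (kth K x))))"
  proof (rule sum.cong[OF refl])
    fix x assume x: "x \<in> {1..r}"
    have "kth K x \<in> K" by (rule km) (use x c1 in simp)
    then have "c (kth K x) \<noteq> 0" "?\<mu> \<noteq> 0" using bspec[OF c] last by simp_all
    then have "?z x * c (kth K x) = ?\<mu> * coef v K r ?i x"       using cx[OF x] by (simp add: ncoord_def)
    then show "fscale (?z x * c (kth K x)) (v (kth K x)) = fscale ?\<mu> (fscale (coef v K r ?i x) (v (kth K x)))" by simp
  qed
  also have "\<dots> = fscale ?\<mu> (v ?i)" using coef(2)[OF gK i] by (simp only: fvs.scale_sum_right[symmetric])
  finally have phz: "\<phi> ?s ?z = fscale ?\<mu> (v ?i)" .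
  have "v ?i \<noteq> 0" using vecsD(2)[OF v] i ps(3) by auto
  moreover have "?\<mu> \<noteq> 0" using bspec[OF c last] by simp
  ultimately have "fvs.span {v ?i} = fvs.span {\<phi> ?s ?z}" using span_singleton_eq_iff phz by metis
  moreover have "\<phi> ?s ` fvs.span {?z} = fvs.span {\<phi> ?s ?z}"
    by (rule lin_on_span_singleton[OF linp[OF s(1)] subspace_Kpow]) (use z s in simp)
  moreover have "\<phi> ?s ` part (rep q ?s) ?i = fvs.span {v ?i}" by (rule phi_part[OF s(1)]) (use i s in simp)
  ultimately have eq: "\<phi> ?s ` fvs.span {?z} = \<phi> ?s ` part (rep q ?s) ?i" by simp
  have "fvs.span {?z} \<subseteq> Kpow (rk ?s)" by (rule fvs.span_minimal) (use z s in simp_all)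
  moreover have "part (rep q ?s) ?i \<subseteq> Kpow (rk ?s)"
  proof -
    have "part (rep q ?s) ?i = fvs.span {y ?i}" "y ?i \<in> Kpow (rk ?s)" using y0(1) i s(2) by simp_all
    then show ?thesis by (simp add: fvs.span_minimal)
  qed
  ultimately have e1: "fvs.span {?z} = part (rep q ?s) ?i"
    using inj_on_image_eq_iff[OF injp[OF s(1)]] eq by blast
  have ix: "index_in K ?i = h" by (rule index_in_kth[OF ps(2)]) (use h in auto)
  have "part (rep q ?s) ?i = q (K, r) h" using rep_part_param[of r K ?i q] ix i h by simp
  then show "q (K, r) h = qparam p v (K, r) h" using e1 K h by (simp add: qparam_def)
qed

section \<open>Projective spaces and the orbit space as open images of spaces of vectors\<close>

section \<open>Orbit spaces\<close>

lemma openin_quotient_via_saturation: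
  assumes "U \<subseteq> f ` topspace X" "openin X {x \<in> topspace X. f x \<in> U}"
  shows "openin (quotient_topology X f) U"
  using assms by (simp add: openin_quotient_topology)

lemma continuous_on_lin_on:
  fixes h :: "(nat \<Rightarrow> 'k::real_normed_field) \<Rightarrow> nat \<Rightarrow> 'k"
  assumes "lin_on h (Kpow n)"
  shows "continuous_on (Kpow n) h"
proof (rule continuous_on_coordinatewise_then_product)
  fix i
  have "h z i = (\<Sum>j\<in>{1..n}. z j * h (unit_vec j) i)" if z: "z \<in> Kpow n" for z
  proof -
    have "h z = h (\<Sum>j\<in>{1..n}. fscale (z j) (unit_vec j))" using Kpow_expand[OF z] by simp
    also have "\<dots> = (\<Sum>j\<in>{1..n}. fscale (z j) (h (unit_vec j)))"
      by (rule lin_on_sum[OF assms subspace_Kpow]) (simp_all only: finite_atLeastAtMost unit_vec_in_Kpow)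
    finally show ?thesis by (simp add: sum_fun_apply fscale_apply)
  qed
  moreover have "continuous_on (Kpow n) (\<lambda>z. \<Sum>j\<in>{1..n}. z j * h (unit_vec j) i)"
    by (intro continuous_on_sum continuous_on_mult continuous_on_const continuous_on_subset[OF continuous_on_product_coordinates]) simp
  ultimately show "continuous_on (Kpow n) (\<lambda>z. h z i)" by (simp cong: continuous_on_cong)
qed

abbreviation Kx :: "nat \<Rightarrow> (nat \<Rightarrow> 'k::real_normed_field) topology" where
  "Kx n \<equiv> top_of_set (Kpow n - {0})"

lemma continuous_map_Kx:
  fixes h :: "(nat \<Rightarrow> 'k::real_normed_field) \<Rightarrow> nat \<Rightarrow> 'k"
  assumes "lin_on h (Kpow n)" "inj_on h (Kpow n)" "h ` Kpow n \<subseteq> Kpow k"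
  shows "continuous_map (Kx n) (Kx k) h"
proof -
  have "continuous_on (Kpow n - {0}) h"
    by (rule continuous_on_subset[OF continuous_on_lin_on[OF assms(1)]]) auto
  moreover have "h z \<in> Kpow k - {0}" if "z \<in> Kpow n - {0}" for z
    using that assms(3) lin_on_eq_0[OF assms(1,2) subspace_Kpow, of z] by auto
  ultimately show ?thesis by (simp add: continuous_map_in_subtopology image_subset_iff Pi_iff)
qed

lemma topspace_Proj: "topspace (Proj n :: (nat \<Rightarrow> 'k::real_normed_field) set topology) = (\<lambda>v. fvs.span {v}) ` (Kpow n - {0})"
  by (simp add: Proj_def)

lemma quotient_map_Proj: "quotient_map (Kx n) (Proj n) (\<lambda>v :: nat \<Rightarrow> 'k::real_normed_field. fvs.span {v})"
  unfolding Proj_def by (rule quotient_map_quotient_topology)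

text \<open>The saturation of an open set is the union of its preimages under all nonzero scalars,
  and each of them acts continuously.\<close>

lemma open_map_Proj: "open_map (Kx n) (Proj n) (\<lambda>v :: nat \<Rightarrow> 'k::real_normed_field. fvs.span {v})"
  unfolding open_map_def
proof (intro allI impI)
  let ?P = "\<lambda>v :: nat \<Rightarrow> 'k. fvs.span {v}"
  fix U :: "(nat \<Rightarrow> 'k) set" assume U: "openin (Kx n) U"
  have UK: "U \<subseteq> Kpow n - {0}" using openin_subset[OF U] by simp
  have eq: "{v \<in> topspace (Kx n). ?P v \<in> ?P ` U} = (\<Union>c\<in>UNIV - {0}. {v \<in> topspace (Kx n). fscale c v \<in> U})" (is "?L = ?R")
  proof (rule subset_antisym; rule subsetI)
    fix v assume "v \<in> ?L"
    then obtain u where u: "v \<in> Kpow n" "v \<noteq> 0" "u \<in> U" "?P v = ?P u" by auto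
    then obtain c where "c \<noteq> 0" "u = fscale c v" using span_singleton_eq_iff[OF u(2), of u] by auto
    then show "v \<in> ?R" using u by auto
  next
    fix v assume "v \<in> ?R"
    then obtain c where c: "c \<noteq> 0" "v \<in> Kpow n" "v \<noteq> 0" "fscale c v \<in> U" by auto
    then have "?P v = ?P (fscale c v)" using span_singleton_eq_iff[OF c(3), of "fscale c v"] by auto
    then show "v \<in> ?L" using c by auto
  qed
  have "openin (Kx n) {v \<in> topspace (Kx n). fscale c v \<in> U}" if "c \<in> UNIV - {0}" for c
  proof (rule openin_continuous_map_preimage[OF _ U], rule continuous_map_Kx)
    show "lin_on (fscale c) (Kpow n)" by (simp add: lin_on_def fvs.scale_right_distrib mult.commute)
    show "inj_on (fscale c) (Kpow n)" using that by (auto intro!: inj_onI)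
    show "fscale c ` Kpow n \<subseteq> Kpow n" by (auto intro!: fvs.subspace_scale)
  qed
  then have "openin (Kx n) ?R" by (intro openin_Union) blast
  then show "openin (Proj n) (?P ` U)"
    unfolding Proj_def
  proof (intro openin_quotient_via_saturation)
    show "?P ` U \<subseteq> ?P ` topspace (Kx n)" using UK by (intro image_mono) simp
  qed (simp only: eq)
qed

lemma continuous_map_Proj:
  fixes h :: "(nat \<Rightarrow> 'k::real_normed_field) \<Rightarrow> nat \<Rightarrow> 'k"
  assumes "lin_on h (Kpow n)" "inj_on h (Kpow n)" "h ` Kpow n \<subseteq> Kpow k"
  shows "continuous_map (Proj n) (Proj k) (\<lambda>L. h ` L)"
proof (rule continuous_compose_quotient_map[OF quotient_map_Proj])
  have "continuous_map (Kx n) (Proj k) ((\<lambda>v. fvs.span {v}) \<circ> h)"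
    by (rule continuous_map_compose[OF continuous_map_Kx[OF assms] quotient_imp_continuous_map[OF quotient_map_Proj]])
  then show "continuous_map (Kx n) (Proj k) ((\<lambda>L. h ` L) \<circ> (\<lambda>v. fvs.span {v}))"
    by (rule continuous_map_eq) (auto simp: lin_on_span_singleton[OF assms(1) subspace_Kpow])
qed

text \<open>The image of a box is a box. Surjectivity of the factors keeps unrestricted factors
  unrestricted, so that only finitely many are proper.\<close>

lemma open_map_product:
  assumes op: "\<And>i. i \<in> I \<Longrightarrow> open_map (X i) (Y i) (f i)"
    and surj: "\<And>i. i \<in> I \<Longrightarrow> f i ` topspace (X i) = topspace (Y i)"
  shows "open_map (product_topology X I) (product_topology Y I) (\<lambda>x. \<lambda>i\<in>I. f i (x i))"
  unfolding open_map_def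
proof (intro allI impI)
  fix U assume U: "openin (product_topology X I) U"
  let ?F = "\<lambda>x. \<lambda>i\<in>I. f i (x i)"
  have "\<exists>W. finite {i \<in> I. W i \<noteq> topspace (Y i)} \<and> (\<forall>i\<in>I. openin (Y i) (W i)) \<and> y \<in> Pi\<^sub>E I W \<and> Pi\<^sub>E I W \<subseteq> ?F ` U"
    if y: "y \<in> ?F ` U" for y
  proof -
    obtain x where x: "x \<in> U" "y = ?F x" using y by auto
    obtain V where V: "finite {i \<in> I. V i \<noteq> topspace (X i)}" "\<forall>i\<in>I. openin (X i) (V i)" "x \<in> Pi\<^sub>E I V" "Pi\<^sub>E I V \<subseteq> U"
      using U x(1) unfolding openin_product_topology_alt by blast
    let ?W = "\<lambda>i. f i ` V i"
    have "{i \<in> I. ?W i \<noteq> topspace (Y i)} \<subseteq> {i \<in> I. V i \<noteq> topspace (X i)}" using surj by auto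
    then have "finite {i \<in> I. ?W i \<noteq> topspace (Y i)}" using V(1) finite_subset by blast
    moreover have "\<forall>i\<in>I. openin (Y i) (?W i)" using V(2) op by (simp add: open_map_def)
    moreover have "y \<in> Pi\<^sub>E I ?W" using V(3) x(2) by (auto simp: PiE_iff)
    moreover have "Pi\<^sub>E I ?W \<subseteq> ?F ` U"
    proof
      fix z assume z: "z \<in> Pi\<^sub>E I ?W"
      then have "\<forall>i\<in>I. \<exists>a\<in>V i. z i = f i a" by (auto simp: PiE_iff)
      then obtain a where a: "\<forall>i\<in>I. a i \<in> V i \<and> z i = f i (a i)" by metis
      let ?a = "restrict a I"
      have "?a \<in> Pi\<^sub>E I V" using a by auto
      moreover have "z = ?F ?a" using z a by (intro ext) (auto simp: PiE_iff extensional_def)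
      ultimately show "z \<in> ?F ` U" using V(4) by blast
    qed
    ultimately show ?thesis by (intro exI[of _ ?W]) simp
  qed
  then show "openin (product_topology Y I) (?F ` U)" unfolding openin_product_topology_alt by blast
qed

text \<open>Tuples of nonzero vectors: the cover of the space of line tuples on which coordinates,
  and so limits, are available.\<close>

definition VT :: "nat \<Rightarrow> nat \<Rightarrow> (nat \<Rightarrow> nat \<Rightarrow> 'k::real_normed_field) topology" where
  "VT n m = product_topology (\<lambda>i. Kx n) {1..m}"

definition lines :: "nat \<Rightarrow> (nat \<Rightarrow> nat \<Rightarrow> 'k::field) \<Rightarrow> nat \<Rightarrow> (nat \<Rightarrow> 'k) set" where
  "lines m v = (\<lambda>i\<in>{1..m}. fvs.span {v i})"

lemma VT_vecs: "v \<in> topspace (VT n m) \<Longrightarrow> vecs n m v"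
  by (auto simp: VT_def vecs_def PiE_iff)

lemma open_map_lines: "open_map (VT n m) (Tuples n m :: (nat \<Rightarrow> (nat \<Rightarrow> 'k::real_normed_field) set) topology) (lines m)"
  unfolding VT_def Tuples_def lines_def
  by (rule open_map_product[OF open_map_Proj]) (simp add: topspace_Proj)

lemma continuous_map_lines: "continuous_map (VT n m) (Tuples n m :: (nat \<Rightarrow> (nat \<Rightarrow> 'k::real_normed_field) set) topology) (lines m)"
  unfolding VT_def Tuples_def lines_def continuous_map_componentwise
proof (intro conjI ballI)
  fix k assume k: "k \<in> {1..m}"
  have "continuous_map (product_topology (\<lambda>i. Kx n) {1..m}) (Proj n) ((\<lambda>v :: nat \<Rightarrow> 'k. fvs.span {v}) \<circ> (\<lambda>x. x k))"
    by (rule continuous_map_compose[OF continuous_map_product_projection[OF k] quotient_imp_continuous_map[OF quotient_map_Proj]])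
  then show "continuous_map (product_topology (\<lambda>i. Kx n) {1..m}) (Proj n) (\<lambda>x :: nat \<Rightarrow> nat \<Rightarrow> 'k. (\<lambda>i\<in>{1..m}. fvs.span {x i}) k)"
    using k by (simp add: o_def)
qed auto

lemma lines_surj: "lines m ` topspace (VT n m) = topspace (Tuples n m :: (nat \<Rightarrow> (nat \<Rightarrow> 'k::real_normed_field) set) topology)"
proof
  show "lines m ` topspace (VT n m) \<subseteq> topspace (Tuples n m :: (nat \<Rightarrow> (nat \<Rightarrow> 'k) set) topology)"
    using continuous_map_image_subset_topspace[OF continuous_map_lines] .
  show "topspace (Tuples n m :: (nat \<Rightarrow> (nat \<Rightarrow> 'k) set) topology) \<subseteq> lines m ` topspace (VT n m)"
  proof
    fix F :: "nat \<Rightarrow> (nat \<Rightarrow> 'k) set" assume F: "F \<in> topspace (Tuples n m)"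
    then have "\<forall>i\<in>{1..m}. \<exists>a\<in>Kpow n - {0}. F i = fvs.span {a}" by (auto simp: Tuples_def topspace_Proj PiE_iff)
    then obtain a where a: "\<forall>i\<in>{1..m}. a i \<in> Kpow n - {0} \<and> F i = fvs.span {a i}" by metis
    have "restrict a {1..m} \<in> topspace (VT n m)" using a by (auto simp: VT_def)
    moreover have "F = lines m (restrict a {1..m})"
      using F a by (intro ext) (auto simp: lines_def Tuples_def PiE_iff extensional_def)
    ultimately show "F \<in> lines m ` topspace (VT n m)" by auto
  qed
qed

subsection \<open>Orbits of multiple flags\<close>

lemma mflag_orbit_mono:
  assumes "mflag_iso m D E" shows "mflag_orbit n m E \<subseteq> mflag_orbit n m D"
proof
  fix x assume "x \<in> mflag_orbit n m E"
  then obtain g where g: "x = (\<lambda>i\<in>{1..m}. g ` part E i)" "lin_iso g (whole E) (Kpow n)"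
    by (auto simp: mflag_orbit_def)
  obtain f where f: "lin_iso f (whole D) (whole E)" "\<forall>i\<in>{1..m}. f ` part D i = part E i"
    using assms by (auto simp: mflag_iso_def)
  have "x = (\<lambda>i\<in>{1..m}. (g \<circ> f) ` part D i)"
    unfolding g(1) by (rule restrict_ext) (simp only: f(2)[rule_format, symmetric] image_comp)
  then show "x \<in> mflag_orbit n m D"
    using lin_iso_trans[OF f(1) g(2)] unfolding mflag_orbit_def mem_Collect_eq by (intro exI conjI)
qed

lemma diag_orbit_lines:
  assumes v: "vecs n m v"
  shows "diag_orbit n m (lines m v) = mflag_orbit n m (line_flag n v)"
proof
  show "diag_orbit n m (lines m v) \<subseteq> mflag_orbit n m (line_flag n v)"
  proof
    fix x assume "x \<in> diag_orbit n m (lines m v)"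
    then obtain g where g: "x = (\<lambda>i\<in>{1..m}. g ` lines m v i)" "lin_iso g (Kpow n) (Kpow n)"
      by (auto simp: diag_orbit_def GL_def)
    have "x = (\<lambda>i\<in>{1..m}. g ` fvs.span {v i})"
      unfolding g(1) by (rule restrict_ext) (simp add: lines_def)
    then show "x \<in> mflag_orbit n m (line_flag n v)"
      unfolding mflag_orbit_def line_flag_def using g(2) by auto
  qed
  show "mflag_orbit n m (line_flag n v) \<subseteq> diag_orbit n m (lines m v)"
  proof
    fix x assume "x \<in> mflag_orbit n m (line_flag n v)"
    then obtain g where g: "x = (\<lambda>i\<in>{1..m}. g ` fvs.span {v i})" "lin_iso g (Kpow n) (Kpow n)"
      by (auto simp: mflag_orbit_def line_flag_def)
    \<comment> \<open>Elements of \<open>GL n\<close> are extensional, so an isomorphism has to be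
      cut down to \<open>Kpow n\<close>.\<close>
    let ?g = "restrict g (Kpow n)"
    have "lin_iso ?g (Kpow n) (Kpow n)" using g(2) lin_iso_cong[of "Kpow n" ?g g] by simp
    then have "?g \<in> GL n" by (simp add: GL_def)
    moreover have "x = (\<lambda>i\<in>{1..m}. ?g ` lines m v i)"
      unfolding g(1)
    proof (rule restrict_ext)
      fix i assume i: "i \<in> {1..m}"
      have "fvs.span {v i} \<subseteq> Kpow n" by (rule fvs.span_minimal) (use vecsD(1)[OF v i] in simp_all)
      then have "g ` fvs.span {v i} = ?g ` fvs.span {v i}" by (intro image_cong) auto
      then show "g ` fvs.span {v i} = ?g ` lines m v i" using i by (simp add: lines_def)
    qed
    ultimately show "x \<in> diag_orbit n m (lines m v)"
      unfolding diag_orbit_def mem_Collect_eq by (intro exI conjI)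
  qed
qed

lemma line_flag_sub: "vecs n m v \<Longrightarrow> i \<in> {1..m} \<Longrightarrow> part (line_flag n v) i \<subseteq> whole (line_flag n v)"
  by (simp add: line_flag_def fvs.span_minimal vecsD(1))

lemma lines_in_mflag_orbit: "lines m v \<in> mflag_orbit n m D \<longleftrightarrow> mflag_iso m D (line_flag n v)"
proof
  assume "lines m v \<in> mflag_orbit n m D"
  then obtain f where f: "lines m v = (\<lambda>i\<in>{1..m}. f ` part D i)" "lin_iso f (whole D) (Kpow n)"
    by (auto simp: mflag_orbit_def)
  have "f ` part D i = fvs.span {v i}" if "i \<in> {1..m}" for i
    using fun_cong[OF f(1), of i] that by (simp add: lines_def)
  then show "mflag_iso m D (line_flag n v)"
    unfolding mflag_iso_def line_flag_def using f(2) by (intro exI[of _ f]) simp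
next
  assume "mflag_iso m D (line_flag n v)"
  then obtain f where f: "lin_iso f (whole D) (Kpow n)" "\<forall>i\<in>{1..m}. f ` part D i = fvs.span {v i}"
    by (auto simp: mflag_iso_def line_flag_def)
  have "lines m v = (\<lambda>i\<in>{1..m}. f ` part D i)" unfolding lines_def using f(2) by (intro restrict_ext) simp
  then show "lines m v \<in> mflag_orbit n m D" using f(1) by (auto simp: mflag_orbit_def)
qed

lemma mflag_iso_refl: "mflag_iso m D D"
  unfolding mflag_iso_def by (rule exI[of _ "\<lambda>x. x"]) (simp add: lin_iso_def bij_betw_def)

text \<open>The orbit of \<open>v\<close> contains \<open>lines m v\<close> itself, so equal orbits
  yield an isomorphism. The converse also uses the inverse isomorphism, hence the hypotheses on
  \<open>D\<close>.\<close>

lemma mflag_orbit_eq_iff: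
  assumes v: "vecs n m v" and D: "fvs.subspace (whole D)" "\<And>i. i \<in> {1..m} \<Longrightarrow> part D i \<subseteq> whole D"
  shows "mflag_orbit n m (line_flag n v) = mflag_orbit n m D \<longleftrightarrow> mflag_iso m D (line_flag n v)"
proof
  assume "mflag_orbit n m (line_flag n v) = mflag_orbit n m D"
  moreover have "lines m v \<in> mflag_orbit n m (line_flag n v)" by (simp add: lines_in_mflag_orbit mflag_iso_refl)
  ultimately show "mflag_iso m D (line_flag n v)" by (simp add: lines_in_mflag_orbit)
next
  assume iso: "mflag_iso m D (line_flag n v)"
  show "mflag_orbit n m (line_flag n v) = mflag_orbit n m D"
    using mflag_orbit_mono[OF iso] mflag_orbit_mono[OF mflag_iso_sym[OF iso D]] by auto
qed

definition orb :: "nat \<Rightarrow> nat \<Rightarrow> (nat \<Rightarrow> nat \<Rightarrow> 'k::real_normed_field) \<Rightarrow> (nat \<Rightarrow> (nat \<Rightarrow> 'k) set) set" where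
  "orb n m v = mflag_orbit n m (line_flag n v)"

lemma orb_eq_diag: "v \<in> topspace (VT n m) \<Longrightarrow> orb n m v = diag_orbit n m (lines m v)"
  by (simp add: orb_def diag_orbit_lines VT_vecs)

lemma continuous_map_orb: "continuous_map (VT n m) (OrbitSpace n m) (orb n m)"
proof -
  have "continuous_map (VT n m) (OrbitSpace n m) (diag_orbit n m \<circ> lines m)"
    unfolding OrbitSpace_def
    by (rule continuous_map_compose[OF continuous_map_lines quotient_imp_continuous_map[OF quotient_map_quotient_topology]])
  then show ?thesis by (rule continuous_map_eq) (simp add: orb_eq_diag)
qed

lemma orb_surj: "orb n m ` topspace (VT n m) = topspace (OrbitSpace n m)"
proof -
  have "orb n m ` topspace (VT n m) = diag_orbit n m ` lines m ` topspace (VT n m)"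
    unfolding image_image by (rule image_cong) (simp_all add: orb_eq_diag)
  then show ?thesis by (simp add: lines_surj OrbitSpace_def)
qed

text \<open>The saturation of an open set is a union of preimages under continuous maps, one for
  each linear isomorphism and each choice of nonzero scalars; it is then pushed down through the
  open map \<open>lines m\<close>.\<close>

lemma open_map_orb: "open_map (VT n m) (OrbitSpace n m) (orb n m :: (nat \<Rightarrow> nat \<Rightarrow> 'k::real_normed_field) \<Rightarrow> _)"
  unfolding open_map_def
proof (intro allI impI)
  fix U :: "(nat \<Rightarrow> nat \<Rightarrow> 'k) set" assume U: "openin (VT n m) U"
  have UV: "U \<subseteq> topspace (VT n m)" by (rule openin_subset[OF U])
  \<comment> \<open>Besides a common \<open>g\<close>, each vector may be rescaled on its own,
    because only its line enters the orbit.\<close>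
  let ?act = "\<lambda>(g, c) v. \<lambda>i\<in>{1..m}. fscale (c i) (g (v i)) :: nat \<Rightarrow> 'k"
  let ?A = "{(g, c). lin_iso g (Kpow n) (Kpow n) \<and> (\<forall>i\<in>{1..m}. c i \<noteq> 0)}"
  have act_cont: "continuous_map (VT n m) (VT n m) (?act a)" if "a \<in> ?A" for a
  proof -
    obtain g c where a: "a = (g, c)" "lin_iso g (Kpow n) (Kpow n)" "\<And>i. i \<in> {1..m} \<Longrightarrow> c i \<noteq> 0" using \<open>a \<in> ?A\<close> by auto
    have g: "lin_on g (Kpow n)" "inj_on g (Kpow n)" "g ` Kpow n = Kpow n"
      using a(2) by (simp_all add: lin_iso_alt bij_betw_def)
    show ?thesis
      unfolding VT_def continuous_map_componentwise
    proof (intro conjI ballI)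
      fix k assume k: "k \<in> {1..m}"
      have "lin_on (fscale (c k)) (Kpow n)" by (simp add: lin_on_def fvs.scale_right_distrib mult.commute)
      moreover have "inj_on (fscale (c k)) (Kpow n)" using a(3)[OF k] by (auto intro!: inj_onI)
      moreover have "fscale (c k) ` Kpow n \<subseteq> Kpow n" by (auto intro!: fvs.subspace_scale)
      ultimately have s: "continuous_map (Kx n) (Kx n) (fscale (c k))" by (rule continuous_map_Kx)
      have "continuous_map (Kx n) (Kx n) g" by (rule continuous_map_Kx[OF g(1,2)]) (simp add: g(3))
      from continuous_map_compose[OF continuous_map_compose[OF continuous_map_product_projection[OF k] this] s]
      show "continuous_map (product_topology (\<lambda>i. Kx n) {1..m}) (Kx n) (\<lambda>x. ?act a x k)"
        using k by (simp add: o_def a(1))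
    qed (auto simp: a(1))
  qed
  have eq: "{v \<in> topspace (VT n m). orb n m v \<in> orb n m ` U} = (\<Union>a\<in>?A. {v \<in> topspace (VT n m). ?act a v \<in> U})" (is "?L = ?R")
  proof (rule subset_antisym; rule subsetI)
    fix v assume "v \<in> ?L"
    then obtain u where v: "v \<in> topspace (VT n m)" and u: "u \<in> U" "orb n m v = orb n m u" by auto
    have uT: "u \<in> topspace (VT n m)" using u UV by auto
    have "mflag_iso m (line_flag n v) (line_flag n u)"
      using u(2)[symmetric] mflag_orbit_eq_iff[OF VT_vecs[OF uT], of "line_flag n v"] line_flag_sub[OF VT_vecs[OF v]]
      by (simp add: orb_def line_flag_def)
    then obtain g where g: "lin_iso g (Kpow n) (Kpow n)" "\<forall>i\<in>{1..m}. g ` fvs.span {v i} = fvs.span {u i}"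
      by (auto simp: mflag_iso_def line_flag_def)
    have gl: "lin_on g (Kpow n)" "inj_on g (Kpow n)" using g(1) by (simp_all add: lin_iso_alt bij_betw_def)
    have "\<forall>i\<in>{1..m}. \<exists>c. c \<noteq> 0 \<and> u i = fscale c (g (v i))"
    proof
      fix i assume i: "i \<in> {1..m}"
      note vi = vecsD[OF VT_vecs[OF v] i]
      have "g (v i) \<noteq> 0" using lin_on_eq_0[OF gl subspace_Kpow vi(1)] vi(2) by auto
      moreover have "fvs.span {g (v i)} = fvs.span {u i}"
        using bspec[OF g(2) i] lin_on_span_singleton[OF gl(1) subspace_Kpow vi(1)] by simp
      ultimately show "\<exists>c. c \<noteq> 0 \<and> u i = fscale c (g (v i))" using span_singleton_eq_iff by auto
    qed
    from bchoice[OF this] obtain c where c: "\<forall>i\<in>{1..m}. c i \<noteq> 0 \<and> u i = fscale (c i) (g (v i))" by (elim exE)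
    have "u = ?act (g, c) v" using c uT by (intro ext) (auto simp: VT_def PiE_iff extensional_def)
    then show "v \<in> ?R" using v u(1) c g(1) by (intro UN_I[of "(g, c)"]) auto
  next
    fix v assume "v \<in> ?R"
    then obtain g c where v: "v \<in> topspace (VT n m)" and g: "lin_iso g (Kpow n) (Kpow n)" and c: "\<forall>i\<in>{1..m}. c i \<noteq> 0"
      and u: "?act (g, c) v \<in> U" by auto
    let ?u = "?act (g, c) v"
    have uT: "?u \<in> topspace (VT n m)" using u UV by auto
    have gl: "lin_on g (Kpow n)" "inj_on g (Kpow n)" using g(1) by (simp_all add: lin_iso_alt bij_betw_def)
    have "\<forall>i\<in>{1..m}. g ` fvs.span {v i} = fvs.span {?u i}"
    proof
      fix i assume i: "i \<in> {1..m}"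
      note vi = vecsD[OF VT_vecs[OF v] i]
      have "g (v i) \<noteq> 0" using lin_on_eq_0[OF gl subspace_Kpow vi(1)] vi(2) by auto
      moreover have "\<exists>d. d \<noteq> 0 \<and> ?u i = fscale d (g (v i))" using c i by (intro exI[of _ "c i"]) simp
      ultimately have "fvs.span {g (v i)} = fvs.span {?u i}" using span_singleton_eq_iff by blast
      then show "g ` fvs.span {v i} = fvs.span {?u i}" using lin_on_span_singleton[OF gl(1) subspace_Kpow vi(1)] by simp
    qed
    then have "mflag_iso m (line_flag n v) (line_flag n ?u)"
      unfolding mflag_iso_def using g by (intro exI[of _ g]) (simp add: line_flag_def)
    then have "orb n m ?u = orb n m v"
      using mflag_orbit_eq_iff[OF VT_vecs[OF uT], of "line_flag n v"] line_flag_sub[OF VT_vecs[OF v]]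
      by (simp add: orb_def line_flag_def)
    then show "v \<in> ?L" using v u by (auto intro: image_eqI[of _ _ ?u])
  qed
  have "openin (VT n m) ?R"
  proof (rule openin_Union)
    fix S assume "S \<in> (\<lambda>a. {v \<in> topspace (VT n m). ?act a v \<in> U}) ` ?A"
    then show "openin (VT n m) S" using openin_continuous_map_preimage[OF act_cont U] by auto
  qed
  then have "openin (VT n m) ?L" unfolding eq .
  then have "openin (Tuples n m) (lines m ` ?L)"
    by (rule open_map_lines[unfolded open_map_def, rule_format])
  moreover have "lines m ` ?L = {F \<in> topspace (Tuples n m). diag_orbit n m F \<in> orb n m ` U}"
  proof -
    have "{v \<in> topspace (VT n m). orb n m v \<in> orb n m ` U} = {v \<in> topspace (VT n m). diag_orbit n m (lines m v) \<in> orb n m ` U}"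
      by (rule Collect_cong) (simp add: orb_eq_diag cong: conj_cong)
    moreover have "lines m ` {v \<in> X. P (lines m v)} = {F \<in> lines m ` X. P F}"
      for X :: "(nat \<Rightarrow> nat \<Rightarrow> 'k) set" and P by auto
    ultimately show ?thesis unfolding lines_surj[symmetric] by (simp only:)
  qed
  moreover have "orb n m ` U \<subseteq> diag_orbit n m ` topspace (Tuples n m)"
  proof -
    have "orb n m ` U \<subseteq> orb n m ` topspace (VT n m)" by (rule image_mono[OF UV])
    also have "\<dots> = topspace (OrbitSpace n m)" by (rule orb_surj)
    also have "\<dots> = diag_orbit n m ` topspace (Tuples n m)" by (simp add: OrbitSpace_def)
    finally show ?thesis .
  qed
  ultimately show "openin (OrbitSpace n m) (orb n m ` U)"
    unfolding OrbitSpace_def by (intro openin_quotient_via_saturation) simp_all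
qed

section \<open>Continuous dependence of independence and coefficients on moving vectors\<close>

section \<open>Continuity of coordinates\<close>

text \<open>The family is extended to a basis of the whole function space; the rows of
  \<open>\<phi>\<close> are the values of its coordinate functions on the unit vectors.\<close>

lemma dual_functionals:
  fixes u :: "'t \<Rightarrow> nat \<Rightarrow> 'k::field"
  assumes "finite T" "indep_fam T u" "\<And>t. t \<in> T \<Longrightarrow> u t \<in> Kpow n"
  shows "\<exists>\<phi>. \<forall>s\<in>T. \<forall>t\<in>T. (\<Sum>j\<in>{1..n}. \<phi> s j * u t j) = (if s = t then 1 else 0)"
proof -
  have inj: "inj_on u T" and ind: "fvs.independent (u ` T)" using assms(1,2) by (simp_all add: indep_fam_iff)
  let ?B = "fvs.extend_basis (u ` T)"
  have B: "fvs.independent ?B" by (rule fvs.independent_extend_basis[OF ind])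
  have UN: "x \<in> fvs.span ?B" for x using fvs.span_extend_basis[OF ind] by simp
  define \<phi> where "\<phi> s j = fvs.representation ?B (unit_vec j) (u s)" for s j
  have "(\<Sum>j\<in>{1..n}. \<phi> s j * u t j) = (if s = t then 1 else 0)" if st: "s \<in> T" "t \<in> T" for s t
  proof -
    have "fvs.representation ?B (u t) (u s) = fvs.representation ?B (\<Sum>j\<in>{1..n}. fscale (u t j) (unit_vec j)) (u s)"
      using Kpow_expand[OF assms(3)[OF st(2)]] by simp
    also have "\<dots> = (\<Sum>j\<in>{1..n}. u t j * \<phi> s j)"
      unfolding \<phi>_def by (simp add: fvs.representation_sum[OF B UN] fvs.representation_scale[OF B UN])
    finally have "(\<Sum>j\<in>{1..n}. \<phi> s j * u t j) = fvs.representation ?B (u t) (u s)" by (simp add: mult.commute)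
    moreover have "u t \<in> ?B" using fvs.extend_basis_superset[OF ind] st by auto
    ultimately show ?thesis using inj_on_eq_iff[OF inj, of s t] st by (simp add: fvs.representation_basis[OF B])
  qed
  then show ?thesis by (intro exI[of _ \<phi>]) simp
qed

text \<open>Entrywise distance from the identity of the matrix pairing the functionals
  \<open>\<phi>\<close> with the vectors \<open>w\<close>: how far fixed functionals are from being
  dual to a moving family.\<close>

definition defect :: "'t set \<Rightarrow> nat \<Rightarrow> ('t \<Rightarrow> nat \<Rightarrow> 'k::real_normed_field) \<Rightarrow> ('t \<Rightarrow> nat \<Rightarrow> 'k) \<Rightarrow> real" where
  "defect T n \<phi> w = (\<Sum>s\<in>T. \<Sum>t\<in>T. norm ((\<Sum>j\<in>{1..n}. \<phi> s j * w t j) - (if s = t then 1 else 0)))"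

lemma defect_nonneg: "0 \<le> defect T n \<phi> w"
  by (simp add: defect_def sum_nonneg)

text \<open>An estimate in place of a matrix inverse. If \<open>b\<close> lists the functionals at
  \<open>y\<close> and \<open>M\<close> is the pairing matrix, then \<open>b = M c\<close>, so
  \<open>c - b = (1 - M) c\<close> is bounded by the total size of \<open>c\<close> times the
  defect. A defect below 1/2 lets the second bound absorb its last term.\<close>

lemma coeff_bound:
  fixes \<phi> :: "'t \<Rightarrow> nat \<Rightarrow> 'k::real_normed_field"
  assumes fin: "finite T" and y: "y = (\<Sum>t\<in>T. fscale (c t) (w t))"
  shows "s \<in> T \<Longrightarrow> norm (c s - (\<Sum>j\<in>{1..n}. \<phi> s j * y j)) \<le> (\<Sum>t\<in>T. norm (c t)) * defect T n \<phi> w"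
    and "(\<Sum>t\<in>T. norm (c t)) \<le> (\<Sum>s\<in>T. norm (\<Sum>j\<in>{1..n}. \<phi> s j * y j)) + (\<Sum>t\<in>T. norm (c t)) * defect T n \<phi> w"
proof -
  let ?b = "\<lambda>s. \<Sum>j\<in>{1..n}. \<phi> s j * y j"
  let ?M = "\<lambda>s t. \<Sum>j\<in>{1..n}. \<phi> s j * w t j"
  let ?C = "\<Sum>t\<in>T. norm (c t)"
  let ?e = "\<lambda>s. \<Sum>t\<in>T. norm (?M s t - (if s = t then 1 else 0))"
  have row: "norm (c s - ?b s) \<le> ?C * ?e s" if s: "s \<in> T" for s
  proof -
    have "?b s = (\<Sum>j\<in>{1..n}. \<Sum>t\<in>T. c t * (\<phi> s j * w t j))"
      unfolding y by (simp add: sum_fun_apply fscale_apply sum_distrib_left algebra_simps)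
    also have "\<dots> = (\<Sum>t\<in>T. c t * ?M s t)" by (subst sum.swap) (simp add: sum_distrib_left)
    finally have b: "?b s = (\<Sum>t\<in>T. c t * ?M s t)" .
    have "c s = (\<Sum>t\<in>T. c t * (if s = t then 1 else 0))"
      using s fin by (simp add: if_distrib cong: if_cong)
    then have "c s - ?b s = (\<Sum>t\<in>T. c t * (if s = t then 1 else 0)) - (\<Sum>t\<in>T. c t * ?M s t)" using b by metis
    also have "\<dots> = (\<Sum>t\<in>T. c t * ((if s = t then 1 else 0) - ?M s t))"
      by (simp add: sum_subtractf algebra_simps)
    finally have "norm (c s - ?b s) = norm (\<Sum>t\<in>T. c t * ((if s = t then 1 else 0) - ?M s t))" by simp
    also have "\<dots> \<le> (\<Sum>t\<in>T. norm (c t) * norm (?M s t - (if s = t then 1 else 0)))"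
      by (rule sum_norm_le) (simp add: norm_mult norm_minus_commute)
    also have "\<dots> \<le> (\<Sum>t\<in>T. ?C * norm (?M s t - (if s = t then 1 else 0)))"
      using fin by (intro sum_mono mult_right_mono member_le_sum) simp_all
    also have "\<dots> = ?C * ?e s" by (simp add: sum_distrib_left)
    finally show ?thesis .
  qed
  have eps: "defect T n \<phi> w = (\<Sum>s\<in>T. ?e s)" by (simp add: defect_def)
  have C0: "0 \<le> ?C" by (simp add: sum_nonneg)
  show "norm (c s - ?b s) \<le> ?C * defect T n \<phi> w" if s: "s \<in> T"
  proof -
    have "?e s \<le> defect T n \<phi> w" unfolding eps using fin s by (intro member_le_sum[where f = ?e]) (simp_all add: sum_nonneg)
    then show ?thesis using row[OF s] mult_left_mono[OF _ C0] order_trans by blast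
  qed
  have "?C \<le> (\<Sum>s\<in>T. norm (?b s) + norm (c s - ?b s))"
  proof (rule sum_mono)
    fix s show "norm (c s) \<le> norm (?b s) + norm (c s - ?b s)" using norm_triangle_ineq[of "?b s" "c s - ?b s"] by simp
  qed
  also have "\<dots> \<le> (\<Sum>s\<in>T. norm (?b s) + ?C * ?e s)" by (intro sum_mono add_left_mono row)
  also have "\<dots> = (\<Sum>s\<in>T. norm (?b s)) + ?C * defect T n \<phi> w" by (simp add: sum.distrib sum_distrib_left eps)
  finally show "?C \<le> (\<Sum>s\<in>T. norm (?b s)) + ?C * defect T n \<phi> w" .
qed

context
  fixes F :: "'z filter" and T :: "'t set" and w :: "'z \<Rightarrow> 't \<Rightarrow> nat \<Rightarrow> 'k::real_normed_field" and w0 n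
  assumes fin: "finite T" and ind: "indep_fam T w0" and K: "\<And>t. t \<in> T \<Longrightarrow> w0 t \<in> Kpow n"
    and lim: "\<And>t j. t \<in> T \<Longrightarrow> ((\<lambda>z. w z t j) \<longlongrightarrow> w0 t j) F"
begin

lemma eps_tendsto:
  assumes \<phi>: "\<forall>s\<in>T. \<forall>t\<in>T. (\<Sum>j\<in>{1..n}. \<phi> s j * w0 t j) = (if s = t then 1 else 0)"
  shows "((\<lambda>z. defect T n \<phi> (w z)) \<longlongrightarrow> 0) F"
proof -
  have "((\<lambda>z. norm ((\<Sum>j\<in>{1..n}. \<phi> s j * w z t j) - (if s = t then 1 else 0))) \<longlongrightarrow> 0) F" if st: "s \<in> T" "t \<in> T" for s t
  proof -
    have "((\<lambda>z. \<Sum>j\<in>{1..n}. \<phi> s j * w z t j) \<longlongrightarrow> (\<Sum>j\<in>{1..n}. \<phi> s j * w0 t j)) F"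
      by (intro tendsto_sum tendsto_mult tendsto_const lim st)
    then have "((\<lambda>z. \<Sum>j\<in>{1..n}. \<phi> s j * w z t j) \<longlongrightarrow> (if s = t then 1 else 0)) F" using \<phi> st by simp
    then show ?thesis by (simp only: LIM_zero_iff tendsto_norm_zero_iff)
  qed
  then have "((\<lambda>z. \<Sum>s\<in>T. \<Sum>t\<in>T. norm ((\<Sum>j\<in>{1..n}. \<phi> s j * w z t j) - (if s = t then 1 else 0))) \<longlongrightarrow> (\<Sum>s\<in>T. \<Sum>t\<in>T. 0)) F"
    by (intro tendsto_sum)
  then show ?thesis by (simp add: defect_def)
qed

text \<open>Functionals dual to the limit family are almost dual to nearby ones. Once the defect is
  below 1/2, the coefficients of a relation have total size at most half of itself, hence
  zero.\<close>

lemma eventually_indep_fam: "eventually (\<lambda>z. indep_fam T (w z)) F"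
proof -
  obtain \<phi> where \<phi>: "\<forall>s\<in>T. \<forall>t\<in>T. (\<Sum>j\<in>{1..n}. \<phi> s j * w0 t j) = (if s = t then 1 else 0)"
    using dual_functionals[OF fin ind K] by blast
  have "eventually (\<lambda>z. defect T n \<phi> (w z) < 1/2) F"
    by (rule order_tendstoD(2)[OF eps_tendsto[OF \<phi>]]) simp
  then show ?thesis
  proof (rule eventually_mono)
    fix z assume e: "defect T n \<phi> (w z) < 1/2"
    show "indep_fam T (w z)"
      unfolding indep_fam_def
    proof (intro allI impI ballI)
      fix c t assume c: "(\<Sum>t\<in>T. fscale (c t) (w z t)) = 0" and t: "t \<in> T"
      let ?C = "\<Sum>t\<in>T. norm (c t)"
      have "?C \<le> ?C * defect T n \<phi> (w z)" using coeff_bound(2)[OF fin c[symmetric], where n = n and \<phi> = \<phi>] by (simp add: zero_fun_apply)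
      also have "\<dots> \<le> ?C * (1/2)" using e by (intro mult_left_mono) (simp_all add: sum_nonneg)
      finally have "?C = 0" using sum_nonneg[of T "\<lambda>t. norm (c t)"] by simp
      then show "c t = 0" using sum_nonneg_eq_0_iff[OF fin, of "\<lambda>t. norm (c t)"] t by simp
    qed
  qed
qed

text \<open>The functionals dual to the limit family give approximate coefficients
  \<open>b z\<close> that converge to the right limit. The true ones differ from them by at most a
  bounded factor times the defect, which tends to 0.\<close>

lemma coeff_tendsto:
  assumes y: "\<And>j. ((\<lambda>z. y z j) \<longlongrightarrow> y0 j) F"
    and eq: "eventually (\<lambda>z. y z = (\<Sum>t\<in>T. fscale (c z t) (w z t))) F" and eq0: "y0 = (\<Sum>t\<in>T. fscale (c0 t) (w0 t))"
    and s: "s \<in> T"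
  shows "((\<lambda>z. c z s) \<longlongrightarrow> c0 s) F"
proof -
  obtain \<phi> where \<phi>: "\<forall>s\<in>T. \<forall>t\<in>T. (\<Sum>j\<in>{1..n}. \<phi> s j * w0 t j) = (if s = t then 1 else 0)"
    using dual_functionals[OF fin ind K] by blast
  define \<epsilon> where "\<epsilon> z = defect T n \<phi> (w z)" for z
  define b where "b z s = (\<Sum>j\<in>{1..n}. \<phi> s j * y z j)" for z s
  have e0: "(\<epsilon> \<longlongrightarrow> 0) F" using eps_tendsto[OF \<phi>] by (simp add: \<epsilon>_def[abs_def])
  have blim: "((\<lambda>z. b z s) \<longlongrightarrow> (\<Sum>j\<in>{1..n}. \<phi> s j * y0 j)) F" for s
    unfolding b_def by (intro tendsto_sum tendsto_mult tendsto_const y)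
  have c0: "(\<Sum>j\<in>{1..n}. \<phi> s j * y0 j) = c0 s"
  proof -
    have "(\<Sum>j\<in>{1..n}. \<phi> s j * y0 j) = (\<Sum>j\<in>{1..n}. \<Sum>t\<in>T. c0 t * (\<phi> s j * w0 t j))"
      unfolding eq0 by (simp add: sum_fun_apply fscale_apply sum_distrib_left algebra_simps)
    also have "\<dots> = (\<Sum>t\<in>T. c0 t * (\<Sum>j\<in>{1..n}. \<phi> s j * w0 t j))" by (subst sum.swap) (simp add: sum_distrib_left)
    also have "\<dots> = (\<Sum>t\<in>T. if s = t then c0 t else 0)" by (rule sum.cong) (use \<phi> s in auto)
    also have "\<dots> = c0 s" using s fin by simp
    finally show ?thesis .
  qed
  have small: "eventually (\<lambda>z. \<epsilon> z < 1/2) F" by (rule order_tendstoD(2)[OF e0]) simp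
  have bound: "eventually (\<lambda>z. norm (c z s - b z s) \<le> 2 * (\<Sum>t\<in>T. norm (b z t)) * \<epsilon> z) F"
    using eventually_conj[OF small eq]
  proof (rule eventually_mono)
    fix z assume z: "\<epsilon> z < 1/2 \<and> y z = (\<Sum>t\<in>T. fscale (c z t) (w z t))"
    let ?C = "\<Sum>t\<in>T. norm (c z t)"
    have 1: "norm (c z s - b z s) \<le> ?C * \<epsilon> z" and 2: "?C \<le> (\<Sum>t\<in>T. norm (b z t)) + ?C * \<epsilon> z"
      using coeff_bound[OF fin conjunct2[OF z], where \<phi> = \<phi> and n = n] s by (simp_all add: \<epsilon>_def b_def)
    have "?C * \<epsilon> z \<le> ?C * (1/2)" using z by (intro mult_left_mono) (simp_all add: sum_nonneg)
    then have "?C \<le> 2 * (\<Sum>t\<in>T. norm (b z t))" using 2 by simp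
    moreover have "0 \<le> \<epsilon> z" by (simp add: \<epsilon>_def defect_nonneg)
    ultimately have "?C * \<epsilon> z \<le> 2 * (\<Sum>t\<in>T. norm (b z t)) * \<epsilon> z" by (rule mult_right_mono)
    then show "norm (c z s - b z s) \<le> 2 * (\<Sum>t\<in>T. norm (b z t)) * \<epsilon> z" using 1 by simp
  qed
  have "((\<lambda>z. 2 * (\<Sum>t\<in>T. norm (b z t)) * \<epsilon> z) \<longlongrightarrow> 2 * (\<Sum>t\<in>T. norm (\<Sum>j\<in>{1..n}. \<phi> t j * y0 j)) * 0) F"
    by (intro tendsto_mult tendsto_const tendsto_sum tendsto_norm blim e0)
  then have "((\<lambda>z. c z s - b z s) \<longlongrightarrow> 0) F" using Lim_null_comparison[OF bound] by simp
  from tendsto_add[OF this blim[of s]] show ?thesis by (simp only: diff_add_cancel add_0 c0)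
qed

end

lemma VT_coord: "i \<in> {1..m} \<Longrightarrow> continuous_map (VT n m) euclidean (\<lambda>v :: nat \<Rightarrow> nat \<Rightarrow> 'k::real_normed_field. v i j)"
proof -
  assume i: "i \<in> {1..m}"
  have "continuous_map (Kx n) euclidean (\<lambda>x :: nat \<Rightarrow> 'k. x j)"
    by (simp add: continuous_on_subset[OF continuous_on_product_coordinates])
  from continuous_map_compose[OF continuous_map_product_projection[OF i, of "\<lambda>i. Kx n"] this]
  show ?thesis by (simp add: VT_def o_def)
qed

lemma VT_coord_tendsto:
  assumes "i \<in> {1..m}" "v0 \<in> topspace (subtopology (VT n m) A)"
  shows "((\<lambda>v :: nat \<Rightarrow> nat \<Rightarrow> 'k::real_normed_field. v i j) \<longlongrightarrow> v0 i j) (atin (subtopology (VT n m) A) v0)"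
proof -
  have "continuous_map (subtopology (VT n m) A) euclidean (\<lambda>v :: nat \<Rightarrow> nat \<Rightarrow> 'k. v i j)"
    by (rule continuous_map_from_subtopology[OF VT_coord[OF assms(1)]])
  then show ?thesis using assms(2) by (simp add: continuous_map_atin)
qed

text \<open>The filter \<open>atin X x\<close> ignores the point itself, which does no harm since
  \<open>x\<close> is in \<open>S\<close>.\<close>

lemma openin_if_eventually:
  assumes S: "S \<subseteq> topspace X" and ev: "\<And>x. x \<in> S \<Longrightarrow> eventually (\<lambda>y. y \<in> S) (atin X x)"
  shows "openin X S"
proof (subst openin_subopen, intro ballI)
  fix x assume x: "x \<in> S"
  then obtain U where U: "openin X U" "x \<in> U" "\<forall>y\<in>U - {x}. y \<in> S" using ev[OF x] S by (auto simp: eventually_atin)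
  then have "U \<subseteq> S" using x by blast
  then show "\<exists>T. openin X T \<and> x \<in> T \<and> T \<subseteq> S" using U by blast
qed

text \<open>Genericity consists of finitely many independence conditions, and each persists nearby
  by \<open>eventually_indep_fam\<close>.\<close>

lemma openin_generic:
  assumes p: "p \<in> Pset n m"
  shows "openin (VT n m) {v \<in> topspace (VT n m). generic n p (v :: nat \<Rightarrow> nat \<Rightarrow> 'k::real_normed_field)}"
proof (rule openin_if_eventually)
  fix v0 :: "nat \<Rightarrow> nat \<Rightarrow> 'k" assume v0: "v0 \<in> {v \<in> topspace (VT n m). generic n p v}"
  then have v0': "v0 \<in> topspace (VT n m)" by simp
  let ?F = "atin (VT n m) v0"
  have "eventually (\<lambda>v. \<forall>s\<in>{s \<in> summands n p. 2 \<le> rk s}. \<forall>h\<in>{1..rk s + 1}. indep_fam ({1..rk s + 1} - {h}) (\<lambda>x. v (kth (blk s) x))) ?F"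
  proof (intro eventually_ball_finite ballI)
    show "finite {s \<in> summands n p. 2 \<le> rk s}" using finite_summands[OF p] by simp
    fix s h assume s: "s \<in> {s \<in> summands n p. 2 \<le> rk s}" and h: "h \<in> {1..rk s + 1}"
    have sub: "blk s \<subseteq> {1..m}" using blk_subset[OF p] s by simp
    have fin: "finite (blk s)" by (rule finite_subset[OF sub]) simp
    have c: "rk s + 1 \<le> card (blk s)" using rk_cases[OF p, of s] s by simp
    have mem: "kth (blk s) x \<in> {1..m}" if "x \<in> {1..rk s + 1} - {h}" for x
    proof -
      have "kth (blk s) x \<in> blk s" by (rule kth_mem[OF fin]) (use that c in auto)
      then show ?thesis using sub by blast
    qed
    show "eventually (\<lambda>v. indep_fam ({1..rk s + 1} - {h}) (\<lambda>x. v (kth (blk s) x))) ?F"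
    proof (rule eventually_indep_fam[where ?w0.0 = "\<lambda>x. v0 (kth (blk s) x)" and n = n])
      show "indep_fam ({1..rk s + 1} - {h}) (\<lambda>x. v0 (kth (blk s) x))"
        using v0 s h unfolding generic_def generic_at_def by simp
      fix x j assume x: "x \<in> {1..rk s + 1} - {h}"
      show "v0 (kth (blk s) x) \<in> Kpow n" by (rule vecsD(1)[OF VT_vecs[OF v0'] mem[OF x]])
      show "((\<lambda>v. v (kth (blk s) x) j) \<longlongrightarrow> v0 (kth (blk s) x) j) ?F"
        using VT_coord_tendsto[OF mem[OF x], of v0 n UNIV j] v0' by simp
    qed simp
  qed simp
  then have "eventually (\<lambda>v. generic n p v) ?F"
    by (rule eventually_mono) (simp add: generic_def generic_at_def)
  moreover have "eventually (\<lambda>v. v \<in> topspace (VT n m)) ?F"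
    using v0 by (auto simp: eventually_atin intro!: exI[of _ "topspace (VT n m)"])
  ultimately show "eventually (\<lambda>v. v \<in> {v \<in> topspace (VT n m). generic n p v}) ?F"
    by eventually_elim simp
qed auto

text \<open>Throughout \<open>A\<close> the vectors defining \<open>coef\<close> are independent and
  span the block, so the expansion holds at all points near \<open>v0\<close> in \<open>A\<close>
  and \<open>coeff_tendsto\<close> applies.\<close>

lemma continuous_map_coef:
  fixes A :: "(nat \<Rightarrow> nat \<Rightarrow> 'k::real_normed_field) set"
  assumes A: "\<And>v. v \<in> A \<Longrightarrow> generic_at v K r \<and> fvs.dim (spn v K) = r"
    and K: "finite K" "r + 1 \<le> card K" "K \<subseteq> {1..m}" and i: "i \<in> K" and x: "x \<in> {1..r}"
  shows "continuous_map (subtopology (VT n m) A) euclidean (\<lambda>v. coef v K r i x)"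
  unfolding continuous_map_atin
proof
  fix v0 assume v0: "v0 \<in> topspace (subtopology (VT n m) A)"
  then have v0': "v0 \<in> topspace (VT n m)" "v0 \<in> A" by simp_all
  let ?F = "atin (subtopology (VT n m) A) v0"
  have mem: "kth K t \<in> {1..m}" if "t \<in> {1..r}" for t
  proof -
    have "kth K t \<in> K" by (rule kth_mem[OF K(1)]) (use that K(2) in auto)
    then show ?thesis using K(3) by blast
  qed
  have im: "i \<in> {1..m}" using i K(3) by blast
  have eq: "v i = (\<Sum>t\<in>{1..r}. fscale (coef v K r i t) (v (kth K t)))" if "v \<in> A" for v
    using coef(2)[OF _ K(1,2) _ i, of v] A[OF that] by simp
  have "((\<lambda>v. coef v K r i x) \<longlongrightarrow> coef v0 K r i x) ?F"
  proof (rule coeff_tendsto[where T = "{1..r}" and w = "\<lambda>v t. v (kth K t)" and ?w0.0 = "\<lambda>t. v0 (kth K t)"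
        and n = n and y = "\<lambda>v. v i" and ?y0.0 = "v0 i"])
    show "indep_fam {1..r} (\<lambda>t. v0 (kth K t))"
      by (rule generic_at_indep[OF _ K(1,2)]) (use A[OF v0'(2)] in auto)
    show "v0 (kth K t) \<in> Kpow n" if "t \<in> {1..r}" for t by (rule vecsD(1)[OF VT_vecs[OF v0'(1)] mem[OF that]])
    show "((\<lambda>v. v (kth K t) j) \<longlongrightarrow> v0 (kth K t) j) ?F" if "t \<in> {1..r}" for t j
      by (rule VT_coord_tendsto[OF mem[OF that] v0])
    show "((\<lambda>v. v i j) \<longlongrightarrow> v0 i j) ?F" for j by (rule VT_coord_tendsto[OF im v0])
    have "eventually (\<lambda>v. v \<in> A) ?F"
      using v0 by (auto simp: eventually_atin intro!: exI[of _ "topspace (subtopology (VT n m) A)"])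
    then show "eventually (\<lambda>v. v i = (\<Sum>t\<in>{1..r}. fscale (coef v K r i t) (v (kth K t)))) ?F"
      by (rule eventually_mono) (rule eq)
    show "v0 i = (\<Sum>t\<in>{1..r}. fscale (coef v0 K r i t) (v0 (kth K t)))" by (rule eq[OF v0'(2)])
  qed (use x in simp_all)
  then show "limitin euclidean (\<lambda>v. coef v K r i x) (coef v0 K r i x) ?F" by simp
qed

section \<open>Density of the circuit condition among tuples of a fixed type\<close>

section \<open>Perturbation into general position\<close>

lemma open_line_through:
  fixes a b :: "nat \<Rightarrow> 'k::real_normed_field"
  assumes "open U" "a \<in> U"
  obtains t where "t \<noteq> 0" "a + fscale t b \<in> U"
proof -
  let ?g = "\<lambda>t. a + fscale t b"
  have "continuous_on UNIV ?g"
  proof (rule continuous_on_coordinatewise_then_product)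
    fix i
    have "continuous_on UNIV (\<lambda>t. a i + t * b i)" by (intro continuous_intros)
    then show "continuous_on UNIV (\<lambda>t. (a + fscale t b) i)" by (simp add: plus_fun_apply fscale_apply)
  qed
  then have "open (?g -` U)" using assms(1) open_vimage by blast
  moreover have "0 \<in> ?g -` U" using assms(2) by simp
  ultimately obtain e where e: "e > 0" "ball 0 e \<subseteq> ?g -` U" unfolding open_contains_ball by blast
  \<comment> \<open>A nonzero scalar of norm below the radius \<open>e\<close>; this is what makes
    arbitrarily small moves possible over the field.\<close>
  let ?t = "of_real (e/2) :: 'k"
  have "norm ?t = e/2" using e(1) by (simp only: norm_of_real)
  then have "?t \<in> ball 0 e" using e(1) by (simp add: dist_norm)
  then have "?g ?t \<in> U" using e(2) by blast
  moreover have "?t \<noteq> 0" using e(1) by simp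
  ultimately show ?thesis using that by blast
qed

text \<open>If \<open>h \<le> r\<close> is removed, the last vector stays outside the span of the
  remaining ones because its coefficient \<open>d h\<close> is nonzero.\<close>

lemma circuit_indep:
  fixes r :: nat
  assumes ind: "indep_fam {1..r} u" and last: "u (r + 1) = (\<Sum>t\<in>{1..r}. fscale (d t) (u t))"
    and nz: "\<And>t. t \<in> {1..r} \<Longrightarrow> d t \<noteq> 0" and h: "h \<in> {1..r + 1}"
  shows "indep_fam ({1..r + 1} - {h}) u"
proof (cases "h = r + 1")
  case True
  then have "{1..r + 1} - {h} = {1..r}" by auto
  then show ?thesis using ind by simp
next
  case False
  have hr: "h \<in> {1..r}" using h False by auto
  have e: "{1..r + 1} - {h} = insert (r + 1) ({1..r} - {h})" using hr by auto
  show ?thesis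
    unfolding e
  proof (rule indep_fam_insert)
    show "indep_fam ({1..r} - {h}) u" by (rule indep_fam_subset[OF ind]) auto
    show "u (r + 1) \<notin> spn u ({1..r} - {h})"
    proof
      assume "u (r + 1) \<in> spn u ({1..r} - {h})"
      then obtain c where c: "u (r + 1) = (\<Sum>t\<in>{1..r} - {h}. fscale (c t) (u t))"
        by (rule span_famE[OF finite_Diff[OF finite_atLeastAtMost]])
      also have "\<dots> = (\<Sum>t\<in>{1..r}. fscale (if t = h then 0 else c t) (u t))"
        by (rule sum.mono_neutral_cong_left) auto
      finally have "(\<Sum>t\<in>{1..r}. fscale (d t) (u t)) = (\<Sum>t\<in>{1..r}. fscale (if t = h then 0 else c t) (u t))"
        using last by simp
      from indep_fam_coeffs_eq[OF ind this hr] nz[OF hr] show False by simp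
    qed
  qed simp
qed

text \<open>Fewer than \<open>r\<close> vectors do not span \<open>W\<close>, so there is a
  direction \<open>b\<close> in \<open>W\<close> off their span. A small multiple of it moves the
  next vector off the span without leaving \<open>W\<close>.\<close>

lemma perturb_independent:
  fixes x :: "nat \<Rightarrow> nat \<Rightarrow> 'k::real_normed_field"
  assumes W: "fin_dim W" "fvs.dim W = r" and x: "\<And>t. t \<in> {1..r} \<Longrightarrow> x t \<in> W \<and> open (U t) \<and> x t \<in> U t"
  shows "k \<le> r \<Longrightarrow> \<exists>y. (\<forall>t\<in>{1..k}. y t \<in> U t \<inter> W) \<and> indep_fam {1..k} y"
proof (induction k)
  case 0
  show ?case by (simp add: indep_fam_def)
next
  case (Suc k)
  then obtain y where y: "\<forall>t\<in>{1..k}. y t \<in> U t \<inter> W" "indep_fam {1..k} y" by auto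
  have sW: "fvs.subspace W" by (rule fin_dim_subspace[OF W(1)])
  have yW: "spn y {1..k} \<subseteq> W" by (rule fvs.span_minimal[OF _ sW]) (use y(1) in auto)
  have "fvs.dim (spn y {1..k}) = k" using dim_span_indep_fam[OF _ y(2)] by simp
  then have "spn y {1..k} \<noteq> W" using W(2) Suc.prems by auto
  then obtain b where b: "b \<in> W" "b \<notin> spn y {1..k}" using yW by auto
  have xk: "x (Suc k) \<in> W" "open (U (Suc k))" "x (Suc k) \<in> U (Suc k)" using x[of "Suc k"] Suc.prems by simp_all
  have "\<exists>z. z \<in> U (Suc k) \<inter> W \<and> z \<notin> spn y {1..k}"
  proof (cases "x (Suc k) \<in> spn y {1..k}")
    case True
    obtain t where t: "t \<noteq> 0" "x (Suc k) + fscale t b \<in> U (Suc k)" by (rule open_line_through[OF xk(2,3)])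
    have "x (Suc k) + fscale t b \<notin> spn y {1..k}"
    proof
      assume "x (Suc k) + fscale t b \<in> spn y {1..k}"
      from fvs.span_diff[OF this True] have "fscale t b \<in> spn y {1..k}" by simp
      from fvs.span_scale[OF this, of "inverse t"] show False using t(1) b(2) by simp
    qed
    moreover have "x (Suc k) + fscale t b \<in> W" by (intro fvs.subspace_add[OF sW] fvs.subspace_scale[OF sW] xk b)
    ultimately show ?thesis using t(2) by blast
  next
    case False then show ?thesis using xk by blast
  qed
  then obtain z where z: "z \<in> U (Suc k) \<inter> W" "z \<notin> spn y {1..k}" by blast
  let ?y = "y(Suc k := z)"
  have eq: "\<And>t. t \<in> {1..k} \<Longrightarrow> ?y t = y t" by auto
  have im: "?y ` {1..k} = y ` {1..k}" by (rule image_cong[OF refl eq])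
  have "indep_fam {1..k} ?y" using y(2) indep_fam_cong[of "{1..k}" ?y y, OF eq] by simp
  then have "indep_fam (insert (Suc k) {1..k}) ?y" by (rule indep_fam_insert) (use z im in simp_all)
  moreover have "insert (Suc k) {1..k} = {1..Suc k}" by auto
  moreover have "\<forall>t\<in>{1..Suc k}. ?y t \<in> U t \<inter> W" using y(1) z(1) by (auto simp: le_Suc_eq)
  ultimately show ?case by (intro exI[of _ ?y]) (simp only: simp_thms)
qed

text \<open>Once the first \<open>r\<close> vectors form a basis of \<open>W\<close>, the last one
  only has to be moved until none of its coordinates is zero.\<close>

lemma perturb_generic:
  fixes x :: "nat \<Rightarrow> nat \<Rightarrow> 'k::real_normed_field"
  assumes W: "fin_dim W" "fvs.dim W = r" and x: "\<And>t. t \<in> {1..r + 1} \<Longrightarrow> x t \<in> W \<and> open (U t) \<and> x t \<in> U t"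
  shows "\<exists>y. (\<forall>t\<in>{1..r + 1}. y t \<in> U t \<inter> W) \<and> (\<forall>h\<in>{1..r + 1}. indep_fam ({1..r + 1} - {h}) y)"
proof -
  have sW: "fvs.subspace W" by (rule fin_dim_subspace[OF W(1)])
  have "\<exists>y. (\<forall>t\<in>{1..r}. y t \<in> U t \<inter> W) \<and> indep_fam {1..r} y"
    by (rule perturb_independent[OF W, where x = x]) (use x in simp_all)
  then obtain y where y: "\<forall>t\<in>{1..r}. y t \<in> U t \<inter> W" "indep_fam {1..r} y" by blast
  have "spn y {1..r} = W" by (rule indep_fam_spans[OF W(1) y(2)]) (use y(1) W(2) in auto)
  moreover have xr: "x (r + 1) \<in> W" "open (U (r + 1))" "x (r + 1) \<in> U (r + 1)" using x[of "r + 1"] by simp_all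
  ultimately obtain c where c: "x (r + 1) = (\<Sum>t\<in>{1..r}. fscale (c t) (y t))"
    using span_famE[OF finite_atLeastAtMost, of "x (r + 1)" y 1 r] by blast
  \<comment> \<open>Adding \<open>s\<close> times this vector changes just the zero coefficients,
    turning each of them into \<open>s\<close>.\<close>
  define b where "b = (\<Sum>t\<in>{1..r}. fscale (if c t = 0 then 1 else 0) (y t))"
  obtain s where s: "s \<noteq> 0" "x (r + 1) + fscale s b \<in> U (r + 1)" by (rule open_line_through[OF xr(2,3)])
  let ?z = "x (r + 1) + fscale s b"
  let ?d = "\<lambda>t. if c t = 0 then s else c t"
  have z: "?z = (\<Sum>t\<in>{1..r}. fscale (?d t) (y t))"
    unfolding c b_def fvs.scale_sum_right sum.distrib[symmetric] by (rule sum.cong) simp_all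
  have "?z \<in> W" unfolding z by (intro fvs.subspace_sum[OF sW] fvs.subspace_scale[OF sW]) (use y(1) in auto)
  let ?y = "y(r + 1 := ?z)"
  have eq: "\<And>t. t \<in> {1..r} \<Longrightarrow> ?y t = y t" by auto
  have "indep_fam {1..r} ?y" using y(2) indep_fam_cong[of "{1..r}" ?y y, OF eq] by simp
  moreover have "?y (r + 1) = (\<Sum>t\<in>{1..r}. fscale (?d t) (?y t))"
    unfolding fun_upd_same z by (rule sum.cong) auto
  ultimately have "indep_fam ({1..r + 1} - {h}) ?y" if "h \<in> {1..r + 1}" for h
    by (rule circuit_indep) (use s(1) that in auto)
  moreover have "\<forall>t\<in>{1..r + 1}. ?y t \<in> U t \<inter> W" using y(1) s(2) \<open>?z \<in> W\<close> by (auto simp: le_Suc_eq)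
  ultimately show ?thesis by (intro exI[of _ ?y]) simp
qed

text \<open>Only the first \<open>rk s + 1\<close> vectors of the blocks of rank at least 2 are
  moved, each inside the span of its block. The block spans stay the same, hence so do ranks and
  separation, while connectedness of the moved blocks follows from genericity.\<close>

lemma generic_dense:
  fixes v :: "nat \<Rightarrow> nat \<Rightarrow> 'k::real_normed_field"
  assumes p: "p \<in> Pset n m" and v: "v \<in> topspace (VT n m)" and bt: "btype n m p v"
    and N: "openin (VT n m) N" "v \<in> N"
  shows "\<exists>v'\<in>N. btype n m p v' \<and> generic n p v'"
proof -
  let ?S = "summands n p"
  note vv = VT_vecs[OF v]
  have "\<forall>x\<in>N. \<exists>B. finite {i \<in> {1..m}. B i \<noteq> topspace (Kx n)} \<and> (\<forall>i\<in>{1..m}. openin (Kx n) (B i))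
      \<and> x \<in> Pi\<^sub>E {1..m} B \<and> Pi\<^sub>E {1..m} B \<subseteq> N"
    using N(1) unfolding VT_def openin_product_topology_alt .
  from bspec[OF this N(2)] obtain O' where O': "\<forall>i\<in>{1..m}. openin (Kx n) (O' i)" "v \<in> Pi\<^sub>E {1..m} O'" "Pi\<^sub>E {1..m} O' \<subseteq> N" by (elim exE conjE)
  have "\<forall>i\<in>{1..m}. \<exists>T. open T \<and> O' i = (Kpow n - {0}) \<inter> T" using O'(1) by (simp add: openin_open)
  from bchoice[OF this] obtain U where U: "\<forall>i\<in>{1..m}. open (U i) \<and> O' i = (Kpow n - {0}) \<inter> U i" by (elim exE)
  have vU: "v i \<in> U i" if "i \<in> {1..m}" for i using O'(2) U that by (auto simp: PiE_iff)
  have sub: "blk s \<subseteq> {1..m}" if "s \<in> ?S" for s by (rule blk_subset[OF p that])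
  have fin: "finite (blk s)" if "s \<in> ?S" for s by (rule finite_subset[OF sub[OF that]]) simp
  have spK: "spn v (blk s) \<subseteq> Kpow n" if "s \<in> ?S" for s
    by (rule spn_subset[OF subspace_Kpow]) (use vecsD(1)[OF vv subsetD[OF sub[OF that]]] in blast)
  have dim: "fvs.dim (spn v (blk s)) = rk s" if "s \<in> ?S" "blk s \<noteq> {}" for s
    using bt that unfolding btype_def by simp
  have "\<exists>y. (\<forall>t\<in>{1..rk s + 1}. y t \<in> U (kth (blk s) t) \<inter> spn v (blk s)) \<and>
      (\<forall>h\<in>{1..rk s + 1}. indep_fam ({1..rk s + 1} - {h}) y)" if s: "s \<in> ?S" "2 \<le> rk s" for s
  proof (rule perturb_generic[OF fin_dim_spn[OF fin[OF s(1)]], where x = "\<lambda>t. v (kth (blk s) t)"])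
    have c: "rk s + 1 \<le> card (blk s)" using rk_cases[OF p s(1)] s(2) by simp
    then show "fvs.dim (spn v (blk s)) = rk s" using dim[OF s(1)] by fastforce
    fix t assume "t \<in> {1..rk s + 1}"
    then have k: "kth (blk s) t \<in> blk s" using c by (intro kth_mem[OF fin[OF s(1)]]) simp
    then have "kth (blk s) t \<in> {1..m}" using sub[OF s(1)] by blast
    then show "v (kth (blk s) t) \<in> spn v (blk s) \<and> open (U (kth (blk s) t)) \<and> v (kth (blk s) t) \<in> U (kth (blk s) t)"
      using spn_mem[OF k, of v] U vU by simp
  qed
  then have "\<forall>s\<in>{s \<in> ?S. 2 \<le> rk s}. \<exists>y. (\<forall>t\<in>{1..rk s + 1}. y t \<in> U (kth (blk s) t) \<inter> spn v (blk s)) \<and>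
      (\<forall>h\<in>{1..rk s + 1}. indep_fam ({1..rk s + 1} - {h}) y)" by simp
  from bchoice[OF this] obtain y where y: "\<forall>s\<in>{s \<in> ?S. 2 \<le> rk s}. (\<forall>t\<in>{1..rk s + 1}. y s t \<in> U (kth (blk s) t) \<inter> spn v (blk s)) \<and>
      (\<forall>h\<in>{1..rk s + 1}. indep_fam ({1..rk s + 1} - {h}) (y s))" by (elim exE)
  \<comment> \<open>Blocks partition the index set, so the moved tuple can be defined index by index
    through the unique summand containing the index.\<close>
  define summand_of where "summand_of i = (THE s. s \<in> ?S \<and> i \<in> blk s)" for i
  have so: "summand_of i = s" if "s \<in> ?S" "i \<in> blk s" for s i
    unfolding summand_of_def by (rule the_equality) (use that summands_disjoint[OF p] in auto)
  define v' where "v' = (\<lambda>i\<in>{1..m}. let s = summand_of i; x = index_in (blk s) i in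
    if 2 \<le> rk s \<and> x \<le> rk s + 1 then y s x else v i)"
  have v's: "v' i = (if 2 \<le> rk s \<and> index_in (blk s) i \<le> rk s + 1 then y s (index_in (blk s) i) else v i)"
    if s: "s \<in> ?S" "i \<in> blk s" for s i
  proof -
    have "i \<in> {1..m}" using sub[OF s(1)] s(2) by auto
    then show ?thesis by (simp add: v'_def so[OF s] Let_def)
  qed
  have small: "v' i \<in> U i \<and> v' i \<in> spn v (blk s) \<and> v' i \<noteq> 0" if s: "s \<in> ?S" "i \<in> blk s" for s i
  proof (cases "2 \<le> rk s \<and> index_in (blk s) i \<le> rk s + 1")
    case True
    let ?x = "index_in (blk s) i"
    have x: "?x \<in> {1..rk s + 1}" using index_in_mem[OF fin[OF s(1)] s(2)] True by simp
    have e: "v' i = y s ?x" using v's[OF s] True by simp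
    have ys: "(\<forall>t\<in>{1..rk s + 1}. y s t \<in> U (kth (blk s) t) \<inter> spn v (blk s)) \<and>
      (\<forall>h\<in>{1..rk s + 1}. indep_fam ({1..rk s + 1} - {h}) (y s))" using y s(1) True by simp
    have "y s ?x \<in> U i \<inter> spn v (blk s)"
      using bspec[OF conjunct1[OF ys] x] kth_index_in[OF fin[OF s(1)] s(2)] by simp
    moreover have "y s ?x \<noteq> 0"
    proof
      assume z: "y s ?x = 0"
      \<comment> \<open>A position different from \<open>?x\<close>: removing it leaves
        \<open>?x\<close> in an independent family, so the vector there is nonzero.\<close>
      define h where "h = (if ?x = 1 then 2 else 1 :: nat)"
      have h: "h \<in> {1..rk s + 1}" "?x \<in> {1..rk s + 1} - {h}" using x True by (auto simp: h_def)
      have i: "indep_fam ({1..rk s + 1} - {h}) (y s)" using conjunct2[OF ys] h(1) by blast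
      have "indep_fam {?x} (y s)" by (rule indep_fam_subset[OF i]) (use h in auto)
      then show False using z indep_famD[of "{?x}" "y s" "\<lambda>_. 1" ?x] by simp
    qed
    ultimately show ?thesis using e by simp
  next
    case False
    have i: "i \<in> {1..m}" using sub[OF s(1)] s(2) by auto
    have "v' i = v i" using v's[OF s] False by auto
    then show ?thesis using vU[OF i] spn_mem[OF s(2), of v] vecsD(2)[OF vv i] by simp
  qed
  have "v' \<in> Pi\<^sub>E {1..m} O'"
  proof (rule PiE_I)
    fix i assume i: "i \<in> {1..m}"
    then obtain s where s: "s \<in> ?S" "i \<in> blk s" using summands_cover[OF p] by blast
    have "v' i \<in> Kpow n" using small[OF s] spK[OF s(1)] by blast
    then show "v' i \<in> O' i" using small[OF s] U i by simp
  next
    fix i assume "i \<notin> {1..m}"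
    then show "v' i = undefined" unfolding v'_def restrict_def by (rule if_not_P)
  qed
  then have v'N: "v' \<in> N" using O'(3) by blast
  have gen_s: "generic_at v' (blk s) (rk s)" if s: "s \<in> ?S" "2 \<le> rk s" for s
    unfolding generic_at_def
  proof
    fix h assume h: "h \<in> {1..rk s + 1}"
    have c: "rk s + 1 \<le> card (blk s)" using rk_cases[OF p s(1)] s(2) by simp
    have e: "v' (kth (blk s) x) = y s x" if "x \<in> {1..rk s + 1} - {h}" for x
    proof -
      have x: "x \<in> {1..card (blk s)}" using that c by simp
      show ?thesis
        using v's[OF s(1) kth_mem[OF fin[OF s(1)] x]] index_in_kth[OF fin[OF s(1)] x] s(2) that by simp
    qed
    have "indep_fam ({1..rk s + 1} - {h}) (y s)" using y s h by simp
    then show "indep_fam ({1..rk s + 1} - {h}) (\<lambda>x. v' (kth (blk s) x))"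
      using indep_fam_cong[of "{1..rk s + 1} - {h}" "\<lambda>x. v' (kth (blk s) x)" "y s", OF e] by simp
  qed
  \<comment> \<open>Here \<open>A\<close> is a union of blocks; this is applied to a single block
    and to the complement of one.\<close>
  have sp_sub: "spn v' A \<subseteq> spn v A" if A: "\<And>i. i \<in> A \<Longrightarrow> \<exists>s\<in>?S. i \<in> blk s \<and> blk s \<subseteq> A" for A
  proof (rule fvs.span_minimal)
    show "v' ` A \<subseteq> spn v A"
    proof (rule image_subsetI)
      fix i assume "i \<in> A"
      then obtain s where s: "s \<in> ?S" "i \<in> blk s" "blk s \<subseteq> A" using A by blast
      then show "v' i \<in> spn v A" using small[OF s(1,2)] spn_mono[OF s(3), of v] by blast
    qed
  qed simp
  have eq: "spn v' (blk s) = spn v (blk s)" if s: "s \<in> ?S" for s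
  proof (cases "2 \<le> rk s")
    case False
    then have "v' i = v i" if "i \<in> blk s" for i using v's[OF s that] by auto
    then have "v' ` blk s = v ` blk s" by (rule image_cong[OF refl])
    then show ?thesis by simp
  next
    case True
    have c: "rk s + 1 \<le> card (blk s)" using rk_cases[OF p s] True by simp
    then have ne: "blk s \<noteq> {}" by auto
    have sub': "spn v' (blk s) \<subseteq> spn v (blk s)" by (rule sp_sub) (use s in blast)
    let ?w = "\<lambda>x. v' (kth (blk s) x)"
    have T: "{1..rk s + 1} - {rk s + 1} = {1..rk s}" by auto
    have ind: "indep_fam {1..rk s} ?w"
      using gen_s[OF s True] T unfolding generic_at_def by (metis atLeastAtMost_iff le_add2 order_refl)
    have im: "?w ` {1..rk s} \<subseteq> v' ` blk s"
    proof (rule image_subsetI)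
      fix x assume "x \<in> {1..rk s}"
      then show "?w x \<in> v' ` blk s" using c by (intro imageI kth_mem[OF fin[OF s]]) simp
    qed
    have "spn ?w {1..rk s} \<subseteq> spn v' (blk s)" by (rule fvs.span_mono[OF im])
    moreover have "spn ?w {1..rk s} = spn v (blk s)"
    proof (rule indep_fam_spans[OF fin_dim_spn[OF fin[OF s]] ind])
      show "?w ` {1..rk s} \<subseteq> spn v (blk s)" using im sub' fvs.span_superset[of "v' ` blk s"] by blast
      show "fvs.dim (spn v (blk s)) \<le> card {1..rk s}" using dim[OF s ne] by simp
    qed simp
    ultimately show ?thesis using sub' by simp
  qed
  have "btype n m p v'"
    unfolding btype_def
  proof (intro ballI impI conjI)
    fix s assume s: "s \<in> ?S" and ne: "blk s \<noteq> {}"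
    show d: "fvs.dim (spn v' (blk s)) = rk s" using eq[OF s] dim[OF s ne] by simp
    show "conn v' (blk s)"
    proof (cases "2 \<le> rk s")
      case True
      have c: "rk s + 1 \<le> card (blk s)" using rk_cases[OF p s] True by simp
      show ?thesis
        by (rule generic_at_conn[OF gen_s[OF s True] fin[OF s] c]) (use d small[OF s] in simp_all)
    next
      case False
      then have "v' i = v i" if "i \<in> blk s" for i using v's[OF s that] by auto
      then have "conn v' (blk s) \<longleftrightarrow> conn v (blk s)" by (intro conn_cong) simp
      then show ?thesis using bt s ne unfolding btype_def by simp
    qed
    have "spn v' ({1..m} - blk s) \<subseteq> spn v ({1..m} - blk s)"
    proof (rule sp_sub)
      fix i assume i: "i \<in> {1..m} - blk s"
      then obtain t where t: "t \<in> ?S" "i \<in> blk t" using summands_cover[OF p, of i] by blast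
      have "blk t \<inter> blk s = {}"
      proof (rule ccontr)
        assume "blk t \<inter> blk s \<noteq> {}"
        then obtain j where "j \<in> blk t" "j \<in> blk s" by blast
        then have "t = s" by (rule summands_disjoint[OF p t(1) s])
        then show False using t i by simp
      qed
      then show "\<exists>t\<in>?S. i \<in> blk t \<and> blk t \<subseteq> {1..m} - blk s" using t sub[OF t(1)] by blast
    qed
    moreover have "spn v (blk s) \<inter> spn v ({1..m} - blk s) \<subseteq> {0}" using bt s ne unfolding btype_def by simp
    ultimately show "spn v' (blk s) \<inter> spn v' ({1..m} - blk s) \<subseteq> {0}" unfolding eq[OF s] by (meson Int_mono order_refl subset_trans)
  qed
  moreover have "generic n p v'" unfolding generic_def using gen_s by simp
  ultimately show ?thesis using v'N by (intro bexI[of _ v']) simp_all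
qed

section \<open>Descent from vector tuples to the embedding of the parameter space\<close>

section \<open>The parametrisation of a fibre\<close>

text \<open>Here \<open>t\<close> computes the inverse of \<open>e\<close> upstairs, on the generic
  part of the full preimage \<open>S\<close> of the fibre. Continuity of \<open>t\<close> makes
  \<open>e\<close> open onto its image, because \<open>\<Theta>\<close> is open and \<open>S\<close>
  is saturated; density descends because \<open>\<Theta>\<close> is continuous and
  surjective.\<close>

lemma open_dense_embedding_from_cover:
  assumes \<Theta>: "continuous_map V Y \<Theta>" "open_map V Y \<Theta>" "\<Theta> ` topspace V = topspace Y"
    and fib: "fib \<subseteq> topspace Y" and S: "S = {v \<in> topspace V. \<Theta> v \<in> fib}"
    and e: "continuous_map X Y e" and G: "openin V G" and t: "continuous_map (subtopology V (S \<inter> G)) X t"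
    and et: "\<And>v. v \<in> S \<inter> G \<Longrightarrow> \<Theta> v = e (t v)"
    and te: "\<And>q v. q \<in> topspace X \<Longrightarrow> v \<in> topspace V \<Longrightarrow> \<Theta> v = e q \<Longrightarrow> v \<in> S \<inter> G \<and> t v = q"
    and dense: "\<And>v N. v \<in> S \<Longrightarrow> openin V N \<Longrightarrow> v \<in> N \<Longrightarrow> N \<inter> (S \<inter> G) \<noteq> {}"
  shows "open_dense_embedding X (subtopology Y fib) e"
proof -
  have GV: "G \<subseteq> topspace V" by (rule openin_subset[OF G])
  have eY: "e q \<in> topspace Y" if "q \<in> topspace X" for q
    using continuous_map_image_subset_topspace[OF e] that by blast
  have lift: "\<exists>v. v \<in> S \<inter> G \<and> \<Theta> v = e q \<and> t v = q" if q: "q \<in> topspace X" for q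
  proof -
    have "e q \<in> \<Theta> ` topspace V" using eY[OF q] \<Theta>(3) by simp
    then obtain v where "v \<in> topspace V" "\<Theta> v = e q" by auto
    then show ?thesis using te[OF q, of v] by (intro exI[of _ v]) simp
  qed
  have tX: "t v \<in> topspace X" if "v \<in> S \<inter> G" for v
    using continuous_map_image_subset_topspace[OF t] that S by auto
  have img: "e ` W = \<Theta> ` {v \<in> S \<inter> G. t v \<in> W}" if W: "W \<subseteq> topspace X" for W
  proof
    show "e ` W \<subseteq> \<Theta> ` {v \<in> S \<inter> G. t v \<in> W}"
    proof (rule image_subsetI)
      fix q assume q: "q \<in> W"
      from lift[OF subsetD[OF W q]] obtain v where v: "v \<in> S \<inter> G" "\<Theta> v = e q" "t v = q" by (elim exE conjE)
      then have "v \<in> {v \<in> S \<inter> G. t v \<in> W}" using q by simp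
      then show "e q \<in> \<Theta> ` {v \<in> S \<inter> G. t v \<in> W}" unfolding v(2)[symmetric] by (rule imageI)
    qed
    show "\<Theta> ` {v \<in> S \<inter> G. t v \<in> W} \<subseteq> e ` W"
    proof (rule image_subsetI)
      fix v assume "v \<in> {v \<in> S \<inter> G. t v \<in> W}"
      then show "\<Theta> v \<in> e ` W" using et[of v] by simp
    qed
  qed
  have efib: "e ` topspace X \<subseteq> fib"
    unfolding img[OF order_refl] using S by auto
  have ec: "continuous_map X (subtopology Y fib) e"
    by (rule continuous_map_into_subtopology[OF e]) (use efib in auto)
  have opn: "openin (subtopology Y fib) (e ` W)" if W: "openin X W" for W
  proof -
    have WX: "W \<subseteq> topspace X" by (rule openin_subset[OF W])
    have "openin (subtopology V (S \<inter> G)) {v \<in> topspace (subtopology V (S \<inter> G)). t v \<in> W}"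
      by (rule openin_continuous_map_preimage[OF t W])
    then obtain A where A: "openin V A" "{v \<in> topspace (subtopology V (S \<inter> G)). t v \<in> W} = A \<inter> (S \<inter> G)"
      by (auto simp: openin_subtopology)
    have A': "{v \<in> S \<inter> G. t v \<in> W} = A \<inter> (S \<inter> G)" using A(2) GV by auto
    \<comment> \<open>Saturation of \<open>S\<close> is used here: a point of
      \<open>A \<inter> G\<close> is mapped into \<open>fib\<close> only if it lies in
      \<open>S\<close>.\<close>
    have "e ` W = \<Theta> ` (A \<inter> G) \<inter> fib"
      unfolding img[OF WX] A' using S openin_subset[OF A(1)] by auto
    moreover have "openin Y (\<Theta> ` (A \<inter> G))" using \<Theta>(2) openin_Int[OF A(1) G] by (simp add: open_map_def)
    ultimately show ?thesis by (auto simp: openin_subtopology)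
  qed
  have inj: "inj_on e (topspace X)"
  proof (rule inj_onI)
    fix q q' assume q: "q \<in> topspace X" "q' \<in> topspace X" "e q = e q'"
    from lift[OF q(1)] obtain v where v: "v \<in> S \<inter> G" "\<Theta> v = e q" "t v = q" by (elim exE conjE)
    have "v \<in> topspace V" using v(1) unfolding S by blast
    from conjunct2[OF te[OF q(2) this trans[OF v(2) q(3)]]] v(3) show "q = q'" by (rule trans[OF sym, rotated])
  qed
  have "embedding_map X (subtopology Y fib) e"
    by (rule injective_open_imp_embedding_map[OF ec _ inj]) (simp add: open_map_def opn)
  moreover have "subtopology Y fib closure_of (e ` topspace X) = topspace (subtopology Y fib)"
  proof
    show "topspace (subtopology Y fib) \<subseteq> subtopology Y fib closure_of (e ` topspace X)"
    proof
      fix w assume w: "w \<in> topspace (subtopology Y fib)"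
      then have "w \<in> \<Theta> ` topspace V" using \<Theta>(3) by simp
      then obtain v where v: "v \<in> topspace V" "w = \<Theta> v" by auto
      have vS: "v \<in> S" using v w S by simp
      have "\<exists>y. y \<in> e ` topspace X \<and> y \<in> T" if T: "w \<in> T" "openin (subtopology Y fib) T" for T
      proof -
        obtain N where N: "openin Y N" "T = N \<inter> fib" using T(2) by (auto simp: openin_subtopology)
        have "openin V {v \<in> topspace V. \<Theta> v \<in> N}" by (rule openin_continuous_map_preimage[OF \<Theta>(1) N(1)])
        moreover have "v \<in> {v \<in> topspace V. \<Theta> v \<in> N}" using v T(1) N(2) by simp
        ultimately have "{v \<in> topspace V. \<Theta> v \<in> N} \<inter> (S \<inter> G) \<noteq> {}" by (rule dense[OF vS])
        then obtain v' where v': "v' \<in> topspace V" "\<Theta> v' \<in> N" "v' \<in> S \<inter> G" by auto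
        have "\<Theta> v' \<in> e ` topspace X" using et[OF v'(3)] tX[OF v'(3)] by simp
        moreover have "\<Theta> v' \<in> T" using v' N(2) S by simp
        ultimately show ?thesis by blast
      qed
      then show "w \<in> subtopology Y fib closure_of (e ` topspace X)" using w by (simp add: in_closure_of)
    qed
  qed (rule closure_of_subset_topspace)
  ultimately show ?thesis using opn[OF openin_topspace] unfolding open_dense_embedding_def by simp
qed

lemma topspace_Params_valid:
  assumes p: "p \<in> Pset n m" and q: "q \<in> topspace (Params p :: (nat set \<times> nat \<Rightarrow> nat \<Rightarrow> (nat \<Rightarrow> 'k::real_normed_field) set) topology)"
  shows "valid_param p q"
proof -
  obtain Is Js Ks where p': "p = (Is, Js, Ks)" by (metis prod_cases3)
  have "q (K, r) h \<in> topspace (Proj r)" if "(K, r) \<in> Ks" "h \<in> {r + 2..card K}" for K r h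
    using q that by (auto simp: Params_def p' PiE_iff Ball_def)
  then show ?thesis unfolding valid_param_def p' by (fastforce simp: topspace_Proj)
qed

text \<open>Normalised coordinates are quotients of continuous coefficients, with denominators that
  are nonzero on generic tuples; the lines they span depend continuously on them.\<close>

lemma continuous_map_qparam:
  fixes A :: "(nat \<Rightarrow> nat \<Rightarrow> 'k::real_normed_field) set"
  assumes p: "p \<in> Pset n m" and A: "\<And>v. v \<in> A \<Longrightarrow> btype n m p v \<and> generic n p v"
  shows "continuous_map (subtopology (VT n m) A) (Params p) (qparam p)"
proof -
  obtain Is Js Ks where p': "p = (Is, Js, Ks)" by (metis prod_cases3)
  have P: "Params p = product_topology (\<lambda>(K, r). product_topology (\<lambda>h. Proj r) {r + 2..card K}) (snd (snd p))"
    by (simp add: Params_def p')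
  let ?X = "subtopology (VT n m) A"
  have line: "continuous_map ?X (Proj r) (\<lambda>v. fvs.span {ncoord v K r (kth K h)})"
    if K: "(K, r) \<in> snd (snd p)" and h: "h \<in> {r + 2..card K}" for K r h
  proof -
    note ps = param_summand[OF p K]
    have c: "r + 1 \<le> card K" using ps(6) by simp
    have gA: "generic_at v K r \<and> fvs.dim (spn v K) = r" if "v \<in> A" for v
      using generic_param[OF p K, of v] A[OF that] by simp
    have i: "kth K h \<in> K" by (rule kth_mem[OF ps(2)]) (use h in auto)
    have l: "kth K (r + 1) \<in> K" by (rule kth_mem[OF ps(2)]) (use c in auto)
    note cc = continuous_map_coef[OF gA ps(2) c ps(3)]
    have nc: "continuous_map ?X euclidean (\<lambda>v. ncoord v K r (kth K h) x)" for x
    proof (cases "x \<in> {1..r}")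
      case True
      have "((\<lambda>v. coef v K r (kth K h) x / coef v K r (kth K (r + 1)) x) \<longlongrightarrow> coef v0 K r (kth K h) x / coef v0 K r (kth K (r + 1)) x) (atin ?X v0)"
        if v0: "v0 \<in> topspace ?X" for v0
      proof (rule tendsto_divide)
        show "((\<lambda>v. coef v K r (kth K h) x) \<longlongrightarrow> coef v0 K r (kth K h) x) (atin ?X v0)"
          using cc[OF _ i True] v0 by (simp add: continuous_map_atin)
        show "((\<lambda>v. coef v K r (kth K (r + 1)) x) \<longlongrightarrow> coef v0 K r (kth K (r + 1)) x) (atin ?X v0)"
          using cc[OF _ l True] v0 by (simp add: continuous_map_atin)
        show "coef v0 K r (kth K (r + 1)) x \<noteq> 0"
          by (rule coef_last_nonzero[OF _ ps(2) c _ True]) (use gA v0 in auto)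
      qed
      then show ?thesis unfolding continuous_map_atin ncoord_def by simp
    next
      case False
      \<comment> \<open>Positions outside \<open>{1..r}\<close> must be treated too, since the
        topology on coordinate vectors is that of all functions on \<open>nat\<close>.\<close>
      have "ncoord v K r (kth K h) x = 0" if "v \<in> topspace ?X" for v
      proof -
        have "ncoord v K r (kth K h) \<in> Kpow r" by (rule ncoord(1)[OF _ ps(2) c _ i]) (use gA that in auto)
        then show ?thesis using False by (auto simp: Kpow_def)
      qed
      then show ?thesis by (intro continuous_map_eq[OF continuous_map_canonical_const[of ?X 0]]) simp
    qed
    have "continuous_map ?X euclidean (\<lambda>v. ncoord v K r (kth K h))"
      using nc by (simp add: euclidean_product_topology[symmetric] continuous_map_componentwise_UNIV)
    moreover have "ncoord v K r (kth K h) \<in> Kpow r - {0}" if v: "v \<in> topspace ?X" for v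
    proof -
      have v': "v \<in> topspace (VT n m)" "v \<in> A" using v by simp_all
      have "kth K h \<in> {1..m}" using i ps(3) by blast
      then have "v (kth K h) \<noteq> 0" by (rule vecsD(2)[OF VT_vecs[OF v'(1)]])
      then show ?thesis using ncoord(1,3)[OF _ ps(2) c _ i, of v] gA[OF v'(2)] by simp
    qed
    ultimately have "continuous_map ?X (Kx r) (\<lambda>v. ncoord v K r (kth K h))"
      by (intro continuous_map_into_subtopology) auto
    from continuous_map_compose[OF this quotient_imp_continuous_map[OF quotient_map_Proj]]
    show ?thesis by (simp add: o_def)
  qed
  show ?thesis
    unfolding P continuous_map_componentwise
  proof (intro conjI ballI)
    show "qparam p ` topspace ?X \<subseteq> extensional (snd (snd p))" by (auto simp: qparam_def)
    fix k assume k: "k \<in> snd (snd p)"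
    obtain K r where kr: "k = (K, r)" by (cases k)
    have "continuous_map ?X (product_topology (\<lambda>h. Proj r) {r + 2..card K}) (\<lambda>v. qparam p v (K, r))"
      unfolding continuous_map_componentwise
    proof (intro conjI ballI)
      show "(\<lambda>v. qparam p v (K, r)) ` topspace ?X \<subseteq> extensional {r + 2..card K}"
        using k kr by (auto simp: qparam_def)
      fix h assume h: "h \<in> {r + 2..card K}"
      have e: "qparam p v (K, r) h = fvs.span {ncoord v K r (kth K h)}" for v :: "nat \<Rightarrow> nat \<Rightarrow> 'k"
        using k kr h by (simp add: qparam_def)
      show "continuous_map ?X (Proj r) (\<lambda>v. qparam p v (K, r) h)"
        unfolding e using line[OF _ h] k kr by simp
    qed
    then show "continuous_map ?X (case k of (K, r) \<Rightarrow> product_topology (\<lambda>h. Proj r) {r + 2..card K}) (\<lambda>v. qparam p v k)"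
      by (simp add: kr)
  qed
qed

lemma whole_Fpq: "whole (Fpq n p q) = bsum (summands n p) (\<lambda>s. Kpow (rk s))"
  unfolding Fpq_alt whole_bigsum by (rule bsum_cong) (rule rep_whole)

lemma subspace_Fpq:
  assumes p: "p \<in> Pset n m" and q: "valid_param p q"
  shows "fvs.subspace (whole (Fpq n p q))" and "i \<in> {1..m} \<Longrightarrow> part (Fpq n p q) i \<subseteq> whole (Fpq n p q)"
proof -
  have "is_mflag m (rep q s)" if "s \<in> summands n p" for s
    using rep_props(2)[OF p q that] by (simp add: has_dim_def)
  then show "fvs.subspace (whole (Fpq n p q))" and "i \<in> {1..m} \<Longrightarrow> part (Fpq n p q) i \<subseteq> whole (Fpq n p q)"
    unfolding Fpq_alt using subspace_whole_bigsum[of n p m "rep q"] by simp_all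
qed

text \<open>The whole space of \<open>Fpq n p q\<close> does not involve \<open>q\<close>, so one
  identification with K^n serves all parameters at once. This is what makes continuity in
  \<open>q\<close> accessible.\<close>

lemma Fpq_identification:
  assumes p: "p \<in> Pset n m"
  shows "\<exists>f. lin_iso f (bsum (summands n p) (\<lambda>s. Kpow (rk s))) (Kpow n :: (nat \<Rightarrow> 'k::field) set)"
proof -
  have "\<exists>u'. (\<forall>t\<in>{}. u' t = (\<lambda>_ _. 0 :: 'k) t) \<and> indep_fam (slots n p) u' \<and> u' ` slots n p \<subseteq> (Kpow n :: (nat \<Rightarrow> 'k) set)"
  proof (rule extend_indep_fam[OF fin_dim_Kpow])
    show "finite (slots n p)" using finite_summands[OF p] by simp
    show "card (slots n p) \<le> fvs.dim (Kpow n :: (nat \<Rightarrow> 'k) set)" using sum_rk[OF p] finite_summands[OF p] by simp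
  qed (simp_all add: indep_fam_def)
  then obtain u :: "summand \<times> nat \<Rightarrow> nat \<Rightarrow> 'k" where u: "indep_fam (slots n p) u" "u ` slots n p \<subseteq> Kpow n"
    by (elim exE conjE)
  have "lin_iso (assemble n p (\<lambda>s x. u (s, x))) (bsum (summands n p) (\<lambda>s. Kpow (rk s))) (Kpow n)"
    by (rule lin_iso_assemble[OF p]) (use u in auto)
  then show ?thesis by (intro exI)
qed

text \<open>For fixed \<open>i\<close> the line is either constant in \<open>q\<close> or one of the
  coordinates of \<open>q\<close>.\<close>

lemma continuous_map_rep_part:
  assumes p: "p \<in> Pset n m" and s: "s \<in> summands n p" and i: "i \<in> blk s"
  shows "continuous_map (Params p) (Proj (rk s))
    (\<lambda>q :: nat set \<times> nat \<Rightarrow> nat \<Rightarrow> (nat \<Rightarrow> 'k::real_normed_field) set. part (rep q s) i)"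
proof (cases "rk s = 1")
  case True
  have "(unit_vec 1 :: nat \<Rightarrow> 'k) \<in> Kpow 1 - {0}" using unit_vec_in_Kpow[of 1 1] unit_vec_nonzero[of 1] by simp
  then have "(Kpow 1 :: (nat \<Rightarrow> 'k) set) \<in> topspace (Proj 1)"
    unfolding topspace_Proj Kpow_1 by (rule imageI)
  then show ?thesis unfolding rep_part_rank1[OF p s i True] True by simp
next
  case False
  have r: "2 \<le> rk s" "rk s + 1 \<le> card (blk s)" using rk_cases[OF p s False] by simp_all
  have fin: "finite (blk s)" by (rule finite_subset[OF blk_subset[OF p s]]) simp
  have ii: "index_in (blk s) i \<in> {1..card (blk s)}" by (rule index_in_mem[OF fin i])
  show ?thesis
  proof (cases "index_in (blk s) i \<le> rk s + 1")
    case True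
    have "(stdframe (rk s) (index_in (blk s) i) :: nat \<Rightarrow> 'k) \<in> Kpow (rk s) - {0}"
      using stdframe_Kpow[of "index_in (blk s) i" "rk s"] stdframe_nonzero[of "rk s" "index_in (blk s) i"] True ii r
      by simp
    then have "fvs.span {stdframe (rk s) (index_in (blk s) i) :: nat \<Rightarrow> 'k} \<in> topspace (Proj (rk s))"
      unfolding topspace_Proj by (rule imageI)
    then show ?thesis unfolding rep_part_frame[OF p s i r(1) True] by simp
  next
    case big: False
    then have "rk s + 1 < card (blk s)" using ii by simp
    then obtain K r where K: "s = Inr (Inr (Inr (K, r)))" "(K, r) \<in> snd (snd p)" "K = blk s" "r = rk s"
      by (rule summand_param[OF p s r(1)])
    have h: "index_in K i \<in> {r + 2..card K}" "r + 1 < index_in K i" "i \<in> K" using big ii i K(3,4) by auto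
    obtain Is Js Ks where p': "p = (Is, Js, Ks)" by (metis prod_cases3)
    have kk: "(K, r) \<in> Ks" using K(2) p' by simp
    have "continuous_map (Params p) (product_topology (\<lambda>h. Proj r) {r + 2..card K})
        (\<lambda>q :: nat set \<times> nat \<Rightarrow> nat \<Rightarrow> (nat \<Rightarrow> 'k) set. q (K, r))"
      using continuous_map_product_projection[OF kk, of "\<lambda>(K, r). product_topology (\<lambda>h. Proj r) {r + 2..card K}"]
      by (simp add: Params_def p')
    from continuous_map_compose[OF this continuous_map_product_projection[OF h(1), of "\<lambda>h. Proj r"]]
    have "continuous_map (Params p) (Proj r) (\<lambda>q :: nat set \<times> nat \<Rightarrow> nat \<Rightarrow> (nat \<Rightarrow> 'k) set. q (K, r) (index_in K i))"
      by (simp add: o_def)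
    then show ?thesis
      unfolding K(4)[symmetric] unfolding K(1) rep_part_param[OF h(2,3)] .
  qed
qed

text \<open>After the fixed identification, each line of the tuple is the image of a line of a
  single summand under an injective linear map. The tuple so obtained depends continuously on
  \<open>q\<close>, and its orbit is the orbit of the flag.\<close>

lemma continuous_map_Fpq_orbit:
  assumes p: "p \<in> Pset n m"
  shows "continuous_map (Params p) (OrbitSpace n m)
    (\<lambda>q :: nat set \<times> nat \<Rightarrow> nat \<Rightarrow> (nat \<Rightarrow> 'k::real_normed_field) set. mflag_orbit n m (Fpq n p q))"
proof -
  obtain f :: "(coord \<Rightarrow> 'k) \<Rightarrow> nat \<Rightarrow> 'k" where f: "lin_iso f (bsum (summands n p) (\<lambda>s. Kpow (rk s))) (Kpow n)"
    using Fpq_identification[OF p] by (elim exE)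
  have lin: "lin_on f (bsum (summands n p) (\<lambda>s. Kpow (rk s)))" and inj: "inj_on f (bsum (summands n p) (\<lambda>s. Kpow (rk s)))"
    and img: "f ` bsum (summands n p) (\<lambda>s. Kpow (rk s)) = Kpow n"
    using f by (simp_all add: lin_iso_alt bij_betw_def)
  define Fq where "Fq q = (\<lambda>i\<in>{1..m}. f ` part (Fpq n p q) i)" for q
  have cont: "continuous_map (Params p) (Tuples n m) Fq"
    unfolding Tuples_def continuous_map_componentwise
  proof (intro conjI ballI)
    show "Fq ` topspace (Params p) \<subseteq> extensional {1..m}" by (auto simp: Fq_def)
    fix i assume i: "i \<in> {1..m}"
    obtain s where s: "s \<in> summands n p" "i \<in> blk s" using summands_cover[OF p i] by blast
    have embW: "emb s ` Kpow (rk s) \<subseteq> (bsum (summands n p) (\<lambda>s. Kpow (rk s)) :: (coord \<Rightarrow> 'k) set)"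
    proof (rule image_subsetI)
      fix y :: "nat \<Rightarrow> 'k" assume y: "y \<in> Kpow (rk s)"
      have "(0 :: nat \<Rightarrow> 'k) \<in> Kpow r" for r by (rule fvs.subspace_0[OF subspace_Kpow])
      then show "emb s y \<in> bsum (summands n p) (\<lambda>s. Kpow (rk s))" unfolding bsum_def using y s(1) by (simp add: cmp_emb)
    qed
    have "continuous_map (Proj (rk s)) (Proj n) (\<lambda>L. (f \<circ> emb s) ` L)"
    proof (rule continuous_map_Proj)
      show "lin_on (f \<circ> emb s) (Kpow (rk s))" by (rule lin_on_comp[OF lin_on_emb lin embW])
      show "inj_on (f \<circ> emb s) (Kpow (rk s))" by (rule comp_inj_on[OF inj_emb inj_on_subset[OF inj embW]])
      show "(f \<circ> emb s) ` Kpow (rk s) \<subseteq> Kpow n" using image_mono[OF embW, of f] img by (simp add: image_comp)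
    qed
    from continuous_map_compose[OF continuous_map_rep_part[OF p s] this]
    have "continuous_map (Params p) (Proj n) (\<lambda>q. (f \<circ> emb s) ` part (rep q s) i)" by (simp add: o_def)
    moreover have "(f \<circ> emb s) ` part (rep q s) i = Fq q i" for q
    proof -
      have "part (Fpq n p q) i = emb s ` part (rep q s) i"
        unfolding Fpq_alt by (rule part_bigsum_blk[OF p i s]) (rule rep_part_zero)
      then show ?thesis using i by (simp add: Fq_def image_comp)
    qed
    ultimately show "continuous_map (Params p) (Proj n) (\<lambda>q. Fq q i)" by simp
  qed
  have "mflag_orbit n m (Fpq n p q) = diag_orbit n m (Fq q)" if q: "q \<in> topspace (Params p)" for q
  proof -
    note val = topspace_Params_valid[OF p q]
    have "Fq q \<in> topspace (Tuples n m)" using continuous_map_image_subset_topspace[OF cont] q by blast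
    then have "Fq q \<in> lines m ` topspace (VT n m)" by (simp only: lines_surj)
    then obtain v where v: "Fq q = lines m v" "v \<in> topspace (VT n m)" by (elim imageE)
    have "f ` part (Fpq n p q) i = fvs.span {v i}" if "i \<in> {1..m}" for i
      using fun_cong[OF v(1), of i] that by (simp add: lines_def Fq_def)
    then have "mflag_iso m (Fpq n p q) (line_flag n v)"
      unfolding mflag_iso_def whole_Fpq using f by (intro exI[of _ f]) (simp add: line_flag_def)
    then have "mflag_orbit n m (line_flag n v) = mflag_orbit n m (Fpq n p q)"
      using mflag_orbit_eq_iff[OF VT_vecs[OF v(2)] subspace_Fpq[OF p val]] by simp
    then show ?thesis using diag_orbit_lines[OF VT_vecs[OF v(2)]] v(1) by simp
  qed
  then have eq: "(diag_orbit n m \<circ> Fq) q = mflag_orbit n m (Fpq n p q)" if "q \<in> topspace (Params p)" for q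
    using that by simp
  have "continuous_map (Params p) (OrbitSpace n m) (diag_orbit n m \<circ> Fq)"
    unfolding OrbitSpace_def
    by (rule continuous_map_compose[OF cont quotient_imp_continuous_map[OF quotient_map_quotient_topology]])
  then show ?thesis by (rule continuous_map_eq) (rule eq)
qed

text \<open>Provides a representative of every type, and with it surjectivity of
  \<open>\<pi>\<close>. The line of the first unit vector is available in each factor.\<close>

lemma Params_nonempty:
  assumes p: "p \<in> Pset n m"
  shows "\<exists>q :: nat set \<times> nat \<Rightarrow> nat \<Rightarrow> (nat \<Rightarrow> 'k::real_normed_field) set. q \<in> topspace (Params p)"
proof -
  obtain Is Js Ks where p': "p = (Is, Js, Ks)" by (metis prod_cases3)
  let ?L = "fvs.span {unit_vec 1} :: (nat \<Rightarrow> 'k) set"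
  let ?q = "\<lambda>(K, r)\<in>Ks. \<lambda>h\<in>{r + 2..card K}. ?L"
  have "?L \<in> topspace (Proj r)" if K: "(K, r) \<in> Ks" for K r
  proof -
    have "2 \<le> r" using param_summand(5)[OF p, of K r] K p' by simp
    then have "(unit_vec 1 :: nat \<Rightarrow> 'k) \<in> Kpow r - {0}" using unit_vec_in_Kpow[of 1 r] unit_vec_nonzero[of 1] by simp
    then show ?thesis unfolding topspace_Proj by (rule imageI)
  qed
  then have "?q \<in> topspace (Params p)" by (auto simp: Params_def p' PiE_iff)
  then show ?thesis by (intro exI)
qed

text \<open>Both sides are extensional in both arguments, so agreement at the relevant indices is
  enough.\<close>

lemma Params_eqI:
  assumes q: "q \<in> topspace (Params p :: (nat set \<times> nat \<Rightarrow> nat \<Rightarrow> (nat \<Rightarrow> 'k::real_normed_field) set) topology)"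
    and eq: "\<And>K r h. (K, r) \<in> snd (snd p) \<Longrightarrow> h \<in> {r + 2..card K} \<Longrightarrow> q (K, r) h = qparam p v (K, r) h"
  shows "qparam p v = q"
proof -
  obtain Is Js Ks where p': "p = (Is, Js, Ks)" by (metis prod_cases3)
  have ext: "q \<in> extensional Ks" "\<And>K r. (K, r) \<in> Ks \<Longrightarrow> q (K, r) \<in> extensional {r + 2..card K}"
    using q by (auto simp: Params_def p' PiE_iff Ball_def)
  show ?thesis
  proof
    fix k :: "nat set \<times> nat"
    obtain K r where k: "k = (K, r)" by (cases k)
    show "qparam p v k = q k"
    proof (cases "(K, r) \<in> Ks")
      case True
      show ?thesis
      proof
        fix h show "qparam p v k h = q k h"
        proof (cases "h \<in> {r + 2..card K}")
          case h: True then show ?thesis using eq[of K r h] True p' k by simp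
        next
          case False
          then have "q k h = undefined" using ext(2)[OF True] k by (simp add: extensional_def)
          moreover have "qparam p v k h = undefined"
            using False True p' k by (simp add: qparam_def restrict_def del: atLeastAtMost_iff)
          ultimately show ?thesis by simp
        qed
      qed
    next
      case False
      then show ?thesis using ext(1) k p' by (simp add: qparam_def extensional_def)
    qed
  qed
qed

lemma constructible_tuple_flag: "constructible n m p (tuple_flag n (lines m v)) \<longleftrightarrow> constructible n m p (line_flag n v)"
proof -
  have "mflag_iso m (tuple_flag n (lines m v)) E \<longleftrightarrow> mflag_iso m (line_flag n v) E" for E :: "(coord \<Rightarrow> 'a) mflag"
    by (simp add: mflag_iso_def tuple_flag_def line_flag_def lines_def)
  then show ?thesis unfolding constructible_alt by simp
qed

lemma constructible_orbit:
  assumes v: "v \<in> topspace (VT n m)" and w: "w \<in> topspace (VT n m)" and eq: "orb n m v = orb n m w"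
    and c: "constructible n m p (line_flag n v)"
  shows "constructible n m p (line_flag n w)"
proof -
  have "fvs.subspace (whole (line_flag n v))" by (simp add: line_flag_def)
  then have "mflag_iso m (line_flag n v) (line_flag n w)"
    using mflag_orbit_eq_iff[OF VT_vecs[OF w] _ line_flag_sub[OF VT_vecs[OF v]]] eq[symmetric] by (simp add: orb_def)
  then have iso: "mflag_iso m (line_flag n w) (line_flag n v)"
    by (rule mflag_iso_sym[OF _ _ line_flag_sub[OF VT_vecs[OF v]]]) (simp add: line_flag_def)
  obtain fam where fam: "\<forall>s\<in>summands n p. indecomposable m (fam s) \<and> has_dim m (fam s) (dvec (blk s) (rk s))"
    "mflag_iso m (line_flag n v) (bigsum n p fam)"
    using c unfolding constructible_alt by (elim exE conjE)
  show ?thesis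
    unfolding constructible_alt using fam(1) mflag_iso_trans[OF iso fam(2)] by (intro exI conjI)
qed

text \<open>Stated for a \<open>real_normed_field\<close>, so that the real and the complex case are
  instances of one proof.\<close>

theorem orbit_space_stratification:
  fixes n m :: nat
  shows "(\<forall>F \<in> topspace (Tuples n m :: (nat \<Rightarrow> (nat \<Rightarrow> 'k::real_normed_field) set) topology).
        \<exists>!p. p \<in> Pset n m \<and> constructible n m p (tuple_flag n F))
     \<and> (\<exists>\<pi> :: (nat \<Rightarrow> (nat \<Rightarrow> 'k) set) set \<Rightarrow> ptuple.
          (\<forall>F \<in> topspace (Tuples n m).
             \<pi> (diag_orbit n m F) = (THE p. p \<in> Pset n m \<and> constructible n m p (tuple_flag n F)))
        \<and> \<pi> ` topspace (OrbitSpace n m) = Pset n m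
        \<and> (\<forall>p \<in> Pset n m. open_dense_embedding (Params p)
             (subtopology (OrbitSpace n m) {\<omega> \<in> topspace (OrbitSpace n m). \<pi> \<omega> = p})
             (\<lambda>q. mflag_orbit n m (Fpq n p q))))"
proof -
  let ?VT = "topspace (VT n m :: (nat \<Rightarrow> nat \<Rightarrow> 'k) topology)"
  let ?T = "topspace (Tuples n m :: (nat \<Rightarrow> (nat \<Rightarrow> 'k) set) topology)"
  let ?P = "\<lambda>F p. p \<in> Pset n m \<and> constructible n m p (tuple_flag n F)"
  have lift: "\<exists>v\<in>?VT. F = lines m v" if "F \<in> ?T" for F
  proof -
    have "F \<in> lines m ` ?VT" using that by (simp only: lines_surj)
    then show ?thesis by (rule imageE) (intro bexI)
  qed
  have linesT: "lines m v \<in> ?T" if "v \<in> ?VT" for v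
    unfolding lines_surj[symmetric] using that by (rule imageI)
  have P_iff: "?P (lines m v) p \<longleftrightarrow> p \<in> Pset n m \<and> btype n m p v" if v: "v \<in> ?VT" for v p
    using constructible_iff_btype[OF _ VT_vecs[OF v], of p] by (simp add: constructible_tuple_flag cong: conj_cong)
  have ex1: "\<exists>!p. ?P (lines m v) p" if v: "v \<in> ?VT" for v
  proof -
    obtain p where p: "p \<in> Pset n m" "btype n m p v" using btype_exists[OF VT_vecs[OF v]] by (elim bexE)
    show ?thesis
    proof (rule ex1I[of _ p])
      show "?P (lines m v) p" unfolding P_iff[OF v] using p by simp
      show "p' = p" if "?P (lines m v) p'" for p'
        using that btype_unique[OF _ _ p, of p'] unfolding P_iff[OF v] by simp
    qed
  qed
  have part1: "\<forall>F\<in>?T. \<exists>!p. ?P F p"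
  proof
    fix F assume "F \<in> ?T"
    then obtain v where v: "v \<in> ?VT" "F = lines m v" using lift by blast
    show "\<exists>!p. ?P F p" unfolding v(2) by (rule ex1[OF v(1)])
  qed
  \<comment> \<open>The type is read off from an arbitrary tuple with orbit \<open>\<omega>\<close>;
    isomorphic flags have the same type, so the choice is immaterial.\<close>
  define \<pi> where "\<pi> \<omega> = (THE p. ?P (SOME F. F \<in> ?T \<and> diag_orbit n m F = \<omega>) p)" for \<omega>
  have pi_orb: "\<pi> (orb n m v) = (THE p. ?P (lines m v) p)" if v: "v \<in> ?VT" for v
  proof -
    let ?F = "SOME F. F \<in> ?T \<and> diag_orbit n m F = orb n m v"
    have "lines m v \<in> ?T \<and> diag_orbit n m (lines m v) = orb n m v" using linesT[OF v] orb_eq_diag[OF v] by simp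
    from someI[where P = "\<lambda>F. F \<in> ?T \<and> diag_orbit n m F = orb n m v", OF this]
    have F: "?F \<in> ?T \<and> diag_orbit n m ?F = orb n m v" .
    then obtain w where w: "w \<in> ?VT" "?F = lines m w" using lift by blast
    have "orb n m w = orb n m v" using F w orb_eq_diag[OF w(1)] by simp
    then have "constructible n m p (line_flag n w) \<longleftrightarrow> constructible n m p (line_flag n v)" for p
      using constructible_orbit[OF w(1) v, of p] constructible_orbit[OF v w(1), of p] by auto
    then have "?P ?F p \<longleftrightarrow> ?P (lines m v) p" for p unfolding w(2) constructible_tuple_flag by simp
    then show ?thesis unfolding \<pi>_def by simp
  qed
  have pi_iff: "\<pi> (orb n m v) = p \<longleftrightarrow> btype n m p v" if v: "v \<in> ?VT" and p: "p \<in> Pset n m" for v p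
  proof
    assume "\<pi> (orb n m v) = p"
    then have "?P (lines m v) p" using theI'[OF ex1[OF v]] pi_orb[OF v] by simp
    then show "btype n m p v" unfolding P_iff[OF v] by simp
  next
    assume "btype n m p v"
    then have "?P (lines m v) p" unfolding P_iff[OF v] using p by simp
    then show "\<pi> (orb n m v) = p" unfolding pi_orb[OF v] by (rule the1_equality[OF ex1[OF v]])
  qed
  have part2: "\<forall>F\<in>?T. \<pi> (diag_orbit n m F) = (THE p. ?P F p)"
  proof
    fix F assume "F \<in> ?T"
    then obtain v where v: "v \<in> ?VT" "F = lines m v" using lift by blast
    show "\<pi> (diag_orbit n m F) = (THE p. ?P F p)" using pi_orb[OF v(1)] orb_eq_diag[OF v(1)] v(2) by simp
  qed
  let ?e = "\<lambda>p (q :: nat set \<times> nat \<Rightarrow> nat \<Rightarrow> (nat \<Rightarrow> 'k) set). mflag_orbit n m (Fpq n p q)"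
  \<comment> \<open>Every vector tuple over the orbit of F(p,q) is of type \<open>p\<close>, is
    generic and returns \<open>q\<close>. This yields injectivity of the parametrisation and shows
    that its image is the image of the generic tuples.\<close>
  have te: "btype n m p v \<and> generic n p v \<and> qparam p v = q"
    if p: "p \<in> Pset n m" and q: "q \<in> topspace (Params p)" and v: "v \<in> ?VT" and eq: "orb n m v = ?e p q" for p q v
  proof -
    note val = topspace_Params_valid[OF p q]
    have "mflag_iso m (Fpq n p q) (line_flag n v)"
      using mflag_orbit_eq_iff[OF VT_vecs[OF v] subspace_Fpq[OF p val]] eq by (simp add: orb_def)
    then obtain f where f: "lin_iso f (whole (Fpq n p q)) (Kpow n)" "\<forall>i\<in>{1..m}. f ` part (Fpq n p q) i = fvs.span {v i}"
      by (auto simp: mflag_iso_def line_flag_def)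
    note nf = normal_form_unique[OF p VT_vecs[OF v] val f(1) bspec[OF f(2)]]
    have "qparam p v = q" by (rule Params_eqI[OF q]) (rule nf(3))
    then show ?thesis using nf(1,2) by simp
  qed
  have part3: "\<pi> ` topspace (OrbitSpace n m) = Pset n m"
  proof
    show "\<pi> ` topspace (OrbitSpace n m) \<subseteq> Pset n m"
      unfolding orb_surj[symmetric] image_image
    proof (rule image_subsetI)
      fix v :: "nat \<Rightarrow> nat \<Rightarrow> 'k" assume v: "v \<in> ?VT"
      show "\<pi> (orb n m v) \<in> Pset n m" using theI'[OF ex1[OF v]] pi_orb[OF v] by simp
    qed
    show "Pset n m \<subseteq> \<pi> ` topspace (OrbitSpace n m)"
    proof
      fix p assume p: "p \<in> Pset n m"
      obtain q :: "nat set \<times> nat \<Rightarrow> nat \<Rightarrow> (nat \<Rightarrow> 'k) set" where q: "q \<in> topspace (Params p)"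
        using Params_nonempty[OF p] by (elim exE)
      have "?e p q \<in> topspace (OrbitSpace n m)"
        using continuous_map_image_subset_topspace[OF continuous_map_Fpq_orbit[OF p]] q by blast
      then have "?e p q \<in> orb n m ` ?VT" by (simp only: orb_surj)
      then obtain v where v: "?e p q = orb n m v" "v \<in> ?VT" by (elim imageE)
      have "btype n m p v" using te[OF p q v(2) v(1)[symmetric]] by simp
      then have "p = \<pi> (orb n m v)" using pi_iff[OF v(2) p] by simp
      then show "p \<in> \<pi> ` topspace (OrbitSpace n m)" unfolding orb_surj[symmetric] using v(2) by simp
    qed
  qed
  have part4: "open_dense_embedding (Params p) (subtopology (OrbitSpace n m) {\<omega> \<in> topspace (OrbitSpace n m). \<pi> \<omega> = p}) (?e p)"
    if p: "p \<in> Pset n m" for p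
  proof (rule open_dense_embedding_from_cover[OF continuous_map_orb open_map_orb orb_surj])
    let ?S = "{v \<in> ?VT. btype n m p v}"
    let ?G = "{v \<in> ?VT. generic n p v}"
    show "{\<omega> \<in> topspace (OrbitSpace n m). \<pi> \<omega> = p} \<subseteq> topspace (OrbitSpace n m)" by auto
    have "orb n m v \<in> topspace (OrbitSpace n m)" if "v \<in> ?VT" for v
      unfolding orb_surj[symmetric] using that by (rule imageI)
    then show "?S = {v \<in> ?VT. orb n m v \<in> {\<omega> \<in> topspace (OrbitSpace n m). \<pi> \<omega> = p}}"
      using pi_iff[OF _ p] by auto
    show "continuous_map (Params p) (OrbitSpace n m) (?e p)" by (rule continuous_map_Fpq_orbit[OF p])
    show "openin (VT n m) ?G" by (rule openin_generic[OF p])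
    show "continuous_map (subtopology (VT n m) (?S \<inter> ?G)) (Params p) (qparam p)"
      by (rule continuous_map_qparam[OF p]) simp
    show "orb n m v = ?e p (qparam p v)" if v: "v \<in> ?S \<inter> ?G" for v
    proof -
      have v': "v \<in> ?VT" "btype n m p v" "generic n p v" using v by simp_all
      have "mflag_iso m (Fpq n p (qparam p v)) (line_flag n v)"
        using normal_form[OF p VT_vecs[OF v'(1)] v'(2,3)] by (simp add: mflag_iso_def line_flag_def)
      then show ?thesis
        using mflag_orbit_eq_iff[OF VT_vecs[OF v'(1)] subspace_Fpq[OF p valid_qparam[OF p VT_vecs[OF v'(1)] v'(2,3)]]]
        by (simp add: orb_def)
    qed
    show "v \<in> ?S \<inter> ?G \<and> qparam p v = q" if "q \<in> topspace (Params p)" "v \<in> ?VT" "orb n m v = ?e p q" for q v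
      using te[OF p that] that(2) by simp
    show "N \<inter> (?S \<inter> ?G) \<noteq> {}" if v: "v \<in> ?S" "openin (VT n m) N" "v \<in> N" for v N
    proof -
      have "\<exists>v'\<in>N. btype n m p v' \<and> generic n p v'"
        by (rule generic_dense[OF p _ _ v(2,3)]) (use v(1) in simp_all)
      then obtain v' where "v' \<in> N" "btype n m p v'" "generic n p v'" by (elim bexE conjE)
      moreover have "v' \<in> ?VT" using openin_subset[OF v(2)] \<open>v' \<in> N\<close> by (rule subsetD)
      ultimately show ?thesis by auto
    qed
  qed
  show ?thesis
    using part1 part2 part3 part4 by (intro conjI exI[of _ \<pi>]) simp_all
qed

theorem theorem1:
  fixes n m :: nat
  assumes "n \<ge> 2" and "m \<ge> 1"
  shows "finite (Pset n m) \<and>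
    ((\<forall>F \<in> topspace (Tuples n m :: (nat \<Rightarrow> (nat \<Rightarrow> real) set) topology).
        \<exists>!p. p \<in> Pset n m \<and> constructible n m p (tuple_flag n F))
     \<and> (\<exists>\<pi> :: (nat \<Rightarrow> (nat \<Rightarrow> real) set) set \<Rightarrow> ptuple.
          (\<forall>F \<in> topspace (Tuples n m).
             \<pi> (diag_orbit n m F) = (THE p. p \<in> Pset n m \<and> constructible n m p (tuple_flag n F)))
        \<and> \<pi> ` topspace (OrbitSpace n m) = Pset n m
        \<and> (\<forall>p \<in> Pset n m. open_dense_embedding (Params p)
             (subtopology (OrbitSpace n m) {\<omega> \<in> topspace (OrbitSpace n m). \<pi> \<omega> = p})
             (\<lambda>q. mflag_orbit n m (Fpq n p q)))))
    \<and>
    ((\<forall>F \<in> topspace (Tuples n m :: (nat \<Rightarrow> (nat \<Rightarrow> complex) set) topology).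
        \<exists>!p. p \<in> Pset n m \<and> constructible n m p (tuple_flag n F))
     \<and> (\<exists>\<pi> :: (nat \<Rightarrow> (nat \<Rightarrow> complex) set) set \<Rightarrow> ptuple.
          (\<forall>F \<in> topspace (Tuples n m).
             \<pi> (diag_orbit n m F) = (THE p. p \<in> Pset n m \<and> constructible n m p (tuple_flag n F)))
        \<and> \<pi> ` topspace (OrbitSpace n m) = Pset n m
        \<and> (\<forall>p \<in> Pset n m. open_dense_embedding (Params p)
             (subtopology (OrbitSpace n m) {\<omega> \<in> topspace (OrbitSpace n m). \<pi> \<omega> = p})
             (\<lambda>q. mflag_orbit n m (Fpq n p q)))))"
  by (intro conjI[OF finite_Pset] conjI[OF orbit_space_stratification orbit_space_stratification])

end
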